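(* Let $d\ge 2$ and let $K$ be a convex body in $\mathbb{R}^d$ with $C^1$ boundary. Then for every function $h:\mathbb{R}\to\mathbb{R}$ with continuous derivative such that $h(0)=0$, \[ \int\limits_{G\cap K\neq\emptyset} h(|G\cap K|)\,\mu_{d,1}(\mathrm{d}G)=\frac{1}{(d-1)\omega_d}\int\limits_{(\partial K)^2}\frac{h'(|x_1-x_2|)}{|x_1-x_2|^{d-2}}\cos\alpha_1\cos\alpha_2\cos\phi_0\,\sigma(\mathrm{d}x_1)\,\sigma(\mathrm{d}x_2). \] Here, for $x_1,x_2\in\partial K$, $\alpha_i$ ($i=1,2$) is the angle between the line through $x_1,x_2$ (containing the chord $[x_1,x_2]$) and its orthogonal projection onto the tangent hyperplane of $\partial K$ at $x_i$, and $\phi_0$ is the angle between the orthogonal projections of the normal vectors of $\partial K$ at $x_1$ and at $x_2$ onto the orthogonal complement of the line through $x_1,x_2$.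
   Context: $A_{d,1}$ is the set of affine lines in $\mathbb{R}^d$ with the rigid-motion-invariant Haar measure $\mu_{d,1}$ normalized so that the measure of the set of lines meeting the unit ball $\mathbb{B}^d$ equals $\kappa_{d-1}$, where $\kappa_k$ is the volume of the $k$-dimensional unit ball. $\omega_d=d\kappa_d$ is the surface area of the unit sphere $\mathbb{S}^{d-1}$. $|G\cap K|$ is the length of the chord $G\cap K$. $\sigma$ is the $(d-1)$-dimensional Hausdorff measure on $\partial K$. *)

theory Defs
  imports "HOL-Analysis.Analysis"
begin

definition convex_body :: "'a::euclidean_space set \<Rightarrow> bool" where
  "convex_body K \<longleftrightarrow> compact K \<and> convex K \<and> interior K \<noteq> {}"

definition C1_boundary :: "'a::euclidean_space set \<Rightarrow> bool" where
  "C1_boundary K \<longleftrightarrow>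
     (\<forall>x\<in>frontier K. \<exists>U g g'. open U \<and> x \<in> U \<and>
        (\<forall>y\<in>U. (g has_derivative (\<lambda>v. g' y \<bullet> v)) (at y)) \<and>
        continuous_on U g' \<and> (\<forall>y\<in>U. g' y \<noteq> 0) \<and>
        K \<inter> U = {y\<in>U. g y \<le> (0::real)})"

definition outer_normal :: "'a::euclidean_space set \<Rightarrow> 'a \<Rightarrow> 'a" where
  "outer_normal K x = (THE u. norm u = 1 \<and> (\<forall>y\<in>K. (y - x) \<bullet> u \<le> 0))"

abbreviation kappa :: "real \<Rightarrow> real" where "kappa s \<equiv> unit_ball_vol s"
definition omega :: "nat \<Rightarrow> real" where "omega d = real d * kappa (real d)"

text \<open>s-dimensional Hausdorff (outer) measure, normalized so that it agrees with
  Lebesgue measure on s-dimensional flats.\<close>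
definition hausdorff_pre :: "real \<Rightarrow> real \<Rightarrow> 'a::euclidean_space set \<Rightarrow> ennreal" where
  "hausdorff_pre s \<delta> A = (INF C \<in> {C :: nat \<Rightarrow> 'a set. A \<subseteq> (\<Union>i. C i) \<and>
        (\<forall>i. bounded (C i) \<and> diameter (C i) \<le> \<delta>)}.
        (\<Sum>i. ennreal (kappa s * (diameter (C i) / 2) powr s)))"

definition hausdorff_outer :: "real \<Rightarrow> 'a::euclidean_space set \<Rightarrow> ennreal" where
  "hausdorff_outer s A = (SUP \<delta> \<in> {0<..}. hausdorff_pre s \<delta> A)"

definition hausdorff_on :: "real \<Rightarrow> 'a::euclidean_space set \<Rightarrow> 'a measure" where
  "hausdorff_on s S = measure_of S (sets (restrict_space borel S)) (hausdorff_outer s)"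

definition line_through :: "'a::euclidean_space \<Rightarrow> 'a \<Rightarrow> 'a set" where
  "line_through y u = {y + t *\<^sub>R u | t. True}"

text \<open>Integration over the space A_{d,1} of affine lines w.r.t. the motion-invariant
  measure mu_{d,1}, normalized so that the lines meeting the unit ball have measure
  kappa_{d-1}:  int f d mu_{d,1} = (1/omega_d) int_{S^{d-1}} int_{u^perp} f(y + R u) dy du.\<close>
definition lines_integral :: "('a::euclidean_space set \<Rightarrow> real) \<Rightarrow> real" where
  "lines_integral f =
     (\<integral>u. (\<integral>y. f (line_through y u)
            \<partial>(hausdorff_on (real DIM('a) - 1) {y. y \<bullet> u = 0}))
        \<partial>(hausdorff_on (real DIM('a) - 1) (sphere 0 1))) / omega DIM('a)"

definition vangle :: "'a::euclidean_space \<Rightarrow> 'a \<Rightarrow> real" where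
  "vangle u v = arccos ((u \<bullet> v) / (norm u * norm v))"

definition proj_perp :: "'a::euclidean_space \<Rightarrow> 'a \<Rightarrow> 'a" where
  "proj_perp n v = v - (v \<bullet> n) *\<^sub>R n"

definition chord_dir :: "'a::euclidean_space \<Rightarrow> 'a \<Rightarrow> 'a" where
  "chord_dir x1 x2 = (x2 - x1) /\<^sub>R norm (x2 - x1)"

definition alpha_angle :: "'a::euclidean_space set \<Rightarrow> 'a \<Rightarrow> 'a \<Rightarrow> 'a \<Rightarrow> real" where
  "alpha_angle K x1 x2 x =
     vangle (chord_dir x1 x2) (proj_perp (outer_normal K x) (chord_dir x1 x2))"

definition phi0_angle :: "'a::euclidean_space set \<Rightarrow> 'a \<Rightarrow> 'a \<Rightarrow> real" where
  "phi0_angle K x1 x2 =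
     vangle (proj_perp (chord_dir x1 x2) (outer_normal K x1))
            (proj_perp (chord_dir x1 x2) (outer_normal K x2))"

end

theory Submission
  imports Defs
begin

text \<open>
  Write \<open>n\<^sub>i\<close> for the outer unit normal at \<open>x\<^sub>i\<close>, \<open>r = |x\<^sub>2 - x\<^sub>1|\<close> and \<open>u\<close> for the direction of the chord. The product of
  the three cosines is \<open>n\<^sub>1 \<bullet> n\<^sub>2 - (n\<^sub>1 \<bullet> u)(n\<^sub>2 \<bullet> u)\<close>, so for fixed \<open>x\<^sub>1\<close> the inner integral on the right is the flux
  through the boundary of the field \<open>h'(r) r\<^sup>2\<^sup>-\<^sup>d (n\<^sub>1 - (n\<^sub>1 \<bullet> u) u)\<close>, whose divergence is
  \<open>-(d-1) h'(r) r\<^sup>1\<^sup>-\<^sup>d (n\<^sub>1 \<bullet> u)\<close>. Integrating the divergence over \<open>K\<close> in polar coordinates around \<open>x\<^sub>1\<close>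
  turns \<open>h'\<close> into \<open>h\<close> of the length of the chord from \<open>x\<^sub>1\<close> in direction \<open>u\<close>. Exchanging the integrations over \<open>x\<^sub>1\<close> and
  \<open>u\<close> and projecting the boundary along \<open>u\<close>, where \<open>(-n\<^sub>1 \<bullet> u)\<^sup>+ d\<sigma>\<close> becomes the measure of the hyperplane
  \<open>u\<^sup>\<bottom>\<close>, gives the integral over lines.

  On hyperplanes the Hausdorff measure of dimension \<open>d - 1\<close> is only needed up to a constant factor (\<open>slice_const\<close> below):
  both sides contain exactly two integrations against this measure, so the factor cancels and the isodiametric
  inequality is not used.
\<close>

section \<open>Hausdorff measure\<close>

locale metric_outer_measure =
  fixes \<mu> :: "'a::metric_space set \<Rightarrow> ennreal"
  assumes empty: "\<mu> {} = 0"
    and mono: "A \<subseteq> B \<Longrightarrow> \<mu> A \<le> \<mu> B"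
    and countably_subadditive: "\<mu> (\<Union>i::nat. C i) \<le> (\<Sum>i. \<mu> (C i))"
    and separated: "0 < e \<Longrightarrow> (\<And>a b. a \<in> A \<Longrightarrow> b \<in> B \<Longrightarrow> e \<le> dist a b) \<Longrightarrow> \<mu> A + \<mu> B \<le> \<mu> (A \<union> B)"
begin

lemma Un_le: "\<mu> (A \<union> B) \<le> \<mu> A + \<mu> B"
  using countably_subadditive[of "binaryset A B"] by (simp add: UN_binaryset_eq suminf_binaryset_eq empty)

definition away :: "'a set \<Rightarrow> 'a set \<Rightarrow> nat \<Rightarrow> 'a set" where
  "away C X n = {x\<in>X. 1 \<le> real n * infdist x C}"

definition shell :: "'a set \<Rightarrow> 'a set \<Rightarrow> nat \<Rightarrow> 'a set" where
  "shell C X n = away C X (Suc n) - away C X n"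

lemma away_subset: "away C X n \<subseteq> X"
  by (auto simp: away_def)

lemma away_mono: "m \<le> n \<Longrightarrow> away C X m \<subseteq> away C X n"
  by (force simp: away_def intro: order_trans mult_right_mono infdist_nonneg)

lemma away_shell_additive: "\<mu> (away C X (n - 1)) + \<mu> (shell C X n) \<le> \<mu> (away C X (Suc n))"
proof (cases "n - 1")
  case 0
  then show ?thesis by (auto simp: away_def[of C X 0] empty shell_def intro!: mono)
next
  case (Suc m)
  then have n: "n = Suc (Suc m)" by simp
  have "\<mu> (away C X (n - 1)) + \<mu> (shell C X n) \<le> \<mu> (away C X (Suc m) \<union> shell C X n)"
    unfolding Suc
  proof (rule separated)
    show "0 < 1 / real (Suc m) - 1 / real n" by (simp add: n frac_less2)
    fix a b assume "a \<in> away C X (Suc m)" "b \<in> shell C X n"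
    then have "1 / real (Suc m) \<le> infdist a C" "infdist b C \<le> 1 / real n"
      by (auto simp: away_def shell_def n field_simps)
    then show "1 / real (Suc m) - 1 / real n \<le> dist a b" using infdist_triangle[of a C b] by linarith
  qed
  also have "\<dots> \<le> \<mu> (away C X (Suc n))"
    using away_mono[of "Suc m" "Suc n" C X] n by (intro mono) (auto simp: shell_def)
  finally show ?thesis .
qed

text \<open>Two shells whose indices differ by two are a positive distance apart, so \<open>\<mu>\<close> is additive on the shells of
  even and on those of odd index.\<close>

lemma suminf_shell_le: "(\<Sum>i. \<mu> (shell C X i)) \<le> \<mu> X + \<mu> X"
proof -
  have every_other: "(\<Sum>i<n. \<mu> (shell C X (2 * i + k))) \<le> \<mu> (away C X (2 * n + k - 1))" for n k
  proof (induction n)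
    case (Suc n)
    have "(\<Sum>i<Suc n. \<mu> (shell C X (2 * i + k))) \<le> \<mu> (away C X (2 * n + k - 1)) + \<mu> (shell C X (2 * n + k))"
      using Suc by (simp add: add_right_mono)
    also have "\<dots> \<le> \<mu> (away C X (Suc (2 * n + k)))" by (rule away_shell_additive)
    finally show ?case by simp
  qed simp
  have "(\<Sum>i<n. \<mu> (shell C X i)) \<le> \<mu> X + \<mu> X" for n
  proof -
    have "(\<Sum>i<n. \<mu> (shell C X i)) \<le> (\<Sum>i<2 * n. \<mu> (shell C X i))" by (intro sum_mono2) auto
    also have "\<dots> = (\<Sum>i<n. \<mu> (shell C X (2 * i + 0))) + (\<Sum>i<n. \<mu> (shell C X (2 * i + 1)))"
      by (induction n) (auto simp: algebra_simps)
    also have "\<dots> \<le> \<mu> X + \<mu> X"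
      by (intro add_mono order_trans[OF every_other] mono away_subset)
    finally show ?thesis .
  qed
  then show ?thesis by (subst suminf_eq_SUP) (auto intro: SUP_least)
qed

lemma Diff_closed_subset_away_Un_shells:
  assumes "closed C" "C \<noteq> {}"
  shows "X - C \<subseteq> away C X n \<union> (\<Union>i. shell C X (i + n))"
proof
  fix x assume x: "x \<in> X - C"
  then have "0 < infdist x C" using assms by (simp add: infdist_pos_not_in_closed)
  then obtain m where "1 / infdist x C < real m" using reals_Archimedean2 by blast
  then have m: "x \<in> away C X m" using x \<open>0 < infdist x C\<close> by (simp add: away_def field_simps)
  show "x \<in> away C X n \<union> (\<Union>i. shell C X (i + n))"
  proof (cases "x \<in> away C X n")
    case False
    define k where "k = (LEAST k. x \<in> away C X k)"
    have k: "x \<in> away C X k" unfolding k_def by (rule LeastI[of _ m]) (rule m)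
    then have nk: "n < k" using away_mono[of k n C X] False by (meson not_le subsetD)
    then have "x \<notin> away C X (k - 1)" using not_less_Least[of "k - 1" "\<lambda>k. x \<in> away C X k"] unfolding k_def by auto
    then have "x \<in> shell C X ((k - 1 - n) + n)" using k nk by (simp add: shell_def)
    then show ?thesis by blast
  qed simp
qed

lemma Int_away_additive: "\<mu> (X \<inter> C) + \<mu> (away C X n) \<le> \<mu> X"
proof (cases "n = 0")
  case False
  have "\<mu> (X \<inter> C) + \<mu> (away C X n) \<le> \<mu> ((X \<inter> C) \<union> away C X n)"
  proof (rule separated)
    show "0 < 1 / real n" using False by simp
    fix a b assume ab: "a \<in> X \<inter> C" "b \<in> away C X n"
    then have "1 / real n \<le> infdist b C" using False by (auto simp: away_def field_simps)
    also have "\<dots> \<le> dist b a" using ab by (intro infdist_le) auto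
    finally show "1 / real n \<le> dist a b" by (simp add: dist_commute)
  qed
  also have "\<dots> \<le> \<mu> X" using away_subset by (intro mono) auto
  finally show ?thesis .
qed (auto simp: away_def empty intro: mono)

lemma caratheodory_closed:
  assumes "closed C"
  shows "\<mu> (X \<inter> C) + \<mu> (X - C) \<le> \<mu> X"
proof (cases "C = {} \<or> \<mu> X = top")
  case False
  define total where "total = (\<Sum>i. \<mu> (shell C X i))"
  have total_finite: "total < top"
    unfolding total_def using suminf_shell_le[of C X] False by (auto simp: less_top order_le_less_trans)
  have "\<mu> (X \<inter> C) + \<mu> (X - C) + (\<Sum>i<n. \<mu> (shell C X i)) \<le> \<mu> X + total" for n
  proof -
    have "\<mu> (X - C) \<le> \<mu> (away C X n) + \<mu> (\<Union>i. shell C X (i + n))"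
      using Diff_closed_subset_away_Un_shells[OF assms] False by (intro order_trans[OF mono Un_le]) auto
    also have "\<dots> \<le> \<mu> (away C X n) + (\<Sum>i. \<mu> (shell C X (i + n)))"
      by (intro add_left_mono countably_subadditive)
    finally have "\<mu> (X \<inter> C) + \<mu> (X - C) + (\<Sum>i<n. \<mu> (shell C X i))
        \<le> \<mu> (X \<inter> C) + (\<mu> (away C X n) + (\<Sum>i. \<mu> (shell C X (i + n)))) + (\<Sum>i<n. \<mu> (shell C X i))"
      by (intro add_left_mono add_right_mono)
    also have "\<dots> = (\<mu> (X \<inter> C) + \<mu> (away C X n)) + total"
      unfolding total_def by (subst suminf_offset[of _ n]) (simp_all add: ac_simps)
    also have "\<dots> \<le> \<mu> X + total" by (intro add_right_mono Int_away_additive)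
    finally show ?thesis .
  qed
  moreover have "(\<lambda>n. \<Sum>i<n. \<mu> (shell C X i)) \<longlonglongrightarrow> total"
    unfolding total_def by (rule summable_LIMSEQ) auto
  ultimately have "\<mu> (X \<inter> C) + \<mu> (X - C) + total \<le> \<mu> X + total"
    by (intro LIMSEQ_le_const2[OF tendsto_add[OF tendsto_const]]) auto
  then show ?thesis using total_finite by (auto simp: ennreal_add_left_cancel_le add.commute[of _ total])
qed (auto simp: empty)

theorem measure_space_borel: "measure_space UNIV (sets borel) \<mu>"
proof -
  have outer: "outer_measure_space (Pow UNIV) \<mu>"
    unfolding outer_measure_space_def positive_def increasing_def countably_subadditive_def
    by (auto intro: empty mono countably_subadditive)
  let ?L = "lambda_system UNIV (Pow UNIV) \<mu>"
  have lambda_measure_space: "measure_space UNIV ?L \<mu>"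
    by (rule sigma_algebra.caratheodory_lemma[OF sigma_algebra_Pow outer])
  have "C \<in> ?L" if "closed C" for C
    using caratheodory_closed[OF that] Un_le[of "_ \<inter> C" "_ - C"]
    by (subst algebra.lambda_system_eq[OF algebra_Pow], intro CollectI conjI ballI antisym)
       (simp_all, metis Int_Diff_Un)
  then have "sigma_sets UNIV {C. closed C} \<subseteq> ?L"
    using lambda_measure_space by (intro sigma_algebra.sigma_sets_subset) (auto simp: measure_space_def)
  then show ?thesis
    by (intro measure_down[OF lambda_measure_space]) (auto simp: borel_eq_closed sigma_algebra_sigma_sets)
qed

end

lemma hausdorff_pre_le_cover:
  assumes "A \<subseteq> (\<Union>i. C i)" "\<And>i. bounded (C i)" "\<And>i. diameter (C i) \<le> \<delta>"
  shows "hausdorff_pre s \<delta> A \<le> (\<Sum>i. ennreal (kappa s * (diameter (C i) / 2) powr s))"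
  unfolding hausdorff_pre_def using assms by (intro INF_lower) auto

lemma hausdorff_pre_less_imp_cover:
  fixes A :: "'a::euclidean_space set"
  assumes "hausdorff_pre s \<delta> A < r"
  obtains C :: "nat \<Rightarrow> 'a set" where "A \<subseteq> (\<Union>i. C i)" "\<And>i. bounded (C i)" "\<And>i. diameter (C i) \<le> \<delta>"
    "(\<Sum>i. ennreal (kappa s * (diameter (C i) / 2) powr s)) < r"
  using assms unfolding hausdorff_pre_def INF_less_iff by auto

lemma hausdorff_pre_mono: "A \<subseteq> B \<Longrightarrow> hausdorff_pre s \<delta> A \<le> hausdorff_pre s \<delta> B"
  unfolding hausdorff_pre_def by (intro INF_superset_mono) auto

lemma hausdorff_pre_antimono: "\<delta> \<le> \<delta>' \<Longrightarrow> hausdorff_pre s \<delta>' A \<le> hausdorff_pre s \<delta> A"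
  unfolding hausdorff_pre_def by (intro INF_superset_mono) (auto intro: order_trans)

lemma hausdorff_pre_le_diameter:
  assumes "bounded A" "diameter A \<le> \<delta>"
  shows "hausdorff_pre s \<delta> A \<le> ennreal (kappa s * (diameter A / 2) powr s)"
proof -
  let ?C = "binaryset A {}"
  have "0 \<le> \<delta>" using assms diameter_ge_0 by fastforce
  then have "hausdorff_pre s \<delta> A \<le> (\<Sum>i. ennreal (kappa s * (diameter (?C i) / 2) powr s))"
    using assms UN_binaryset_eq[of A "{}"] by (intro hausdorff_pre_le_cover) (auto simp: binaryset_def)
  also have "\<dots> = ennreal (kappa s * (diameter A / 2) powr s)"
    by (subst suminf_binaryset_eq[where f="\<lambda>A. ennreal (kappa s * (diameter A / 2) powr s)"]) auto
  finally show ?thesis .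
qed

lemma hausdorff_pre_empty [simp]: "0 \<le> \<delta> \<Longrightarrow> hausdorff_pre s \<delta> {} = 0"
  using hausdorff_pre_le_diameter[of "{}" \<delta> s] by simp

lemma hausdorff_pre_countably_subadditive:
  fixes A :: "nat \<Rightarrow> 'a::euclidean_space set"
  shows "hausdorff_pre s \<delta> (\<Union>i. A i) \<le> (\<Sum>i. hausdorff_pre s \<delta> (A i))"
proof (rule ennreal_le_epsilon)
  fix e :: real assume e: "0 < e" and finite_sum: "(\<Sum>i. hausdorff_pre s \<delta> (A i)) < top"
  let ?w = "\<lambda>C :: 'a set. ennreal (kappa s * (diameter C / 2) powr s)"
  have "hausdorff_pre s \<delta> (A i) < hausdorff_pre s \<delta> (A i) + ennreal (e * (1/2) ^ Suc i)" for i
    using ennreal_suminf_lessD[OF finite_sum, of i] e by (simp add: ennreal_add_left_cancel_less less_top)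
  then have "\<exists>C. A i \<subseteq> (\<Union>j. C j) \<and> (\<forall>j. bounded (C j) \<and> diameter (C j) \<le> \<delta>)
      \<and> (\<Sum>j. ?w (C j)) < hausdorff_pre s \<delta> (A i) + ennreal (e * (1/2) ^ Suc i)" for i
    by (rule hausdorff_pre_less_imp_cover) blast
  then obtain C where C: "\<And>i. A i \<subseteq> (\<Union>j. C i j)" "\<And>i j. bounded (C i j)" "\<And>i j. diameter (C i j) \<le> \<delta>"
      "\<And>i. (\<Sum>j. ?w (C i j)) < hausdorff_pre s \<delta> (A i) + ennreal (e * (1/2) ^ Suc i)"
    by metis
  let ?D = "\<lambda>n. C (fst (prod_decode n)) (snd (prod_decode n))"
  have "hausdorff_pre s \<delta> (\<Union>i. A i) \<le> (\<Sum>n. ?w (?D n))"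
  proof (intro hausdorff_pre_le_cover)
    show "(\<Union>i. A i) \<subseteq> (\<Union>n. ?D n)"
    proof
      fix x assume "x \<in> (\<Union>i. A i)"
      then obtain i j where "x \<in> C i j" using C(1) by blast
      then show "x \<in> (\<Union>n. ?D n)" by (auto intro!: exI[of _ "prod_encode (i,j)"])
    qed
  qed (use C in auto)
  also have "\<dots> = (\<Sum>i. \<Sum>j. ?w (C i j))"
    using suminf_ennreal_2dimen[of "\<lambda>i. \<Sum>j. ?w (C i j)" "\<lambda>p. ?w (C (fst p) (snd p))"] by simp
  also have "\<dots> \<le> (\<Sum>i. hausdorff_pre s \<delta> (A i) + ennreal (e * (1/2) ^ Suc i))"
    using C(4) by (intro suminf_le) (auto intro: less_imp_le)
  also have "\<dots> = (\<Sum>i. hausdorff_pre s \<delta> (A i)) + (\<Sum>i. ennreal (e * (1/2) ^ Suc i))"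
    by (intro suminf_add[symmetric]) auto
  also have "(\<Sum>i. ennreal (e * (1/2) ^ Suc i)) = ennreal e"
    using e sums_mult[OF power_half_series, of e] by (intro suminf_ennreal_eq) auto
  finally show "hausdorff_pre s \<delta> (\<Union>i. A i) \<le> (\<Sum>i. hausdorff_pre s \<delta> (A i)) + ennreal e" .
qed

lemma hausdorff_pre_finitely_subadditive:
  assumes "finite I" "0 \<le> \<delta>"
  shows "hausdorff_pre s \<delta> (\<Union>i\<in>I. A i) \<le> (\<Sum>i\<in>I. hausdorff_pre s \<delta> (A i))"
  using assms(1)
proof induction
  case (insert a F)
  have "hausdorff_pre s \<delta> (A a \<union> (\<Union>i\<in>F. A i)) \<le> hausdorff_pre s \<delta> (A a) + hausdorff_pre s \<delta> (\<Union>i\<in>F. A i)"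
    using hausdorff_pre_countably_subadditive[of s \<delta> "binaryset (A a) (\<Union>i\<in>F. A i)"] assms(2)
    by (simp add: UN_binaryset_eq suminf_binaryset_eq)
  then show ?case using insert by (auto intro: order_trans add_mono)
qed (use assms in simp)

lemma hausdorff_pre_separated:
  assumes sep: "\<And>a b. a \<in> A \<Longrightarrow> b \<in> B \<Longrightarrow> \<delta> < dist a b"
  shows "hausdorff_pre s \<delta> A + hausdorff_pre s \<delta> B \<le> hausdorff_pre s \<delta> (A \<union> B)"
  unfolding hausdorff_pre_def[of s \<delta> "A \<union> B"]
proof (rule INF_greatest, clarify)
  fix C :: "nat \<Rightarrow> 'a set"
  assume C: "A \<union> B \<subseteq> (\<Union>i. C i)" "\<forall>i. bounded (C i) \<and> diameter (C i) \<le> \<delta>"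
  let ?w = "\<lambda>C :: 'a set. ennreal (kappa s * (diameter C / 2) powr s)"
  let ?meet = "\<lambda>X i. if C i \<inter> X = {} then {} else C i"
  have "0 \<le> \<delta>" using C(2) diameter_ge_0 by (meson order_trans)
  then have meet: "hausdorff_pre s \<delta> X \<le> (\<Sum>i. ?w (?meet X i))" if "X \<subseteq> A \<union> B" for X
    using C that by (intro hausdorff_pre_le_cover) (fastforce split: if_splits)+
  have meets_one: "C i \<inter> A = {} \<or> C i \<inter> B = {}" for i
  proof (rule ccontr)
    assume "\<not> ?thesis"
    then obtain a b where "a \<in> C i" "a \<in> A" "b \<in> C i" "b \<in> B" by auto
    then have "\<delta> < dist a b" "dist a b \<le> diameter (C i)" "diameter (C i) \<le> \<delta>"
      using sep C(2) by (auto intro: diameter_bounded_bound)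
    then show False by linarith
  qed
  have "hausdorff_pre s \<delta> A + hausdorff_pre s \<delta> B \<le> (\<Sum>i. ?w (?meet A i)) + (\<Sum>i. ?w (?meet B i))"
    by (intro add_mono meet) auto
  also have "\<dots> = (\<Sum>i. ?w (?meet A i) + ?w (?meet B i))" by (intro suminf_add) auto
  also have "\<dots> \<le> (\<Sum>i. ?w (C i))"
  proof (rule suminf_le)
    fix i show "?w (?meet A i) + ?w (?meet B i) \<le> ?w (C i)" using meets_one[of i] by auto
  qed auto
  finally show "hausdorff_pre s \<delta> A + hausdorff_pre s \<delta> B \<le> (\<Sum>i. ?w (C i))" .
qed

lemma hausdorff_outer_mono: "A \<subseteq> B \<Longrightarrow> hausdorff_outer s A \<le> hausdorff_outer s B"
  unfolding hausdorff_outer_def by (intro SUP_mono) (auto intro: hausdorff_pre_mono)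

lemma hausdorff_pre_le_outer: "0 < \<delta> \<Longrightarrow> hausdorff_pre s \<delta> A \<le> hausdorff_outer s A"
  unfolding hausdorff_outer_def by (intro SUP_upper) auto

lemma hausdorff_outer_leI: "(\<And>\<delta>. 0 < \<delta> \<Longrightarrow> hausdorff_pre s \<delta> A \<le> c) \<Longrightarrow> hausdorff_outer s A \<le> c"
  unfolding hausdorff_outer_def by (intro SUP_least) auto

lemma hausdorff_outer_countably_subadditive:
  "hausdorff_outer s (\<Union>i::nat. A i) \<le> (\<Sum>i. hausdorff_outer s (A i))"
  by (intro hausdorff_outer_leI order_trans[OF hausdorff_pre_countably_subadditive] suminf_le)
     (auto intro: hausdorff_pre_le_outer)

lemma hausdorff_outer_singleton [simp]: "hausdorff_outer s {p} = 0"
proof -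
  have "hausdorff_outer s {p} \<le> 0"
    by (rule hausdorff_outer_leI) (use hausdorff_pre_le_diameter[of "{p}" _ s] in simp)
  then show ?thesis by simp
qed

lemma hausdorff_outer_eq_SUP: "hausdorff_outer s A = (SUP n. hausdorff_pre s (1 / Suc n) A)"
proof (rule antisym)
  show "hausdorff_outer s A \<le> (SUP n. hausdorff_pre s (1 / Suc n) A)"
  proof (rule hausdorff_outer_leI)
    fix \<delta> :: real assume "0 < \<delta>"
    then obtain n :: nat where "1 / Suc n < \<delta>" using nat_approx_posE by blast
    then show "hausdorff_pre s \<delta> A \<le> (SUP n. hausdorff_pre s (1 / Suc n) A)"
      by (intro SUP_upper2[of n] hausdorff_pre_antimono) auto
  qed
qed (auto intro!: SUP_least hausdorff_pre_le_outer)

lemma hausdorff_outer_separated: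
  assumes "0 < e" and sep: "\<And>a b. a \<in> A \<Longrightarrow> b \<in> B \<Longrightarrow> e \<le> dist a b"
  shows "hausdorff_outer s A + hausdorff_outer s B \<le> hausdorff_outer s (A \<union> B)"
proof -
  obtain N :: nat where N: "1 / Suc N < e" using nat_approx_posE[OF assms(1)] by auto
  have increasing: "incseq (\<lambda>n. hausdorff_pre s (1 / Suc n) X)" for X :: "'a set"
    by (intro incseq_SucI hausdorff_pre_antimono) (simp add: field_simps)
  have "hausdorff_outer s A + hausdorff_outer s B
      = (SUP n. hausdorff_pre s (1 / Suc n) A + hausdorff_pre s (1 / Suc n) B)"
    unfolding hausdorff_outer_eq_SUP by (rule ennreal_SUP_add[symmetric]) (rule increasing)+
  also have "\<dots> \<le> hausdorff_outer s (A \<union> B)"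
  proof (rule SUP_least)
    fix n :: nat
    let ?d = "1 / Suc (max n N) :: real"
    have d: "?d \<le> 1 / Suc n" "?d \<le> 1 / Suc N" by (auto simp: field_simps)
    have "hausdorff_pre s (1 / Suc n) A + hausdorff_pre s (1 / Suc n) B
        \<le> hausdorff_pre s ?d A + hausdorff_pre s ?d B"
      by (intro add_mono hausdorff_pre_antimono d)
    also have "\<dots> \<le> hausdorff_pre s ?d (A \<union> B)"
      using sep d N by (intro hausdorff_pre_separated) force
    also have "\<dots> \<le> hausdorff_outer s (A \<union> B)" by (intro hausdorff_pre_le_outer) auto
    finally show "hausdorff_pre s (1 / Suc n) A + hausdorff_pre s (1 / Suc n) B \<le> hausdorff_outer s (A \<union> B)" .
  qed
  finally show ?thesis .
qed

interpretation hausdorff_outer: metric_outer_measure "hausdorff_outer s"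
proof
  show "hausdorff_outer s {} = 0"
    using hausdorff_outer_mono[of "{}" "{0}" s] by simp
qed (rule hausdorff_outer_mono hausdorff_outer_countably_subadditive hausdorff_outer_separated; assumption)+

definition hausdorff_measure :: "real \<Rightarrow> 'a::euclidean_space measure" where
  "hausdorff_measure s = measure_of UNIV (sets borel) (hausdorff_outer s)"

lemma sets_hausdorff_measure [simp, measurable_cong]: "sets (hausdorff_measure s) = sets borel"
  unfolding hausdorff_measure_def using sets.sigma_sets_eq[of borel] by auto

lemma space_hausdorff_measure [simp]: "space (hausdorff_measure s) = UNIV"
  unfolding hausdorff_measure_def by simp

lemma emeasure_hausdorff_measure: "A \<in> sets borel \<Longrightarrow> emeasure (hausdorff_measure s) A = hausdorff_outer s A"
  using hausdorff_outer.measure_space_borel[of s]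
  by (intro emeasure_measure_of[OF hausdorff_measure_def]) (auto simp: measure_space_def)

lemma hausdorff_on_eq_restrict:
  assumes "S \<in> sets borel"
  shows "hausdorff_on s S = restrict_space (hausdorff_measure s) S"
proof -
  let ?R = "restrict_space (hausdorff_measure s) S"
  have sets: "sets ?R = sets (restrict_space borel S)" by (intro sets_restrict_space_cong) simp
  have "?R = measure_of S (sets ?R) (emeasure ?R)"
    using measure_of_of_measure[of ?R] by (simp add: space_restrict_space)
  also have "\<dots> = hausdorff_on s S"
    unfolding hausdorff_on_def sets
  proof (rule measure_of_eq)
    show "sets (restrict_space borel S) \<subseteq> Pow S"
      using sets.space_closed[of "restrict_space borel S"] by (simp add: space_restrict_space)
    fix A assume "A \<in> sigma_sets S (sets (restrict_space borel S))"
    then have "A \<in> sets (restrict_space borel S)"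
      using sets.sigma_sets_eq[of "restrict_space borel S"] by (simp add: space_restrict_space)
    then have "A \<in> sets borel" "A \<subseteq> S" using assms by (auto simp: sets_restrict_space_iff)
    then show "emeasure ?R A = hausdorff_outer s A"
      using assms by (subst emeasure_restrict_space) (auto simp: emeasure_hausdorff_measure)
  qed
  finally show ?thesis by simp
qed

lemma lipschitz_image_Int_diameter:
  fixes f :: "'a::metric_space \<Rightarrow> 'b::real_normed_vector"
  assumes f: "L-lipschitz_on A f" and C: "bounded C"
  shows "bounded (f ` (C \<inter> A))" "diameter (f ` (C \<inter> A)) \<le> L * diameter C"
proof -
  have image_dist_le: "dist (f x) (f y) \<le> L * diameter C" if "x \<in> C \<inter> A" "y \<in> C \<inter> A" for x y
    using lipschitz_onD[OF f, of x y] lipschitz_on_nonneg[OF f] diameter_bounded_bound[OF C, of x y] that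
    by (meson IntE mult_left_mono order_trans)
  show "bounded (f ` (C \<inter> A))" using image_dist_le by (force simp: bounded_two_points)
  show "diameter (f ` (C \<inter> A)) \<le> L * diameter C"
    using lipschitz_on_nonneg[OF f] diameter_ge_0[OF C] by (intro diameter_le) (auto simp flip: dist_norm intro: image_dist_le)
qed

lemma lipschitz_image_Int_diameter_powr:
  fixes f :: "'a::metric_space \<Rightarrow> 'b::real_normed_vector"
  assumes f: "L-lipschitz_on A f" and C: "bounded C" and s: "0 \<le> s"
  shows "ennreal (kappa s * (diameter (f ` (C \<inter> A)) / 2) powr s)
    \<le> ennreal (L powr s) * ennreal (kappa s * (diameter C / 2) powr s)"
proof -
  have "(diameter (f ` (C \<inter> A)) / 2) powr s \<le> (L * (diameter C / 2)) powr s"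
    using lipschitz_image_Int_diameter[OF f C] s diameter_ge_0 by (intro powr_mono2) auto
  also have "\<dots> = L powr s * (diameter C / 2) powr s" by (rule powr_mult)
  finally have "kappa s * (diameter (f ` (C \<inter> A)) / 2) powr s \<le> L powr s * (kappa s * (diameter C / 2) powr s)"
    using s unit_ball_vol_nonneg[of s] by (metis mult.left_commute mult_left_mono)
  then show ?thesis by (subst ennreal_mult'[symmetric]) (auto intro: ennreal_leI)
qed

lemma hausdorff_pre_lipschitz:
  fixes f :: "'a::euclidean_space \<Rightarrow> 'b::euclidean_space"
  assumes f: "L-lipschitz_on A f" and L: "0 < L" and s: "0 \<le> s"
  shows "hausdorff_pre s \<delta> (f ` A) \<le> ennreal (L powr s) * hausdorff_pre s (\<delta> / L) A"
proof (rule ennreal_le_epsilon)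
  fix e :: real assume e: "0 < e" and finite_bound: "ennreal (L powr s) * hausdorff_pre s (\<delta> / L) A < top"
  have Ls: "0 < L powr s" using L by simp
  then have "hausdorff_pre s (\<delta> / L) A < hausdorff_pre s (\<delta> / L) A + ennreal (e / L powr s)"
    using e finite_bound by (auto simp: ennreal_add_left_cancel_less ennreal_mult_less_top less_top)
  then obtain C :: "nat \<Rightarrow> 'a set" where C: "A \<subseteq> (\<Union>i. C i)" "\<And>i. bounded (C i)" "\<And>i. diameter (C i) \<le> \<delta> / L"
    and small: "(\<Sum>i. ennreal (kappa s * (diameter (C i) / 2) powr s)) < hausdorff_pre s (\<delta> / L) A + ennreal (e / L powr s)"
    by (rule hausdorff_pre_less_imp_cover) blast
  note image = lipschitz_image_Int_diameter[OF f C(2)]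
  have "hausdorff_pre s \<delta> (f ` A) \<le> (\<Sum>i. ennreal (kappa s * (diameter (f ` (C i \<inter> A)) / 2) powr s))"
  proof (rule hausdorff_pre_le_cover)
    show "f ` A \<subseteq> (\<Union>i. f ` (C i \<inter> A))" using C(1) by blast
    show "diameter (f ` (C i \<inter> A)) \<le> \<delta>" for i
      using image(2)[of i] C(3)[of i] L by (auto simp: field_simps intro: order_trans)
  qed (rule image(1))
  also have "\<dots> \<le> (\<Sum>i. ennreal (L powr s) * ennreal (kappa s * (diameter (C i) / 2) powr s))"
    by (intro suminf_le lipschitz_image_Int_diameter_powr[OF f C(2) s]) auto
  also have "\<dots> = ennreal (L powr s) * (\<Sum>i. ennreal (kappa s * (diameter (C i) / 2) powr s))" by simp
  also have "\<dots> \<le> ennreal (L powr s) * (hausdorff_pre s (\<delta> / L) A + ennreal (e / L powr s))"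
    by (rule mult_left_mono[OF less_imp_le[OF small]]) simp
  also have "\<dots> = ennreal (L powr s) * hausdorff_pre s (\<delta> / L) A + ennreal e"
    using Ls L e by (simp add: distrib_left flip: ennreal_mult)
  finally show "hausdorff_pre s \<delta> (f ` A) \<le> ennreal (L powr s) * hausdorff_pre s (\<delta> / L) A + ennreal e" .
qed

lemma hausdorff_outer_lipschitz:
  fixes f :: "'a::euclidean_space \<Rightarrow> 'b::euclidean_space"
  assumes "L-lipschitz_on A f" "0 < L" "0 \<le> s"
  shows "hausdorff_outer s (f ` A) \<le> ennreal (L powr s) * hausdorff_outer s A"
  using assms(2)
  by (intro hausdorff_outer_leI order_trans[OF hausdorff_pre_lipschitz[OF assms]] mult_left_mono hausdorff_pre_le_outer) auto

lemma hausdorff_outer_image_le: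
  fixes f :: "'a \<Rightarrow> 'b::euclidean_space" and g :: "'a \<Rightarrow> 'c::euclidean_space"
  assumes dist_le: "\<And>x y. x \<in> A \<Longrightarrow> y \<in> A \<Longrightarrow> dist (f x) (f y) \<le> L * dist (g x) (g y)" and L: "0 < L" and s: "0 \<le> s"
  shows "hausdorff_outer s (f ` A) \<le> ennreal (L powr s) * hausdorff_outer s (g ` A)"
proof -
  define h where "h = f \<circ> inv_into A g"
  have h: "h (g x) = f x" if "x \<in> A" for x
  proof -
    have "inv_into A g (g x) \<in> A" "g (inv_into A g (g x)) = g x"
      using that by (auto intro: inv_into_into f_inv_into_f)
    then show ?thesis using dist_le[of "inv_into A g (g x)" x] that by (simp add: h_def)
  qed
  have "L-lipschitz_on (g ` A) h"
    using dist_le L by (intro lipschitz_onI) (auto simp: h)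
  then have "hausdorff_outer s (h ` g ` A) \<le> ennreal (L powr s) * hausdorff_outer s (g ` A)"
    by (rule hausdorff_outer_lipschitz[OF _ L s])
  also have "h ` g ` A = f ` A" by (force simp: h)
  finally show ?thesis .
qed

lemma hausdorff_outer_isometry:
  assumes "\<And>x y. x \<in> A \<Longrightarrow> y \<in> A \<Longrightarrow> dist (f x) (f y) = dist x y" "0 \<le> s"
  shows "hausdorff_outer s (f ` A) = hausdorff_outer s A"
  using hausdorff_outer_image_le[of A f 1 "\<lambda>x. x" s] hausdorff_outer_image_le[of A "\<lambda>x. x" 1 f s] assms
  by (intro antisym) simp_all

section \<open>Hausdorff measure restricted to a set\<close>

definition hausdorff_within :: "real \<Rightarrow> 'a::euclidean_space set \<Rightarrow> 'a measure" where
  "hausdorff_within s T = density (hausdorff_measure s) (indicator T)"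

abbreviation surface :: "'a::euclidean_space set \<Rightarrow> 'a measure" where
  "surface T \<equiv> hausdorff_within (real DIM('a) - 1) T"

lemma sets_hausdorff_within [simp, measurable_cong]: "sets (hausdorff_within s T) = sets borel"
  by (simp add: hausdorff_within_def)

lemma emeasure_hausdorff_within:
  assumes "T \<in> sets borel" "A \<in> sets borel"
  shows "emeasure (hausdorff_within s T) A = hausdorff_outer s (T \<inter> A)"
proof -
  have "emeasure (hausdorff_within s T) A = (\<integral>\<^sup>+x. indicator (T \<inter> A) x \<partial>hausdorff_measure s)"
    unfolding hausdorff_within_def using assms by (simp add: emeasure_density indicator_inter_arith)
  then show ?thesis using assms by (simp add: emeasure_hausdorff_measure)
qed

lemma AE_hausdorff_within: "T \<in> sets borel \<Longrightarrow> AE x in hausdorff_within s T. x \<in> T"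
  unfolding hausdorff_within_def by (subst AE_density) (auto simp: indicator_def)

lemma AE_hausdorff_within_neq:
  assumes "T \<in> sets borel"
  shows "AE x in hausdorff_within s T. x \<noteq> p"
proof -
  have "emeasure (hausdorff_within s T) {p} \<le> hausdorff_outer s {p}"
    using assms by (subst emeasure_hausdorff_within) (auto intro: hausdorff_outer_mono simp del: hausdorff_outer_singleton)
  then have "{p} \<in> null_sets (hausdorff_within s T)" by (auto simp: null_sets_def)
  then show ?thesis by (rule AE_I') auto
qed

lemma measurable_hausdorff_on_borel: "T \<in> sets borel \<Longrightarrow> (\<lambda>x. x) \<in> measurable (hausdorff_on s T) borel"
  by (simp add: hausdorff_on_eq_restrict measurable_restrict_space1)

lemma space_hausdorff_on: "T \<in> sets borel \<Longrightarrow> space (hausdorff_on s T) = T"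
  by (simp add: hausdorff_on_eq_restrict space_restrict_space)

lemma distr_hausdorff_on:
  assumes T: "T \<in> sets borel"
  shows "distr (hausdorff_on s T) borel (\<lambda>x. x) = hausdorff_within s T"
proof (rule measure_eqI)
  fix A assume "A \<in> sets (distr (hausdorff_on s T) borel (\<lambda>x. x))"
  then have A: "A \<in> sets borel" by simp
  have "emeasure (distr (hausdorff_on s T) borel (\<lambda>x. x)) A = emeasure (hausdorff_on s T) (A \<inter> T)"
    using A measurable_hausdorff_on_borel[OF T] by (simp add: emeasure_distr space_hausdorff_on[OF T])
  also have "\<dots> = emeasure (hausdorff_measure s) (A \<inter> T)"
    unfolding hausdorff_on_eq_restrict[OF T] using T by (intro emeasure_restrict_space) auto
  also have "\<dots> = emeasure (hausdorff_within s T) A"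
    using T A by (simp add: emeasure_hausdorff_within emeasure_hausdorff_measure Int_commute)
  finally show "emeasure (distr (hausdorff_on s T) borel (\<lambda>x. x)) A = emeasure (hausdorff_within s T) A" .
qed simp

lemma integral_hausdorff_on:
  fixes f :: "'a::euclidean_space \<Rightarrow> real"
  assumes "T \<in> sets borel" "f \<in> borel_measurable borel"
  shows "(\<integral>x. f x \<partial>hausdorff_on s T) = (\<integral>x. f x \<partial>hausdorff_within s T)"
  unfolding distr_hausdorff_on[OF assms(1), symmetric]
  using assms(2) measurable_hausdorff_on_borel[OF assms(1)] by (simp add: integral_distr)

lemma distr_hausdorff_within_isometry:
  fixes f :: "'a::euclidean_space \<Rightarrow> 'b::euclidean_space"
  assumes f: "\<And>x y. dist (f x) (f y) = dist x y" and T: "T \<in> sets borel" "f ` T \<in> sets borel" and s: "0 \<le> s"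
  shows "distr (hausdorff_within s T) borel f = hausdorff_within s (f ` T)"
proof (rule measure_eqI)
  have "continuous_on UNIV f" using f by (auto simp: continuous_on_iff)
  then have measurable: "f \<in> borel_measurable borel" by (rule borel_measurable_continuous_onI)
  fix A assume "A \<in> sets (distr (hausdorff_within s T) borel f)"
  then have A: "A \<in> sets borel" by simp
  then have "f -` A \<in> sets borel" using measurable_sets[OF measurable] by simp
  then have "emeasure (distr (hausdorff_within s T) borel f) A = hausdorff_outer s (T \<inter> f -` A)"
    using A T measurable by (simp add: emeasure_distr emeasure_hausdorff_within)
  also have "\<dots> = hausdorff_outer s (f ` (T \<inter> f -` A))"
    using f s by (intro hausdorff_outer_isometry[symmetric])
  also have "f ` (T \<inter> f -` A) = f ` T \<inter> A" by auto
  finally show "emeasure (distr (hausdorff_within s T) borel f) A = emeasure (hausdorff_within s (f ` T)) A"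
    using T A by (simp add: emeasure_hausdorff_within)
qed simp

section \<open>Hausdorff measure of cubes\<close>

lemma inner_sum_Basis_subset:
  assumes "I \<subseteq> Basis" "b \<in> Basis"
  shows "(\<Sum>I) \<bullet> b = (if b \<in> I then 1 else 0)"
proof -
  have "finite I" using assms finite_Basis finite_subset by blast
  have "(\<Sum>I) \<bullet> b = (\<Sum>i\<in>I. if i = b then 1 else 0)"
    unfolding inner_sum_left using assms by (intro sum.cong) (auto simp: inner_Basis subset_iff)
  then show ?thesis using \<open>finite I\<close> by simp
qed

lemma ex_grid_index:
  fixes t :: real
  assumes "0 \<le> t" "t \<le> 1" "0 < N"
  shows "\<exists>k<N. real k / real N \<le> t \<and> t \<le> (real k + 1) / real N"
proof (cases "t = 1")
  case True
  then show ?thesis using assms by (intro exI[of _ "N - 1"]) (auto simp: field_simps)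
next
  case False
  define k where "k = nat \<lfloor>real N * t\<rfloor>"
  have k: "real k \<le> real N * t" "real N * t < real k + 1" using assms by (auto simp: k_def of_nat_nat)
  have "real N * t < real N" using assms False by simp
  then have "k < N" using k by linarith
  moreover have "real k / real N \<le> t" "t \<le> (real k + 1) / real N"
    using k assms(3) by (auto simp: field_simps)
  ultimately show ?thesis by blast
qed

definition grid_cell :: "'a::euclidean_space set \<Rightarrow> nat \<Rightarrow> ('a \<Rightarrow> nat) \<Rightarrow> 'a set" where
  "grid_cell I N k = (let c = \<Sum>b\<in>I. (real (k b) / real N) *\<^sub>R b in cbox c (c + (1 / real N) *\<^sub>R \<Sum>I))"

lemma bounded_grid_cell: "bounded (grid_cell I N k)"
  by (simp add: grid_cell_def Let_def)

lemma diameter_grid_cell_le: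
  assumes I: "I \<subseteq> Basis"
  shows "diameter (grid_cell I N k) \<le> real (card I) / real N"
proof -
  have "diameter (grid_cell I N k) = (1 / real N) * norm (\<Sum>I)"
    unfolding grid_cell_def Let_def
    by (subst diameter_cbox) (auto simp: inner_add_left inner_sum_Basis_subset[OF I] dist_norm)
  moreover have "norm (\<Sum>I) \<le> (\<Sum>b\<in>I. 1)" using I by (intro sum_norm_le) auto
  ultimately show ?thesis by (simp add: divide_right_mono)
qed

lemma unit_cube_subset_grid:
  fixes I :: "'a::euclidean_space set"
  assumes I: "I \<subseteq> Basis" and N: "0 < N"
  shows "cbox 0 (\<Sum>I) \<subseteq> (\<Union>k\<in>I \<rightarrow>\<^sub>E {..<N}. grid_cell I N k)"
proof
  fix x assume x: "x \<in> cbox 0 (\<Sum>I)"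
  have finite_I: "finite I" using I finite_Basis finite_subset by blast
  have "\<forall>b\<in>I. \<exists>k<N. real k / real N \<le> x \<bullet> b \<and> x \<bullet> b \<le> (real k + 1) / real N"
    using x I N by (intro ballI ex_grid_index) (force simp: mem_box inner_sum_Basis_subset[OF I])+
  then obtain k where k: "\<And>b. b \<in> I \<Longrightarrow> k b < N \<and> real (k b) / real N \<le> x \<bullet> b \<and> x \<bullet> b \<le> (real (k b) + 1) / real N"
    by metis
  define corner where "corner = (\<Sum>b\<in>I. (real (restrict k I b) / real N) *\<^sub>R b)"
  have corner: "corner \<bullet> b = (if b \<in> I then real (k b) / real N else 0)" if "b \<in> Basis" for b
  proof -
    have "corner \<bullet> b = (\<Sum>i\<in>I. if i = b then real (k b) / real N else 0)"
      unfolding corner_def inner_sum_left using I that by (intro sum.cong) (auto simp: inner_Basis subset_iff)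
    then show ?thesis using finite_I by simp
  qed
  have "x \<in> grid_cell I N (restrict k I)"
    unfolding grid_cell_def Let_def corner_def[symmetric] mem_box using k x
    by (auto simp: corner inner_add_left inner_sum_Basis_subset[OF I] mem_box add_divide_distrib)
  moreover have "restrict k I \<in> I \<rightarrow>\<^sub>E {..<N}" using k by auto
  ultimately show "x \<in> (\<Union>k\<in>I \<rightarrow>\<^sub>E {..<N}. grid_cell I N k)" by blast
qed

lemma hausdorff_pre_grid_cell_le:
  assumes I: "I \<subseteq> Basis" and \<delta>: "real (card I) / real N \<le> \<delta>" and s: "0 \<le> s"
  shows "hausdorff_pre s \<delta> (grid_cell I N k) \<le> ennreal (kappa s * (real (card I) / real N / 2) powr s)"
proof -
  have "hausdorff_pre s \<delta> (grid_cell I N k) \<le> ennreal (kappa s * (diameter (grid_cell I N k) / 2) powr s)"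
    using diameter_grid_cell_le[OF I, of N k] \<delta> by (intro hausdorff_pre_le_diameter bounded_grid_cell) auto
  also have "\<dots> \<le> ennreal (kappa s * (real (card I) / real N / 2) powr s)"
    using diameter_grid_cell_le[OF I, of N k] diameter_ge_0[OF bounded_grid_cell, of I N k] s
    by (intro ennreal_leI mult_left_mono powr_mono2) auto
  finally show ?thesis .
qed

lemma hausdorff_outer_unit_cube_le:
  fixes I :: "'a::euclidean_space set"
  assumes I: "I \<subseteq> Basis" "I \<noteq> {}"
  shows "hausdorff_outer (real (card I)) (cbox 0 (\<Sum>I)) \<le> ennreal (kappa (real (card I)) * (real (card I) / 2) ^ card I)"
proof (rule hausdorff_outer_leI)
  fix \<delta> :: real assume \<delta>: "0 < \<delta>"
  let ?n = "card I" and ?s = "real (card I)"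
  have finite_I: "finite I" using I finite_Basis finite_subset by blast
  then have n: "0 < ?n" using I by (simp add: card_gt_0_iff)
  obtain N :: nat where N: "?s / \<delta> < real N" using reals_Archimedean2 by blast
  have "0 \<le> ?s / \<delta>" using \<delta> by simp
  then have N0: "0 < real N" using N by linarith
  then have N\<delta>: "?s / real N \<le> \<delta>" using N \<delta> by (simp add: field_simps)
  have "hausdorff_pre ?s \<delta> (cbox 0 (\<Sum>I)) \<le> hausdorff_pre ?s \<delta> (\<Union>k\<in>I \<rightarrow>\<^sub>E {..<N}. grid_cell I N k)"
    using N0 by (intro hausdorff_pre_mono unit_cube_subset_grid I) simp
  also have "\<dots> \<le> (\<Sum>k\<in>I \<rightarrow>\<^sub>E {..<N}. hausdorff_pre ?s \<delta> (grid_cell I N k))"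
    using finite_I \<delta> by (intro hausdorff_pre_finitely_subadditive finite_PiE) auto
  also have "\<dots> \<le> (\<Sum>k\<in>I \<rightarrow>\<^sub>E {..<N}. ennreal (kappa ?s * (?s / N / 2) powr ?s))"
    by (intro sum_mono hausdorff_pre_grid_cell_le I N\<delta>) simp
  also have "\<dots> = ennreal (real (N ^ ?n) * (kappa ?s * (?s / N / 2) powr ?s))"
    using finite_I by (simp add: card_PiE ennreal_of_nat_eq_real_of_nat ennreal_mult'' flip: of_nat_power)
  also have "real (N ^ ?n) * (kappa ?s * (?s / N / 2) powr ?s) = kappa ?s * (?s / 2) ^ ?n"
    using N0 n by (simp add: powr_realpow field_simps power_divide)
  finally show "hausdorff_pre ?s \<delta> (cbox 0 (\<Sum>I)) \<le> ennreal (kappa ?s * (?s / 2) ^ ?n)" .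
qed

lemma bounded_subset_cbox_diameter:
  fixes C :: "'a::euclidean_space set"
  assumes bounded: "bounded C"
  obtains l u where "C \<subseteq> cbox l u" "\<And>b. b \<in> Basis \<Longrightarrow> l \<bullet> b \<le> u \<bullet> b" "\<And>b. b \<in> Basis \<Longrightarrow> u \<bullet> b - l \<bullet> b \<le> diameter C"
proof (cases "C = {}")
  case True
  then show ?thesis using that[of 0 0] by simp
next
  case False
  define l where "l = (\<Sum>b\<in>Basis. (INF x\<in>C. x \<bullet> b) *\<^sub>R b)"
  define u where "u = (\<Sum>b\<in>Basis. (SUP x\<in>C. x \<bullet> b) *\<^sub>R b)"
  have lu: "l \<bullet> b = (INF x\<in>C. x \<bullet> b)" "u \<bullet> b = (SUP x\<in>C. x \<bullet> b)" if "b \<in> Basis" for b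
    using that by (auto simp: l_def u_def)
  have "bounded ((\<lambda>x. x \<bullet> b) ` C)" for b
    using bounded by (rule bounded_linear_image) (rule bounded_linear_inner_left)
  then have bdd: "bdd_below ((\<lambda>x. x \<bullet> b) ` C)" "bdd_above ((\<lambda>x. x \<bullet> b) ` C)" for b
    by (auto intro: bounded_imp_bdd_below bounded_imp_bdd_above)
  have between: "l \<bullet> b \<le> x \<bullet> b" "x \<bullet> b \<le> u \<bullet> b" if "b \<in> Basis" "x \<in> C" for b x
    using that bdd by (auto simp: lu intro: cINF_lower cSUP_upper)
  show ?thesis
  proof (rule that)
    show "C \<subseteq> cbox l u" using between by (auto simp: mem_box)
    fix b :: 'a assume b: "b \<in> Basis"
    show "l \<bullet> b \<le> u \<bullet> b" using between[OF b] False by (metis ex_in_conv order_trans)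
    have "x \<bullet> b - diameter C \<le> y \<bullet> b" if "x \<in> C" "y \<in> C" for x y
      using Basis_le_norm[OF b, of "x - y"] diameter_bounded_bound[OF bounded that]
      by (simp add: inner_diff_left dist_norm)
    then have "x \<bullet> b - diameter C \<le> l \<bullet> b" if "x \<in> C" for x
      unfolding lu(1)[OF b] using that False by (intro cINF_greatest) auto
    then have "u \<bullet> b \<le> l \<bullet> b + diameter C"
      unfolding lu(2)[OF b] using False by (intro cSUP_least) (auto simp: algebra_simps)
    then show "u \<bullet> b - l \<bullet> b \<le> diameter C" by simp
  qed
qed

text \<open>Thickening the sets of a cover of the face spanned by \<open>I\<close> in the remaining directions covers the unit cube, so
  that the lower bound for the measure of the face follows from the Lebesgue measure of the cube.\<close>

definition cylinder_box :: "'a::euclidean_space set \<Rightarrow> 'a \<Rightarrow> 'a \<Rightarrow> 'a set" where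
  "cylinder_box I l u =
    cbox (\<Sum>b\<in>Basis. (if b \<in> I then l \<bullet> b else 0) *\<^sub>R b) (\<Sum>b\<in>Basis. (if b \<in> I then u \<bullet> b else 1) *\<^sub>R b)"

lemma emeasure_cylinder_box:
  assumes I: "I \<subseteq> Basis" and lu: "\<And>b. b \<in> Basis \<Longrightarrow> l \<bullet> b \<le> u \<bullet> b"
  shows "emeasure lborel (cylinder_box I l u) = ennreal (\<Prod>b\<in>I. u \<bullet> b - l \<bullet> b)"
proof -
  have "emeasure lborel (cylinder_box I l u) = ennreal (\<Prod>b\<in>Basis. if b \<in> I then u \<bullet> b - l \<bullet> b else 1)"
    unfolding cylinder_box_def using lu
    by (subst emeasure_lborel_cbox) (auto simp: inner_diff_left intro!: prod.cong arg_cong[where f=ennreal])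
  then show ?thesis using I by (simp add: prod.If_cases Int_absorb1)
qed

lemma unit_cube_subset_cylinder_boxes:
  assumes I: "I \<subseteq> Basis" and cover: "cbox 0 (\<Sum>I) \<subseteq> (\<Union>i. cbox (l i) (u i))"
  shows "cbox 0 One \<subseteq> (\<Union>i. cylinder_box I (l i) (u i))"
proof
  fix x :: 'a assume x: "x \<in> cbox 0 One"
  define y where "y = (\<Sum>b\<in>Basis. (if b \<in> I then x \<bullet> b else 0) *\<^sub>R b)"
  have y: "y \<bullet> b = (if b \<in> I then x \<bullet> b else 0)" if "b \<in> Basis" for b
    using that by (auto simp: y_def)
  have "y \<in> cbox 0 (\<Sum>I)" using x by (auto simp: y mem_box inner_sum_Basis_subset[OF I])
  then obtain i where "y \<in> cbox (l i) (u i)" using cover by blast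
  then have "x \<in> cylinder_box I (l i) (u i)" using x by (force simp: cylinder_box_def mem_box y)
  then show "x \<in> (\<Union>i. cylinder_box I (l i) (u i))" by blast
qed

lemma unit_cube_cover_diameters:
  fixes I :: "'a::euclidean_space set"
  assumes I: "I \<subseteq> Basis" and cover: "cbox 0 (\<Sum>I) \<subseteq> (\<Union>i::nat. C i)" and bounded: "\<And>i. bounded (C i)"
  shows "1 \<le> (\<Sum>i. ennreal (diameter (C i) ^ card I))"
proof -
  have "\<exists>l u. C i \<subseteq> cbox l u \<and> (\<forall>b\<in>Basis. l \<bullet> b \<le> u \<bullet> b \<and> u \<bullet> b - l \<bullet> b \<le> diameter (C i))" for i
    using bounded_subset_cbox_diameter[OF bounded[of i]] by metis
  then obtain l u where lu: "\<And>i. C i \<subseteq> cbox (l i) (u i)"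
      "\<And>i b. b \<in> Basis \<Longrightarrow> l i \<bullet> b \<le> u i \<bullet> b \<and> u i \<bullet> b - l i \<bullet> b \<le> diameter (C i)"
    by metis
  let ?box = "\<lambda>i. cylinder_box I (l i) (u i)"
  have "cbox 0 (\<Sum>I) \<subseteq> (\<Union>i. cbox (l i) (u i))" using cover lu(1) by blast
  then have box_cover: "cbox 0 One \<subseteq> (\<Union>i. ?box i)" by (rule unit_cube_subset_cylinder_boxes[OF I])
  have "1 = emeasure lborel (cbox 0 One :: 'a set)" by (subst emeasure_lborel_cbox) auto
  also have "\<dots> \<le> (\<Sum>i. emeasure lborel (?box i))"
    by (rule order_trans[OF emeasure_mono[OF box_cover] emeasure_subadditive_countably]) (auto simp: cylinder_box_def)
  also have "\<dots> \<le> (\<Sum>i. ennreal (diameter (C i) ^ card I))"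
  proof (rule suminf_le)
    fix i
    have "(\<Prod>b\<in>I. u i \<bullet> b - l i \<bullet> b) \<le> (\<Prod>b\<in>I. diameter (C i))"
      using lu(2)[of _ i] I by (intro prod_mono) auto
    then show "emeasure lborel (?box i) \<le> ennreal (diameter (C i) ^ card I)"
      using lu(2)[of _ i] by (simp add: emeasure_cylinder_box[OF I] ennreal_leI)
  qed auto
  finally show ?thesis .
qed

lemma hausdorff_outer_unit_cube_ge:
  fixes I :: "'a::euclidean_space set"
  assumes I: "I \<subseteq> Basis" "I \<noteq> {}"
  shows "ennreal (kappa (real (card I)) / 2 ^ card I) \<le> hausdorff_outer (real (card I)) (cbox 0 (\<Sum>I))"
proof -
  let ?n = "card I" and ?s = "real (card I)"
  have n: "0 < ?n" using I finite_Basis finite_subset by (metis card_gt_0_iff)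
  have "ennreal (kappa ?s / 2 ^ ?n) \<le> hausdorff_pre ?s 1 (cbox 0 (\<Sum>I))"
    unfolding hausdorff_pre_def
  proof (rule INF_greatest, clarify)
    fix C :: "nat \<Rightarrow> 'a set"
    assume C: "cbox 0 (\<Sum>I) \<subseteq> (\<Union>i. C i)" "\<forall>i. bounded (C i) \<and> diameter (C i) \<le> 1"
    have "ennreal (kappa ?s / 2 ^ ?n) * 1 \<le> ennreal (kappa ?s / 2 ^ ?n) * (\<Sum>i. ennreal (diameter (C i) ^ ?n))"
      using C by (intro mult_left_mono unit_cube_cover_diameters[OF I(1)]) auto
    also have "\<dots> = (\<Sum>i. ennreal (kappa ?s / 2 ^ ?n) * ennreal (diameter (C i) ^ ?n))" by simp
    also have "\<dots> = (\<Sum>i. ennreal (kappa ?s * (diameter (C i) / 2) powr ?s))"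
    proof (rule suminf_cong)
      fix i
      have "0 \<le> diameter (C i)" using C diameter_ge_0 by auto
      then have "(diameter (C i) / 2) powr ?s = (diameter (C i) / 2) ^ ?n" using n by (intro powr_realpow') auto
      then show "ennreal (kappa ?s / 2 ^ ?n) * ennreal (diameter (C i) ^ ?n) = ennreal (kappa ?s * (diameter (C i) / 2) powr ?s)"
        using \<open>0 \<le> diameter (C i)\<close> by (simp add: power_divide flip: ennreal_mult)
    qed
    finally show "ennreal (kappa ?s / 2 ^ ?n) \<le> (\<Sum>i. ennreal (kappa ?s * (diameter (C i) / 2) powr ?s))" by simp
  qed
  also have "\<dots> \<le> hausdorff_outer ?s (cbox 0 (\<Sum>I))" by (rule hausdorff_pre_le_outer) simp
  finally show ?thesis .
qed

lemma hausdorff_outer_1_unit_interval: "hausdorff_outer 1 {0..1::real} = 1"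
  using hausdorff_outer_unit_cube_le[of "{1::real}"] hausdorff_outer_unit_cube_ge[of "{1::real}"]
  by (intro antisym) (simp_all add: unit_ball_vol_1)

lemma hausdorff_outer_coordinate_bounded_finite:
  fixes A I :: "'a::euclidean_space set"
  assumes I: "I \<subseteq> Basis" "I \<noteq> {}" and A: "bounded A" "\<And>x b. x \<in> A \<Longrightarrow> b \<in> Basis - I \<Longrightarrow> x \<bullet> b = 0"
  shows "hausdorff_outer (real (card I)) A < \<infinity>"
proof -
  let ?s = "real (card I)"
  obtain R where R: "R > 0" "\<And>x. x \<in> A \<Longrightarrow> norm x \<le> R" using A(1) by (auto simp: bounded_pos)
  define f where "f x = (2 * R) *\<^sub>R x + (- R) *\<^sub>R \<Sum>I" for x :: 'a
  have "0 \<in> cbox 0 (\<Sum>I)" by (auto simp: mem_box inner_sum_Basis_subset[OF I(1)])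
  moreover have "(2 * R) *\<^sub>R \<Sum>I + (- R) *\<^sub>R \<Sum>I = R *\<^sub>R \<Sum>I"
    by (subst scaleR_add_left[symmetric]) simp
  ultimately have "f ` cbox 0 (\<Sum>I) = cbox ((- R) *\<^sub>R \<Sum>I) (R *\<^sub>R \<Sum>I)"
    using R(1) unfolding f_def image_affinity_cbox by auto
  moreover have "x \<in> cbox ((- R) *\<^sub>R \<Sum>I) (R *\<^sub>R \<Sum>I)" if "x \<in> A" for x
    unfolding mem_box
  proof
    fix b :: 'a assume b: "b \<in> Basis"
    then have "\<bar>x \<bullet> b\<bar> \<le> R" using R(2)[OF that] Basis_le_norm[OF b, of x] by linarith
    then show "((- R) *\<^sub>R \<Sum>I) \<bullet> b \<le> x \<bullet> b \<and> x \<bullet> b \<le> (R *\<^sub>R \<Sum>I) \<bullet> b"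
      using A(2)[OF that, of b] b by (auto simp: inner_sum_Basis_subset[OF I(1)] abs_le_iff)
  qed
  ultimately have "hausdorff_outer ?s A \<le> hausdorff_outer ?s (f ` cbox 0 (\<Sum>I))"
    by (intro hausdorff_outer_mono) auto
  also have "\<dots> \<le> ennreal ((2 * R) powr ?s) * hausdorff_outer ?s (cbox 0 (\<Sum>I))"
    using R(1) by (intro hausdorff_outer_lipschitz lipschitz_onI)
      (auto simp: f_def dist_norm simp flip: scaleR_diff_right)
  also have "\<dots> < \<infinity>"
    using hausdorff_outer_unit_cube_le[OF I] by (auto simp: ennreal_mult_less_top intro: order_le_less_trans)
  finally show ?thesis .
qed

section \<open>Translation invariant measures\<close>

definition translation_invariant :: "'a::euclidean_space measure \<Rightarrow> bool" where
  "translation_invariant M \<longleftrightarrow> sets M = sets borel \<and> (\<forall>v. distr M borel ((+) v) = M)"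

lemma translation_invariant_lborel: "translation_invariant lborel"
  by (simp add: translation_invariant_def lborel_distr_plus)

lemma translation_invariant_hausdorff_measure:
  assumes "0 \<le> s"
  shows "translation_invariant (hausdorff_measure s)"
proof -
  have "hausdorff_measure s = hausdorff_within s (UNIV :: 'a set)"
    by (simp add: hausdorff_within_def density_1)
  moreover have "distr (hausdorff_within s (UNIV :: 'a set)) borel ((+) v) = hausdorff_within s ((+) v ` UNIV)" for v
    using assms by (intro distr_hausdorff_within_isometry) auto
  ultimately show ?thesis by (simp add: translation_invariant_def)
qed

lemma nn_integral_translate:
  assumes M: "translation_invariant M" and [measurable]: "f \<in> borel_measurable borel"
  shows "(\<integral>\<^sup>+x. f (v + x) \<partial>M) = (\<integral>\<^sup>+x. f x \<partial>M)"
proof -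
  have [measurable_cong]: "sets M = sets borel" using M by (simp add: translation_invariant_def)
  have "(\<integral>\<^sup>+x. f x \<partial>M) = (\<integral>\<^sup>+x. f x \<partial>distr M borel ((+) v))"
    using M by (simp add: translation_invariant_def)
  also have "\<dots> = (\<integral>\<^sup>+x. f (v + x) \<partial>M)" by (subst nn_integral_distr) auto
  finally show ?thesis by simp
qed

text \<open>Fubini's theorem for \<open>1\<^sub>A(x) 1\<^sub>B(x + y)\<close>, translating by \<open>x\<close> in one order of integration and by \<open>y\<close> in the other.\<close>

lemma translation_invariant_mult_commute:
  fixes M N :: "'a::euclidean_space measure"
  assumes M: "sigma_finite_measure M" "translation_invariant M" and N: "sigma_finite_measure N" "translation_invariant N"
    and A [measurable]: "A \<in> sets borel" and [measurable]: "B \<in> sets borel"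
  shows "emeasure N A * emeasure M B = emeasure M (uminus -` A) * emeasure N B"
proof -
  interpret M: sigma_finite_measure M by fact
  interpret N: sigma_finite_measure N by fact
  interpret pair_sigma_finite N M ..
  have sets [measurable_cong]: "sets M = sets borel" "sets N = sets borel"
    using M N by (simp_all add: translation_invariant_def)
  have [measurable]: "uminus -` A \<in> sets borel"
    using measurable_sets[of uminus borel borel A] by simp
  have "emeasure N A * emeasure M B = (\<integral>\<^sup>+x. indicator A x * (\<integral>\<^sup>+y. indicator B (x + y) \<partial>M) \<partial>N)"
    by (subst nn_integral_translate[OF M(2)]) (simp_all add: sets nn_integral_multc)
  also have "\<dots> = (\<integral>\<^sup>+x. \<integral>\<^sup>+y. indicator A x * indicator B (x + y) \<partial>M \<partial>N)"
    by (simp add: nn_integral_cmult)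
  also have "\<dots> = (\<integral>\<^sup>+y. \<integral>\<^sup>+x. indicator A x * indicator B (x + y) \<partial>N \<partial>M)"
    by (rule Fubini'[symmetric]) measurable
  also have "\<dots> = (\<integral>\<^sup>+y. \<integral>\<^sup>+x. indicator A (x - y) * indicator B x \<partial>N \<partial>M)"
  proof (rule nn_integral_cong)
    fix y
    show "(\<integral>\<^sup>+x. indicator A x * indicator B (x + y) \<partial>N) = (\<integral>\<^sup>+x. indicator A (x - y) * indicator B x \<partial>N)"
      using nn_integral_translate[OF N(2), of "\<lambda>x. indicator A (x - y) * indicator B x" y] by (simp add: add.commute)
  qed
  also have "\<dots> = (\<integral>\<^sup>+x. \<integral>\<^sup>+y. indicator A (x - y) * indicator B x \<partial>M \<partial>N)"
    by (rule Fubini') measurable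
  also have "\<dots> = (\<integral>\<^sup>+x. emeasure M (uminus -` A) * indicator B x \<partial>N)"
  proof (rule nn_integral_cong)
    fix x
    have "(\<integral>\<^sup>+y. indicator A (x - y) \<partial>M) = (\<integral>\<^sup>+y. indicator (uminus -` A) (- x + y) \<partial>M)"
      by (simp add: indicator_def)
    also have "\<dots> = emeasure M (uminus -` A)"
      by (subst nn_integral_translate[OF M(2)]) (simp_all add: sets)
    finally show "(\<integral>\<^sup>+y. indicator A (x - y) * indicator B x \<partial>M) = emeasure M (uminus -` A) * indicator B x"
      by (simp add: nn_integral_multc)
  qed
  also have "\<dots> = emeasure M (uminus -` A) * emeasure N B" by (simp add: nn_integral_cmult sets)
  finally show ?thesis .
qed

lemma translation_invariant_eq_lborel:
  fixes M :: "'a::euclidean_space measure"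
  assumes M: "sigma_finite_measure M" "translation_invariant M" and B: "B \<in> sets borel"
  shows "emeasure M B = emeasure M (cbox 0 One) * emeasure lborel B"
proof -
  let ?cube = "cbox 0 One :: 'a set"
  have sets: "sets M = sets borel" using M by (simp add: translation_invariant_def)
  have "1 * emeasure M B = emeasure M (uminus -` ?cube) * emeasure lborel B"
    using translation_invariant_mult_commute[OF M lborel.sigma_finite_measure_axioms translation_invariant_lborel _ B, of ?cube]
    by (simp add: emeasure_lborel_cbox)
  also have "uminus -` ?cube = (+) One -` ?cube"
  proof -
    have "0 \<le> 1 + r \<longleftrightarrow> - 1 \<le> r" for r :: real by linarith
    then show ?thesis by (auto simp: mem_box inner_add_left)
  qed
  also have "emeasure M ((+) One -` ?cube) = emeasure (distr M borel ((+) One)) ?cube"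
    using sets by (subst emeasure_distr) (auto simp: sets_eq_imp_space_eq[OF sets] cong: measurable_cong_sets)
  also have "distr M borel ((+) One) = M" using M by (simp add: translation_invariant_def)
  finally show ?thesis by simp
qed

lemma sigma_finite_of_bounded_finite:
  fixes M :: "'a::euclidean_space measure"
  assumes "sets M = sets borel" "\<And>A. bounded A \<Longrightarrow> A \<in> sets borel \<Longrightarrow> emeasure M A < \<infinity>"
  shows "sigma_finite_measure M"
proof
  have "space M = UNIV" using sets_eq_imp_space_eq[OF assms(1)] by simp
  moreover have "emeasure M (cball 0 (real n)) < top" for n using assms(2)[of "cball 0 (real n)"] by simp
  ultimately show "\<exists>A. countable A \<and> A \<subseteq> sets M \<and> \<Union> A = space M \<and> (\<forall>a\<in>A. emeasure M a \<noteq> \<infinity>)"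
    using assms real_arch_simple
    by (intro exI[of _ "range (\<lambda>n::nat. cball 0 (real n))"] conjI ballI) (auto simp: less_top)
qed

lemma hausdorff_outer_DIM_eq_lborel:
  fixes B :: "'a::euclidean_space set"
  assumes "B \<in> sets borel"
  shows "hausdorff_outer (real DIM('a)) B = hausdorff_outer (real DIM('a)) (cbox 0 One :: 'a set) * emeasure lborel B"
proof -
  have "sigma_finite_measure (hausdorff_measure (real DIM('a)) :: 'a measure)"
    using hausdorff_outer_coordinate_bounded_finite[of "Basis :: 'a set"]
    by (intro sigma_finite_of_bounded_finite) (auto simp: emeasure_hausdorff_measure)
  from translation_invariant_eq_lborel[OF this translation_invariant_hausdorff_measure assms] show ?thesis
    using assms by (simp add: emeasure_hausdorff_measure)
qed

lemma hausdorff_outer_1_eq_lborel: "B \<in> sets borel \<Longrightarrow> hausdorff_outer 1 B = emeasure lborel (B :: real set)"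
  using hausdorff_outer_DIM_eq_lborel[of B] by (simp add: hausdorff_outer_1_unit_interval)

section \<open>Slicing by hyperplanes\<close>

abbreviation hplane :: "'a::euclidean_space \<Rightarrow> 'a set" where
  "hplane e \<equiv> {y. y \<bullet> e = 0}"

lemma hplane_borel [measurable]: "hplane e \<in> sets borel"
  by (intro borel_closed closed_Collect_eq continuous_intros)

lemma proj_perp_inner: "norm e = 1 \<Longrightarrow> proj_perp e x \<bullet> e = 0"
  by (simp add: proj_perp_def inner_diff_left norm_eq_1)

lemma proj_perp_diff: "proj_perp e (x - y) = proj_perp e x - proj_perp e y"
  by (simp add: proj_perp_def inner_diff_left algebra_simps)

lemma proj_perp_add_scaleR:
  "norm e = 1 \<Longrightarrow> y \<bullet> e = 0 \<Longrightarrow> proj_perp e (y + t *\<^sub>R e) = y"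
  by (simp add: proj_perp_def inner_add_left norm_eq_1)

lemma continuous_on_proj_perp [continuous_intros]: "continuous_on A f \<Longrightarrow> continuous_on A (\<lambda>x. proj_perp e (f x))"
  unfolding proj_perp_def by (intro continuous_intros)

lemma proj_perp_measurable [measurable]: "proj_perp e \<in> borel_measurable borel"
  by (intro borel_measurable_continuous_onI continuous_intros)

lemma norm_proj_perp_power2: "norm e = 1 \<Longrightarrow> (norm (proj_perp e x))\<^sup>2 = (norm x)\<^sup>2 - (x \<bullet> e)\<^sup>2"
  unfolding power2_norm_eq_inner proj_perp_def
  by (simp add: inner_diff_left inner_diff_right inner_commute norm_eq_1 power2_eq_square)

lemma norm_proj_perp_le: "norm e = 1 \<Longrightarrow> norm (proj_perp e x) \<le> norm x"
  by (rule power2_le_imp_le) (simp_all add: norm_proj_perp_power2)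

lemma householder_reflection:
  fixes e e' :: "'a::euclidean_space"
  assumes "norm e = 1" "norm e' = 1"
  obtains R :: "'a \<Rightarrow> 'a" where "linear R" "\<And>x y. R x \<bullet> R y = x \<bullet> y" "R e = e'" "\<And>x. R (R x) = x"
proof (cases "e = e'")
  case True
  then show ?thesis using that[of "\<lambda>x. x"] by (simp add: linear_ident)
next
  case False
  define v where "v = e - e'"
  define R where "R x = x - (2 * (x \<bullet> v) / (v \<bullet> v)) *\<^sub>R v" for x
  have v_nonzero: "v \<bullet> v \<noteq> 0" using False by (simp add: v_def)
  have R_inner_v: "R x \<bullet> v = - (x \<bullet> v)" for x using v_nonzero by (simp add: R_def inner_diff_left)
  have "linear R" by (rule linearI) (simp_all add: R_def inner_add_left algebra_simps add_divide_distrib)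
  moreover have "R x \<bullet> R y = x \<bullet> y" for x y
  proof -
    have "R x \<bullet> R y = x \<bullet> R y - (2 * (x \<bullet> v) / (v \<bullet> v)) * (R y \<bullet> v)"
      by (subst R_def[of x]) (simp add: inner_diff_left inner_commute[of v "R y"])
    also have "\<dots> = x \<bullet> y" unfolding R_inner_v by (simp add: R_def inner_diff_right)
    finally show ?thesis .
  qed
  moreover have "2 * (e \<bullet> v) = v \<bullet> v"
    using assms by (simp add: v_def inner_diff_left inner_diff_right inner_commute norm_eq_1)
  then have "R e = e'" using v_nonzero by (simp add: R_def v_def)
  moreover have "R (R x) = x" for x
    unfolding R_def[of "R x"] R_inner_v by (simp add: R_def)
  ultimately show ?thesis by (rule that)
qed

lemma isometry_of_inner:
  assumes "linear R" "\<And>x y. R x \<bullet> R y = x \<bullet> (y::'a::euclidean_space)"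
  shows "dist (R x) (R y) = dist x y" "norm (R x) = norm x"
proof -
  have norm: "norm (R x) = norm x" for x using assms(2)[of x x] by (simp add: norm_eq_sqrt_inner)
  then show "norm (R x) = norm x" .
  show "dist (R x) (R y) = dist x y" using norm[of "x - y"] assms(1) by (simp add: dist_norm linear_diff)
qed

lemma card_Basis_minus_singleton:
  fixes b :: "'a::euclidean_space"
  assumes "b \<in> Basis" "DIM('a) \<ge> 2"
  shows "real (card (Basis - {b})) = real DIM('a) - 1" "Basis - {b} \<noteq> {}"
proof -
  show "real (card (Basis - {b})) = real DIM('a) - 1" using assms by (simp add: of_nat_diff)
  then have "card (Basis - {b}) \<noteq> 0" using assms(2) by linarith
  then show "Basis - {b} \<noteq> {}" by (metis card.empty)
qed

lemma hausdorff_outer_hplane_finite: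
  fixes e :: "'a::euclidean_space"
  assumes e: "norm e = 1" and dim: "DIM('a) \<ge> 2" and A: "bounded A" "A \<subseteq> hplane e"
  shows "hausdorff_outer (real DIM('a) - 1) A < \<infinity>"
proof -
  obtain b :: 'a where b: "b \<in> Basis" using nonempty_Basis by blast
  obtain R where R: "linear R" "\<And>x y. R x \<bullet> R y = x \<bullet> y" "R e = b"
    using householder_reflection[OF e, of b] b by auto
  have "hausdorff_outer (real (card (Basis - {b}))) (R ` A) < \<infinity>"
  proof (rule hausdorff_outer_coordinate_bounded_finite)
    show "bounded (R ` A)" using A(1) R(1) by (simp add: bounded_linear_image linear_conv_bounded_linear)
    fix x b' assume "x \<in> R ` A" "b' \<in> Basis - (Basis - {b})"
    then show "x \<bullet> b' = 0" using A(2) b R(2,3) by force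
  qed (use card_Basis_minus_singleton[OF b dim] in auto)
  moreover have "hausdorff_outer (real DIM('a) - 1) (R ` A) = hausdorff_outer (real DIM('a) - 1) A"
    using isometry_of_inner[OF R(1,2)] dim by (intro hausdorff_outer_isometry) auto
  ultimately show ?thesis by (simp add: card_Basis_minus_singleton[OF b dim])
qed

lemma sigma_finite_surface_hplane:
  fixes e :: "'a::euclidean_space"
  assumes "norm e = 1" "DIM('a) \<ge> 2"
  shows "sigma_finite_measure (surface (hplane e))"
proof (rule sigma_finite_of_bounded_finite)
  fix A :: "'a set" assume "bounded A" "A \<in> sets borel"
  then show "emeasure (surface (hplane e)) A < \<infinity>"
    using hausdorff_outer_hplane_finite[OF assms, of "hplane e \<inter> A"]
    by (simp add: emeasure_hausdorff_within bounded_Int)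
qed simp

lemma distr_surface_hplane_translate:
  fixes e :: "'a::euclidean_space"
  assumes w: "w \<bullet> e = 0"
  shows "distr (surface (hplane e)) borel ((+) w) = surface (hplane e)"
proof -
  have "(+) w ` hplane e = hplane e"
  proof (intro subset_antisym subsetI)
    fix y assume "y \<in> hplane e"
    then show "y \<in> (+) w ` hplane e" using w by (intro image_eqI[of _ _ "y - w"]) (auto simp: inner_diff_left)
  qed (use w in \<open>auto simp: inner_add_left\<close>)
  then show ?thesis
    using distr_hausdorff_within_isometry[of "(+) w" "hplane e" "real DIM('a) - 1"] by simp
qed

lemma nn_integral_surface_hplane_translate:
  assumes w: "w \<bullet> e = 0" and [measurable]: "f \<in> borel_measurable borel"
  shows "(\<integral>\<^sup>+y. f (w + y) \<partial>surface (hplane e)) = (\<integral>\<^sup>+y. f y \<partial>surface (hplane e))"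
proof -
  have "(\<integral>\<^sup>+y. f y \<partial>distr (surface (hplane e)) borel ((+) w)) = (\<integral>\<^sup>+y. f (w + y) \<partial>surface (hplane e))"
    by (subst nn_integral_distr) auto
  then show ?thesis unfolding distr_surface_hplane_translate[OF w] by simp
qed

definition slices :: "'a::euclidean_space \<Rightarrow> 'a measure" where
  "slices e = distr (surface (hplane e) \<Otimes>\<^sub>M lborel) borel (\<lambda>(y, t). y + t *\<^sub>R e)"

lemma sets_slices [simp, measurable_cong]: "sets (slices e) = sets borel"
  by (simp add: slices_def)

lemma nn_integral_slices:
  fixes e :: "'a::euclidean_space"
  assumes e: "norm e = 1" "DIM('a) \<ge> 2" and [measurable]: "f \<in> borel_measurable borel"
  shows "(\<integral>\<^sup>+x. f x \<partial>slices e) = (\<integral>\<^sup>+y. \<integral>\<^sup>+t. f (y + t *\<^sub>R e) \<partial>lborel \<partial>surface (hplane e))"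
proof -
  interpret S: sigma_finite_measure "surface (hplane e)" by (rule sigma_finite_surface_hplane[OF e])
  interpret pair_sigma_finite "surface (hplane e)" lborel ..
  show ?thesis unfolding slices_def
    by (subst nn_integral_distr) (auto simp: split_beta' lborel.nn_integral_fst[symmetric])
qed

lemma emeasure_slices:
  fixes e :: "'a::euclidean_space"
  assumes e: "norm e = 1" "DIM('a) \<ge> 2" and [measurable]: "A \<in> sets borel"
  shows "emeasure (slices e) A = (\<integral>\<^sup>+y. \<integral>\<^sup>+t. indicator A (y + t *\<^sub>R e) \<partial>lborel \<partial>surface (hplane e))"
  using nn_integral_slices[OF e, of "indicator A"] by simp

lemma emeasure_slices_product:
  fixes e :: "'a::euclidean_space"
  assumes e: "norm e = 1" "DIM('a) \<ge> 2"
    and A [measurable]: "A \<in> sets borel" and I [measurable]: "I \<in> sets borel"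
  shows "emeasure (slices e) {x. proj_perp e x \<in> A \<and> x \<bullet> e \<in> I}
    = hausdorff_outer (real DIM('a) - 1) (hplane e \<inter> A) * emeasure lborel I"
proof -
  have "emeasure (slices e) {x. proj_perp e x \<in> A \<and> x \<bullet> e \<in> I}
      = (\<integral>\<^sup>+y. \<integral>\<^sup>+t. indicator {x. proj_perp e x \<in> A \<and> x \<bullet> e \<in> I} (y + t *\<^sub>R e) \<partial>lborel \<partial>surface (hplane e))"
    by (rule emeasure_slices[OF e]) measurable
  also have "\<dots> = (\<integral>\<^sup>+y. indicator A y * emeasure lborel I \<partial>surface (hplane e))"
  proof (rule nn_integral_cong_AE)
    show "AE y in surface (hplane e).
        (\<integral>\<^sup>+t. indicator {x. proj_perp e x \<in> A \<and> x \<bullet> e \<in> I} (y + t *\<^sub>R e) \<partial>lborel) = indicator A y * emeasure lborel I"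
      using AE_hausdorff_within[OF hplane_borel]
    proof eventually_elim
      case (elim y)
      then have "indicator {x. proj_perp e x \<in> A \<and> x \<bullet> e \<in> I} (y + t *\<^sub>R e) = (indicator A y * indicator I t :: ennreal)" for t
        using e by (simp add: proj_perp_add_scaleR inner_add_left norm_eq_1 indicator_def)
      then show ?case by (simp add: nn_integral_cmult)
    qed
  qed
  also have "\<dots> = emeasure (surface (hplane e)) A * emeasure lborel I" by (simp add: nn_integral_multc)
  finally show ?thesis by (simp add: emeasure_hausdorff_within)
qed

lemma translation_invariant_slices:
  fixes e :: "'a::euclidean_space"
  assumes e: "norm e = 1" "DIM('a) \<ge> 2"
  shows "translation_invariant (slices e)"
proof -
  have "distr (slices e) borel ((+) v) = slices e" for v
  proof (rule measure_eqI)
    fix A assume "A \<in> sets (distr (slices e) borel ((+) v))"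
    then have A [measurable]: "A \<in> sets borel" by simp
    let ?w = "proj_perp e v"
    have "emeasure (distr (slices e) borel ((+) v)) A = (\<integral>\<^sup>+x. indicator A (v + x) \<partial>slices e)"
      by (simp add: nn_integral_distr flip: nn_integral_indicator)
    also have "\<dots> = (\<integral>\<^sup>+y. \<integral>\<^sup>+t. indicator A (v + (y + t *\<^sub>R e)) \<partial>lborel \<partial>surface (hplane e))"
      by (rule nn_integral_slices[OF e]) measurable
    also have "\<dots> = (\<integral>\<^sup>+y. \<integral>\<^sup>+t. indicator A (?w + y + t *\<^sub>R e) \<partial>lborel \<partial>surface (hplane e))"
    proof (rule nn_integral_cong)
      fix y
      have "v + (y + t *\<^sub>R e) = ?w + y + (v \<bullet> e + t) *\<^sub>R e" for t
        by (simp add: proj_perp_def algebra_simps)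
      then have "(\<integral>\<^sup>+t. indicator A (v + (y + t *\<^sub>R e)) \<partial>lborel) = (\<integral>\<^sup>+t. indicator A (?w + y + (v \<bullet> e + t) *\<^sub>R e) \<partial>lborel)"
        by (simp only:)
      also have "\<dots> = (\<integral>\<^sup>+t. indicator A (?w + y + t *\<^sub>R e) \<partial>lborel)"
        by (rule nn_integral_translate[OF translation_invariant_lborel, of "\<lambda>t. indicator A (?w + y + t *\<^sub>R e)"]) measurable
      finally show "(\<integral>\<^sup>+t. indicator A (v + (y + t *\<^sub>R e)) \<partial>lborel) = (\<integral>\<^sup>+t. indicator A (?w + y + t *\<^sub>R e) \<partial>lborel)" .
    qed
    also have "\<dots> = (\<integral>\<^sup>+y. \<integral>\<^sup>+t. indicator A (y + t *\<^sub>R e) \<partial>lborel \<partial>surface (hplane e))"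
      by (rule nn_integral_surface_hplane_translate[OF proj_perp_inner[OF e(1)],
            where f="\<lambda>y. \<integral>\<^sup>+t. indicator A (y + t *\<^sub>R e) \<partial>lborel"]) measurable
    also have "\<dots> = emeasure (slices e) A" by (rule emeasure_slices[OF e A, symmetric])
    finally show "emeasure (distr (slices e) borel ((+) v)) A = emeasure (slices e) A" .
  qed simp
  then show ?thesis by (simp add: translation_invariant_def)
qed

lemma sigma_finite_slices:
  fixes e :: "'a::euclidean_space"
  assumes e: "norm e = 1" "DIM('a) \<ge> 2"
  shows "sigma_finite_measure (slices e)"
proof (rule sigma_finite_of_bounded_finite)
  fix A :: "'a set" assume "bounded A" and A: "A \<in> sets borel"
  then obtain r where r: "\<And>x. x \<in> A \<Longrightarrow> norm x \<le> r" by (auto simp: bounded_iff)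
  have "A \<subseteq> {x. proj_perp e x \<in> cball 0 r \<and> x \<bullet> e \<in> {- r..r}}"
  proof
    fix x assume "x \<in> A"
    then have "norm x \<le> r" by (rule r)
    moreover have "\<bar>x \<bullet> e\<bar> \<le> norm x" using Cauchy_Schwarz_ineq2[of x e] e by simp
    ultimately show "x \<in> {x. proj_perp e x \<in> cball 0 r \<and> x \<bullet> e \<in> {- r..r}}"
      using norm_proj_perp_le[OF e(1), of x] by (auto simp: abs_le_iff)
  qed
  then have "emeasure (slices e) A \<le> emeasure (slices e) {x. proj_perp e x \<in> cball 0 r \<and> x \<bullet> e \<in> {- r..r}}"
    by (intro emeasure_mono) (auto, measurable)
  also have "\<dots> < \<infinity>"
    using hausdorff_outer_hplane_finite[OF e, of "hplane e \<inter> cball 0 r"]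
    by (subst emeasure_slices_product[OF e]) (auto simp: ennreal_mult_less_top emeasure_lborel_Icc_eq bounded_Int)
  finally show "emeasure (slices e) A < \<infinity>" .
qed simp

lemma emeasure_slices_cball_eq:
  fixes e e' :: "'a::euclidean_space"
  assumes e: "norm e = 1" "norm e' = 1" "DIM('a) \<ge> 2"
  shows "emeasure (slices e) (cball 0 1) = emeasure (slices e') (cball 0 1)"
proof -
  obtain R where R: "linear R" "\<And>x y. R x \<bullet> R y = x \<bullet> y" "R e = e'" "\<And>x. R (R x) = x"
    using householder_reflection[OF e(1,2)] by auto
  note isometry = isometry_of_inner[OF R(1,2)]
  have [measurable]: "R \<in> borel_measurable borel"
    using R(1) by (intro borel_measurable_continuous_onI linear_continuous_on) (simp add: linear_conv_bounded_linear)
  have "R ` hplane e = hplane e'"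
  proof (intro subset_antisym subsetI)
    fix x assume "x \<in> hplane e'"
    moreover have "R e' = e" using R(3,4) by metis
    ultimately have "R x \<in> hplane e" using R(2)[of x e'] by simp
    then show "x \<in> R ` hplane e" using R(4) by (metis image_eqI)
  qed (use R(2,3) in force)
  then have surface: "distr (surface (hplane e)) borel R = surface (hplane e')"
    using distr_hausdorff_within_isometry[of R "hplane e" "real DIM('a) - 1"] isometry by simp
  have [measurable]: "cball (0::'a) 1 \<in> sets borel" by simp
  have "emeasure (slices e') (cball 0 1)
      = (\<integral>\<^sup>+y. \<integral>\<^sup>+t. indicator (cball 0 1) (y + t *\<^sub>R e') \<partial>lborel \<partial>distr (surface (hplane e)) borel R)"
    by (simp add: emeasure_slices[OF e(2,3)] surface)
  also have "\<dots> = (\<integral>\<^sup>+y. \<integral>\<^sup>+t. indicator (cball 0 1) (R y + t *\<^sub>R e') \<partial>lborel \<partial>surface (hplane e))"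
    by (subst nn_integral_distr; measurable)
  also have "\<dots> = (\<integral>\<^sup>+y. \<integral>\<^sup>+t. indicator (cball 0 1) (y + t *\<^sub>R e) \<partial>lborel \<partial>surface (hplane e))"
  proof (intro nn_integral_cong)
    fix y t
    have "norm (R y + t *\<^sub>R e') = norm (R (y + t *\<^sub>R e))" using R(1,3) by (simp add: linear_add linear_scale)
    then show "indicator (cball 0 1) (R y + t *\<^sub>R e') = (indicator (cball 0 1) (y + t *\<^sub>R e) :: ennreal)"
      using isometry by (simp add: indicator_def)
  qed
  also have "\<dots> = emeasure (slices e) (cball 0 1)" by (subst emeasure_slices[OF e(1,3)]) auto
  finally show ?thesis by simp
qed

lemma emeasure_slices_unit_cube:
  fixes b :: "'a::euclidean_space"
  assumes b: "b \<in> Basis" and dim: "DIM('a) \<ge> 2"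
  shows "emeasure (slices b) (cbox 0 One) = hausdorff_outer (real DIM('a) - 1) (cbox 0 (\<Sum>(Basis - {b})))"
proof -
  let ?face = "cbox 0 (\<Sum>(Basis - {b}))"
  have face_inner: "(\<Sum>(Basis - {b})) \<bullet> i = (if i = b then 0 else 1)" if "i \<in> Basis" for i
    using that by (simp add: inner_sum_Basis_subset)
  have proj: "proj_perp b x \<bullet> i = (if i = b then 0 else x \<bullet> i)" if "i \<in> Basis" for i x
    using b that by (auto simp: proj_perp_def inner_diff_left inner_Basis)
  have "cbox 0 One = {x. proj_perp b x \<in> ?face \<and> x \<bullet> b \<in> {0..1}}"
    using b by (auto simp: mem_box face_inner proj split: if_splits)
  then have "emeasure (slices b) (cbox 0 One) = hausdorff_outer (real DIM('a) - 1) (hplane b \<inter> ?face)"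
    using b dim by (simp only:) (subst emeasure_slices_product, auto)
  also have "hplane b \<inter> ?face = ?face" using b by (force simp: mem_box face_inner)
  finally show ?thesis .
qed

definition slice_const :: "'a::euclidean_space itself \<Rightarrow> real" where
  "slice_const _ = enn2real (hausdorff_outer (real DIM('a) - 1) (cbox 0 (\<Sum>(Basis - {SOME b::'a. b \<in> Basis}))))"

lemma slice_const_pos:
  assumes "DIM('a::euclidean_space) \<ge> 2"
  shows "0 < slice_const TYPE('a)"
    and "ennreal (slice_const TYPE('a)) = hausdorff_outer (real DIM('a) - 1) (cbox 0 (\<Sum>(Basis - {SOME b::'a. b \<in> Basis})))"
proof -
  define b where "b = (SOME b::'a. b \<in> Basis)"
  have b: "b \<in> Basis" unfolding b_def using nonempty_Basis by (metis ex_in_conv someI_ex)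
  let ?H = "hausdorff_outer (real DIM('a) - 1) (cbox 0 (\<Sum>(Basis - {b})))"
  note card = card_Basis_minus_singleton[OF b assms]
  have "ennreal (kappa (real DIM('a) - 1) / 2 ^ card (Basis - {b})) \<le> ?H"
    using hausdorff_outer_unit_cube_ge[of "Basis - {b}"] card by auto
  moreover have "0 < kappa (real DIM('a) - 1)" using assms by (intro unit_ball_vol_pos) simp
  ultimately have "0 < ?H" by (auto intro: less_le_trans[rotated])
  moreover have "?H < top"
    using hausdorff_outer_unit_cube_le[of "Basis - {b}"] card by (auto intro: order_le_less_trans)
  ultimately show "0 < slice_const TYPE('a)"
      "ennreal (slice_const TYPE('a)) = hausdorff_outer (real DIM('a) - 1) (cbox 0 (\<Sum>(Basis - {SOME b::'a. b \<in> Basis})))"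
    unfolding slice_const_def b_def[symmetric] by (auto simp: enn2real_positive_iff)
qed

lemma slices_eq_density:
  fixes e :: "'a::euclidean_space"
  assumes e: "norm e = 1" "DIM('a) \<ge> 2"
  shows "slices e = density lborel (\<lambda>_. ennreal (slice_const TYPE('a)))"
proof (rule measure_eqI)
  define b where "b = (SOME b::'a. b \<in> Basis)"
  have b: "b \<in> Basis" unfolding b_def using nonempty_Basis by (metis ex_in_conv someI_ex)
  have proportional: "emeasure (slices e) B = emeasure (slices e) (cbox 0 One) * emeasure lborel B"
    if "norm e = 1" "B \<in> sets borel" for e :: 'a and B
    by (rule translation_invariant_eq_lborel[OF sigma_finite_slices[OF that(1) e(2)] translation_invariant_slices[OF that(1) e(2)] that(2)])
  let ?ball = "emeasure lborel (cball (0::'a) 1)"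
  have ball: "?ball \<noteq> 0" "?ball \<noteq> top"
    using emeasure_cball[of 1 "0::'a"] by (simp_all add: less_imp_neq[OF unit_ball_vol_pos, symmetric])
  have "?ball * emeasure (slices e) (cbox 0 One) = ?ball * emeasure (slices b) (cbox 0 One)"
    using proportional[of e "cball 0 1"] proportional[of b "cball 0 1"] emeasure_slices_cball_eq[of e b] e b
    by (simp add: mult.commute)
  then have "emeasure (slices e) (cbox 0 One) = emeasure (slices b) (cbox 0 One)"
    using ball by (simp add: ennreal_mult_cancel_left)
  also have "\<dots> = ennreal (slice_const TYPE('a))"
    unfolding slice_const_pos(2)[OF e(2)] b_def[symmetric] by (rule emeasure_slices_unit_cube[OF b e(2)])
  finally show "emeasure (slices e) B = emeasure (density lborel (\<lambda>_. ennreal (slice_const TYPE('a)))) B"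
    if "B \<in> sets (slices e)" for B
    using proportional[OF e(1), of B] that by (simp add: emeasure_density nn_integral_cmult)
qed simp

lemma nn_integral_slices_eq_lborel:
  fixes e :: "'a::euclidean_space"
  assumes e: "norm e = 1" "DIM('a) \<ge> 2" and f [measurable]: "f \<in> borel_measurable borel"
  shows "(\<integral>\<^sup>+y. \<integral>\<^sup>+t. f (y + t *\<^sub>R e) \<partial>lborel \<partial>surface (hplane e))
      = ennreal (slice_const TYPE('a)) * (\<integral>\<^sup>+x. f x \<partial>lborel)"
  using nn_integral_slices[OF e f, symmetric]
  by (simp add: slices_eq_density[OF e] nn_integral_density nn_integral_cmult)

lemma
  fixes e :: "'a::euclidean_space" and F :: "'a \<Rightarrow> real"
  assumes e: "norm e = 1" "DIM('a) \<ge> 2" and F: "integrable lborel F"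
  shows AE_integrable_slices: "AE y in surface (hplane e). integrable lborel (\<lambda>t. F (y + t *\<^sub>R e))"
    and integral_slices_eq_lborel:
      "(\<integral>y. \<integral>t. F (y + t *\<^sub>R e) \<partial>lborel \<partial>surface (hplane e)) = slice_const TYPE('a) * (\<integral>x. F x \<partial>lborel)"
proof -
  have [measurable]: "F \<in> borel_measurable borel" using F by simp
  interpret S: sigma_finite_measure "surface (hplane e)" by (rule sigma_finite_surface_hplane[OF e])
  interpret pair_sigma_finite "surface (hplane e)" lborel ..
  have const_nonneg: "0 \<le> slice_const TYPE('a)" using slice_const_pos(1)[OF e(2)] by simp
  have "integrable (slices e) F"
    unfolding slices_eq_density[OF e] using F const_nonneg by (subst integrable_density) auto
  then have pair_integrable: "integrable (surface (hplane e) \<Otimes>\<^sub>M lborel) (\<lambda>(y, t). F (y + t *\<^sub>R e))"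
    unfolding slices_def by (subst (asm) integrable_distr_eq) (auto simp: split_beta')
  show "AE y in surface (hplane e). integrable lborel (\<lambda>t. F (y + t *\<^sub>R e))"
    using AE_integrable_fst[OF pair_integrable] .
  have "(\<integral>y. \<integral>t. F (y + t *\<^sub>R e) \<partial>lborel \<partial>surface (hplane e))
      = (\<integral>p. F (fst p + snd p *\<^sub>R e) \<partial>(surface (hplane e) \<Otimes>\<^sub>M lborel))"
    using integral_fst'[OF pair_integrable] by (simp add: split_beta')
  also have "\<dots> = (\<integral>x. F x \<partial>slices e)"
    unfolding slices_def by (subst integral_distr) (auto simp: split_beta')
  also have "\<dots> = slice_const TYPE('a) * (\<integral>x. F x \<partial>lborel)"
    unfolding slices_eq_density[OF e] using const_nonneg by (subst integral_density) auto
  finally show "(\<integral>y. \<integral>t. F (y + t *\<^sub>R e) \<partial>lborel \<partial>surface (hplane e)) = slice_const TYPE('a) * (\<integral>x. F x \<partial>lborel)" .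
qed

section \<open>Projections of hyperplanes and of flat sets\<close>

text \<open>The volume of the slanted cylinder with base \<open>A\<close> in the hyperplane orthogonal to \<open>n\<close> and axis \<open>e\<close> is computed
  twice, by slicing along \<open>e\<close> and along \<open>n\<close>; this compares \<open>A\<close> with its projection along \<open>e\<close>.\<close>

definition oblique_proj :: "'a::euclidean_space \<Rightarrow> 'a \<Rightarrow> 'a \<Rightarrow> 'a" where
  "oblique_proj n e x = x - ((x \<bullet> n) / (n \<bullet> e)) *\<^sub>R e"

definition skew_cylinder :: "'a::euclidean_space \<Rightarrow> 'a \<Rightarrow> 'a set \<Rightarrow> 'a set" where
  "skew_cylinder n e A = {x. (x \<bullet> n) / (n \<bullet> e) \<in> {0..1} \<and> oblique_proj n e x \<in> A}"

lemma oblique_proj_measurable [measurable]: "oblique_proj n e \<in> borel_measurable borel"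
  unfolding oblique_proj_def by measurable

lemma skew_cylinder_borel [measurable]:
  assumes [measurable]: "A \<in> sets borel"
  shows "skew_cylinder n e A \<in> sets borel"
  unfolding skew_cylinder_def by measurable

lemma hplane_Int_vimage_oblique_proj:
  fixes n e :: "'a::euclidean_space"
  assumes e: "norm e = 1" and ne: "n \<bullet> e \<noteq> 0" and An: "A \<subseteq> hplane n"
  shows "hplane e \<inter> {y. oblique_proj n e y \<in> A} = proj_perp e ` A"
proof (intro subset_antisym subsetI)
  fix y assume y: "y \<in> hplane e \<inter> {y. oblique_proj n e y \<in> A}"
  then have "proj_perp e (oblique_proj n e y) = y"
    using e by (simp add: proj_perp_def oblique_proj_def inner_diff_left norm_eq_1)
  then show "y \<in> proj_perp e ` A" using y by (metis IntD2 image_eqI mem_Collect_eq)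
next
  fix y assume "y \<in> proj_perp e ` A"
  then obtain a where a: "a \<in> A" "y = proj_perp e a" by auto
  have "a \<bullet> n = 0" using a An by auto
  then have "y \<bullet> n = - (a \<bullet> e) * (n \<bullet> e)"
    using a by (simp add: proj_perp_def inner_diff_left inner_commute[of e n])
  then have "oblique_proj n e y = a" using a ne by (simp add: oblique_proj_def proj_perp_def)
  then show "y \<in> hplane e \<inter> {y. oblique_proj n e y \<in> A}" using a by (simp add: proj_perp_inner[OF e])
qed

lemma emeasure_skew_cylinder_axis:
  fixes n e :: "'a::euclidean_space"
  assumes e: "norm e = 1" and dim: "DIM('a) \<ge> 2" and ne: "0 < n \<bullet> e"
    and A [measurable]: "A \<in> sets borel" and An: "A \<subseteq> hplane n"
  shows "ennreal (slice_const TYPE('a)) * emeasure lborel (skew_cylinder n e A)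
    = hausdorff_outer (real DIM('a) - 1) (proj_perp e ` A)"
proof -
  let ?B = "{y. oblique_proj n e y \<in> A}"
  have B: "?B \<in> sets borel" by measurable
  have "ennreal (slice_const TYPE('a)) * emeasure lborel (skew_cylinder n e A)
      = (\<integral>\<^sup>+y. \<integral>\<^sup>+t. indicator (skew_cylinder n e A) (y + t *\<^sub>R e) \<partial>lborel \<partial>surface (hplane e))"
    using nn_integral_slices_eq_lborel[OF e dim, of "indicator (skew_cylinder n e A)"] by simp
  also have "\<dots> = (\<integral>\<^sup>+y. indicator ?B y \<partial>surface (hplane e))"
  proof (rule nn_integral_cong)
    fix y
    let ?c = "(y \<bullet> n) / (n \<bullet> e)"
    have quotient: "((y + t *\<^sub>R e) \<bullet> n) / (n \<bullet> e) = ?c + t" for t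
      using ne by (simp add: inner_add_left inner_commute[of e n] add_divide_distrib)
    have "y + t *\<^sub>R e \<in> skew_cylinder n e A \<longleftrightarrow> t \<in> {- ?c .. 1 - ?c} \<and> oblique_proj n e y \<in> A" for t
      unfolding skew_cylinder_def mem_Collect_eq oblique_proj_def quotient by (auto simp: algebra_simps)
    then have "(\<integral>\<^sup>+t. indicator (skew_cylinder n e A) (y + t *\<^sub>R e) \<partial>lborel)
        = (\<integral>\<^sup>+t. indicator ?B y * indicator {- ?c .. 1 - ?c} t \<partial>lborel)"
      by (intro nn_integral_cong) (auto simp: indicator_def)
    also have "\<dots> = indicator ?B y" by (subst nn_integral_cmult) auto
    finally show "(\<integral>\<^sup>+t. indicator (skew_cylinder n e A) (y + t *\<^sub>R e) \<partial>lborel) = indicator ?B y" .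
  qed
  also have "\<dots> = hausdorff_outer (real DIM('a) - 1) (proj_perp e ` A)"
    using B ne by (simp add: emeasure_hausdorff_within hplane_Int_vimage_oblique_proj[OF e _ An])
  finally show ?thesis .
qed

lemma add_scaleR_normal_mem_skew_cylinder:
  fixes n e y :: "'a::euclidean_space"
  assumes n: "norm n = 1" and ne: "0 < n \<bullet> e" and y: "y \<bullet> n = 0"
  shows "y + t *\<^sub>R n \<in> skew_cylinder n e A \<longleftrightarrow> t \<in> {0..n \<bullet> e} \<and> t *\<^sub>R (n - (1 / (n \<bullet> e)) *\<^sub>R e) + y \<in> A"
proof -
  have height: "(y + t *\<^sub>R n) \<bullet> n = t" using y n by (simp add: inner_add_left norm_eq_1)
  show ?thesis
    unfolding skew_cylinder_def mem_Collect_eq oblique_proj_def height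
    using ne by (auto simp: algebra_simps zero_le_divide_iff)
qed

lemma emeasure_skew_cylinder_base:
  fixes n e :: "'a::euclidean_space"
  assumes n: "norm n = 1" and dim: "DIM('a) \<ge> 2" and ne: "0 < n \<bullet> e"
    and A [measurable]: "A \<in> sets borel" and An: "A \<subseteq> hplane n"
  shows "ennreal (slice_const TYPE('a)) * emeasure lborel (skew_cylinder n e A)
    = ennreal (n \<bullet> e) * hausdorff_outer (real DIM('a) - 1) A"
proof -
  let ?k = "n \<bullet> e" and ?w = "n - (1 / (n \<bullet> e)) *\<^sub>R e"
  interpret S: sigma_finite_measure "surface (hplane n)" by (rule sigma_finite_surface_hplane[OF n dim])
  interpret pair_sigma_finite "surface (hplane n)" lborel ..
  have w: "?w \<bullet> n = 0" using n ne by (simp add: inner_diff_left norm_eq_1 inner_commute[of e n])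
  have "ennreal (slice_const TYPE('a)) * emeasure lborel (skew_cylinder n e A)
      = (\<integral>\<^sup>+y. \<integral>\<^sup>+t. indicator (skew_cylinder n e A) (y + t *\<^sub>R n) \<partial>lborel \<partial>surface (hplane n))"
    using nn_integral_slices_eq_lborel[OF n dim, of "indicator (skew_cylinder n e A)"] by simp
  also have "\<dots> = (\<integral>\<^sup>+y. \<integral>\<^sup>+t. indicator {0..?k} t * indicator A (t *\<^sub>R ?w + y) \<partial>lborel \<partial>surface (hplane n))"
  proof (rule nn_integral_cong_AE, use AE_hausdorff_within[OF hplane_borel] in eventually_elim)
    case (elim y)
    then have "y + t *\<^sub>R n \<in> skew_cylinder n e A \<longleftrightarrow> t \<in> {0..?k} \<and> t *\<^sub>R ?w + y \<in> A" for t
      by (intro add_scaleR_normal_mem_skew_cylinder n ne) simp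
    then show ?case by (intro nn_integral_cong) (auto simp: indicator_def)
  qed
  also have "\<dots> = (\<integral>\<^sup>+t. \<integral>\<^sup>+y. indicator {0..?k} t * indicator A (t *\<^sub>R ?w + y) \<partial>surface (hplane n) \<partial>lborel)"
    by (rule Fubini'[symmetric]) measurable
  also have "\<dots> = (\<integral>\<^sup>+t. indicator {0..?k} t * hausdorff_outer (real DIM('a) - 1) A \<partial>lborel)"
  proof (rule nn_integral_cong)
    fix t
    have "(\<integral>\<^sup>+y. indicator A (t *\<^sub>R ?w + y) \<partial>surface (hplane n)) = hausdorff_outer (real DIM('a) - 1) A"
      using An by (subst nn_integral_surface_hplane_translate)
        (auto simp: w inner_scaleR_left emeasure_hausdorff_within Int_absorb1 simp del: scaleR_right_diff_distrib)
    then show "(\<integral>\<^sup>+y. indicator {0..?k} t * indicator A (t *\<^sub>R ?w + y) \<partial>surface (hplane n))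
        = indicator {0..?k} t * hausdorff_outer (real DIM('a) - 1) A"
      by (simp add: nn_integral_cmult)
  qed
  also have "\<dots> = ennreal ?k * hausdorff_outer (real DIM('a) - 1) A" using ne by (simp add: nn_integral_multc)
  finally show ?thesis .
qed

lemma hausdorff_outer_proj_hplane:
  fixes n e :: "'a::euclidean_space"
  assumes "norm n = 1" "norm e = 1" "DIM('a) \<ge> 2" "0 < n \<bullet> e" "A \<in> sets borel" "A \<subseteq> hplane n"
  shows "hausdorff_outer (real DIM('a) - 1) (proj_perp e ` A) = ennreal (n \<bullet> e) * hausdorff_outer (real DIM('a) - 1) A"
  using emeasure_skew_cylinder_axis[OF assms(2-6)] emeasure_skew_cylinder_base[OF assms(1,3-6)] by simp

definition within_factor :: "real \<Rightarrow> ennreal \<Rightarrow> ennreal \<Rightarrow> bool" where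
  "within_factor L a b \<longleftrightarrow> a \<le> ennreal L * b \<and> b \<le> ennreal L * a"

lemma within_factor_mono: "within_factor L a b \<Longrightarrow> L \<le> M \<Longrightarrow> within_factor M a b"
  unfolding within_factor_def by (meson ennreal_leI mult_right_mono order_trans zero_le)

lemma within_factor_mult_left: "within_factor L a b \<Longrightarrow> within_factor L (c * a) (c * b)"
  unfolding within_factor_def by (simp add: mult.left_commute[of "ennreal L"] mult_left_mono)

lemma within_factor_sym: "within_factor L a b \<Longrightarrow> within_factor L b a"
  by (simp add: within_factor_def)

lemma within_factor_trans:
  assumes ab: "within_factor L a b" and bc: "within_factor M b c" and "0 \<le> L" "0 \<le> M"
  shows "within_factor (L * M) a c"
proof -
  have "a \<le> ennreal L * (ennreal M * c)" "c \<le> ennreal M * (ennreal L * a)"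
    using ab bc unfolding within_factor_def by (meson mult_left_mono order_trans zero_le)+
  then show ?thesis using assms(3,4) by (simp add: within_factor_def ennreal_mult mult_ac)
qed

lemma ennreal_le_of_le_mult:
  assumes "\<And>\<eta>::real. 0 < \<eta> \<Longrightarrow> a \<le> ennreal (1 + \<eta>) * b"
  shows "a \<le> b"
proof (rule ennreal_le_epsilon)
  fix e :: real assume e: "b < top" "0 < e"
  obtain r where r: "0 \<le> r" "b = ennreal r" using e by (cases b) auto
  have "a \<le> ennreal (1 + e / (r + 1)) * b" using e r by (intro assms) auto
  also have "\<dots> = ennreal ((1 + e / (r + 1)) * r)" unfolding r(2) using r e by (intro ennreal_mult[symmetric]) auto
  also have "\<dots> \<le> ennreal (r + e)"
  proof (rule ennreal_leI)
    have "e / (r + 1) * r \<le> e" using r e by (simp add: field_simps)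
    then show "(1 + e / (r + 1)) * r \<le> r + e" by (simp add: algebra_simps)
  qed
  also have "\<dots> = b + ennreal e" using r e by simp
  finally show "a \<le> b + ennreal e" .
qed

lemma emeasure_le_of_locally_le:
  fixes M N :: "'a::euclidean_space measure"
  assumes sets [measurable_cong]: "sets M = sets borel" "sets N = sets borel"
    and local: "\<And>x. x \<in> S \<Longrightarrow> \<exists>U. open U \<and> x \<in> U \<and> (\<forall>B\<in>sets borel. B \<subseteq> S \<inter> U \<longrightarrow> emeasure M B \<le> emeasure N B)"
    and B: "B \<in> sets borel" "B \<subseteq> S"
  shows "emeasure M B \<le> emeasure N B"
proof (cases "B = {}")
  case False
  define F where "F = {U. open U \<and> (\<forall>B\<in>sets borel. B \<subseteq> S \<inter> U \<longrightarrow> emeasure M B \<le> emeasure N B)}"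
  obtain F' where F': "F' \<subseteq> F" "countable F'" "\<Union>F' = \<Union>F"
    using Lindelof[of F] by (auto simp: F_def)
  have cover: "S \<subseteq> \<Union>F'" using local F'(3) by (fastforce simp: F_def)
  then have nonempty: "F' \<noteq> {}" using False B by auto
  define U where "U = from_nat_into F'"
  have U: "U i \<in> F" for i using F'(1) nonempty from_nat_into[OF nonempty] by (auto simp: U_def)
  then have U_borel: "U i \<in> sets borel" for i by (auto simp: F_def)
  let ?D = "\<lambda>i. B \<inter> disjointed U i"
  have D_borel: "?D i \<in> sets borel" for i using B U_borel sets.range_disjointed_sets[of U borel] by auto
  have disjoint: "disjoint_family ?D" using disjoint_family_disjointed[of U] by (auto simp: disjoint_family_on_def)
  have "(\<Union>i. ?D i) = B \<inter> (\<Union>i. U i)" by (simp flip: Int_UN_distrib add: UN_disjointed_eq)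
  also have "\<dots> = B" using cover B range_from_nat_into[OF nonempty F'(2)] by (auto simp: U_def)
  finally have union: "(\<Union>i. ?D i) = B" .
  have sum_pieces: "(\<Sum>i. emeasure L (?D i)) = emeasure L B" if "sets L = sets borel" for L :: "'a measure"
  proof -
    have "range ?D \<subseteq> sets L" using D_borel that by blast
    from suminf_emeasure[OF this disjoint] show ?thesis by (simp only: union)
  qed
  have "emeasure M B = (\<Sum>i. emeasure M (?D i))" using sum_pieces[OF sets(1)] by simp
  also have "\<dots> \<le> (\<Sum>i. emeasure N (?D i))"
  proof (rule suminf_le)
    fix i
    have "?D i \<subseteq> S \<inter> U i" using B disjointed_subset[of U i] by auto
    then show "emeasure M (?D i) \<le> emeasure N (?D i)" using U[of i] D_borel[of i] by (auto simp: F_def)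
  qed auto
  also have "\<dots> = emeasure N B" by (rule sum_pieces[OF sets(2)])
  finally show ?thesis .
qed simp

lemma emeasure_eq_of_locally_within_factor:
  fixes M N :: "'a::euclidean_space measure"
  assumes sets: "sets M = sets borel" "sets N = sets borel"
    and local: "\<And>x \<eta>. x \<in> S \<Longrightarrow> 0 < \<eta> \<Longrightarrow>
      \<exists>U. open U \<and> x \<in> U \<and> (\<forall>B\<in>sets borel. B \<subseteq> S \<inter> U \<longrightarrow> within_factor (1 + \<eta>) (emeasure M B) (emeasure N B))"
    and B: "B \<in> sets borel" "B \<subseteq> S"
  shows "emeasure M B = emeasure N B"
proof (rule antisym; rule ennreal_le_of_le_mult)
  fix \<eta> :: real assume \<eta>: "0 < \<eta>"
  have "emeasure M B \<le> emeasure (scale_measure (ennreal (1 + \<eta>)) N) B"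
    using local[OF _ \<eta>] sets B
    by (intro emeasure_le_of_locally_le[of M _ S]) (simp_all add: within_factor_def, meson)
  then show "emeasure M B \<le> ennreal (1 + \<eta>) * emeasure N B" by simp
  have "emeasure N B \<le> emeasure (scale_measure (ennreal (1 + \<eta>)) M) B"
    using local[OF _ \<eta>] sets B
    by (intro emeasure_le_of_locally_le[of N _ S]) (simp_all add: within_factor_def, meson)
  then show "emeasure N B \<le> ennreal (1 + \<eta>) * emeasure M B" by simp
qed

lemma hausdorff_outer_images_within_factor:
  fixes f :: "'a \<Rightarrow> 'b::euclidean_space" and g :: "'a \<Rightarrow> 'c::euclidean_space"
  assumes "\<And>x y. x \<in> A \<Longrightarrow> y \<in> A \<Longrightarrow> dist (f x) (f y) \<le> L * dist (g x) (g y)"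
    and "\<And>x y. x \<in> A \<Longrightarrow> y \<in> A \<Longrightarrow> dist (g x) (g y) \<le> L * dist (f x) (f y)"
    and "0 < L" "0 \<le> s"
  shows "within_factor (L powr s) (hausdorff_outer s (f ` A)) (hausdorff_outer s (g ` A))"
  unfolding within_factor_def using assms by (intro conjI hausdorff_outer_image_le)

lemma injective_image_compact_borel:
  fixes f :: "'a::euclidean_space \<Rightarrow> 'b::euclidean_space"
  assumes Q: "compact Q" "continuous_on Q f" "inj_on f Q" and B: "B \<in> sets borel" "B \<subseteq> Q"
  shows "f ` B \<in> sets borel"
proof -
  have "continuous_on (f ` Q) (inv_into Q f)" using Q by (intro continuous_on_inv) auto
  then have "inv_into Q f \<in> borel_measurable (restrict_space borel (f ` Q))"
    by (rule borel_measurable_continuous_on_restrict)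
  then have "inv_into Q f -` B \<inter> f ` Q \<in> sets (restrict_space borel (f ` Q))"
    using measurable_sets[of "inv_into Q f" "restrict_space borel (f ` Q)" borel B] B by (simp add: space_restrict_space)
  moreover have "inv_into Q f -` B \<inter> f ` Q = f ` B"
    using B(2) Q(3) by (auto simp: inv_into_f_f image_iff subset_iff)
  moreover have "f ` Q \<in> sets borel" using Q by (intro borel_compact compact_continuous_image)
  ultimately show ?thesis by (auto simp: sets_restrict_space_iff)
qed

definition flat_along :: "'a::euclidean_space \<Rightarrow> real \<Rightarrow> 'a set \<Rightarrow> bool" where
  "flat_along n \<epsilon> Q \<longleftrightarrow> (\<forall>x\<in>Q. \<forall>y\<in>Q. \<bar>(x - y) \<bullet> n\<bar> \<le> \<epsilon> * dist x y)"

lemma flat_alongD: "flat_along n \<epsilon> Q \<Longrightarrow> x \<in> Q \<Longrightarrow> y \<in> Q \<Longrightarrow> \<bar>(x - y) \<bullet> n\<bar> \<le> \<epsilon> * norm (x - y)"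
  by (simp add: flat_along_def dist_norm)

lemma flat_along_mono:
  assumes "flat_along n \<epsilon> Q" "B \<subseteq> Q" "\<epsilon> \<le> \<delta>"
  shows "flat_along n \<delta> B"
  using assms unfolding flat_along_def by (meson mult_right_mono order_trans subsetD zero_le_dist)

lemma norm_diff_le_proj_normal:
  assumes n: "norm n = 1" and flat: "flat_along n \<epsilon> Q" and xy: "x \<in> Q" "y \<in> Q"
  shows "(1 - \<epsilon>) * norm (x - y) \<le> norm (proj_perp n (x - y))"
proof -
  have "norm (x - y) \<le> norm (proj_perp n (x - y)) + norm (((x - y) \<bullet> n) *\<^sub>R n)"
    unfolding proj_perp_def by (metis diff_add_cancel norm_triangle_ineq)
  also have "norm (((x - y) \<bullet> n) *\<^sub>R n) \<le> \<epsilon> * norm (x - y)" using flat_alongD[OF flat xy] n by simp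
  finally show ?thesis by (simp add: algebra_simps)
qed

lemma norm_diff_le_proj_oblique:
  assumes n: "norm n = 1" and e: "norm e = 1" and ne: "0 < n \<bullet> e" and \<epsilon>: "\<epsilon> \<le> (n \<bullet> e) / 2"
    and flat: "flat_along n \<epsilon> Q" and xy: "x \<in> Q" "y \<in> Q"
  shows "norm (x - y) \<le> 2 * (1 + 1 / (n \<bullet> e)) * norm (proj_perp e (x - y))"
proof -
  define t where "t = (x - y) \<bullet> e"
  define z where "z = proj_perp e (x - y)"
  have z: "x - y = z + t *\<^sub>R e" by (simp add: z_def t_def proj_perp_def)
  have "(x - y) \<bullet> n = z \<bullet> n + t * (n \<bullet> e)" by (subst z) (simp add: inner_add_left inner_commute[of e n])
  then have "\<bar>t\<bar> * (n \<bullet> e) \<le> \<bar>(x - y) \<bullet> n\<bar> + \<bar>z \<bullet> n\<bar>"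
    using ne by (metis abs_minus_commute abs_mult abs_of_pos abs_triangle_ineq4 add_diff_cancel_left')
  also have "\<dots> \<le> (n \<bullet> e) / 2 * norm (x - y) + norm z"
    using flat_alongD[OF flat xy] Cauchy_Schwarz_ineq2[of z n] n mult_right_mono[OF \<epsilon>, of "norm (x - y)"] by simp
  finally have "\<bar>t\<bar> \<le> norm (x - y) / 2 + norm z / (n \<bullet> e)" using ne by (simp add: field_simps)
  moreover have "norm (x - y) \<le> norm z + \<bar>t\<bar>" using norm_triangle_ineq[of z "t *\<^sub>R e"] z e by simp
  moreover define q where "q = norm z / (n \<bullet> e)"
  ultimately have "norm (x - y) \<le> 2 * (norm z + q)" by simp
  then show ?thesis by (simp add: q_def z_def algebra_simps)
qed

lemma proj_oblique_of_proj_normal_estimate: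
  assumes n: "norm n = 1" and e: "norm e = 1" and ne: "0 < n \<bullet> e" and \<epsilon>: "0 < \<epsilon>" "\<epsilon> \<le> (n \<bullet> e) / 2"
    and flat: "flat_along n \<epsilon> Q" and xy: "x \<in> Q" "y \<in> Q"
  shows "norm (proj_perp e (x - y) - proj_perp e (proj_perp n (x - y)))
    \<le> 2 * (1 + 1 / (n \<bullet> e)) * \<epsilon> * norm (proj_perp e (x - y))"
proof -
  have "proj_perp e (x - y) - proj_perp e (proj_perp n (x - y)) = ((x - y) \<bullet> n) *\<^sub>R proj_perp e n"
    by (simp add: proj_perp_def algebra_simps inner_diff_left)
  then have "norm (proj_perp e (x - y) - proj_perp e (proj_perp n (x - y))) = \<bar>(x - y) \<bullet> n\<bar> * norm (proj_perp e n)"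
    by simp
  also have "\<dots> \<le> (\<epsilon> * norm (x - y)) * 1"
    using flat_alongD[OF flat xy] norm_proj_perp_le[OF e, of n] n \<epsilon> by (intro mult_mono) auto
  also have "\<dots> \<le> \<epsilon> * (2 * (1 + 1 / (n \<bullet> e)) * norm (proj_perp e (x - y)))"
    using norm_diff_le_proj_oblique[OF n e ne \<epsilon>(2) flat xy] \<epsilon> by simp
  finally show ?thesis by (simp add: mult_ac)
qed

lemma one_le_inverse_one_minus:
  fixes \<epsilon> :: real
  assumes "0 < \<epsilon>" "\<epsilon> < 1"
  shows "1 \<le> 1 / (1 - \<epsilon>)" "1 + \<epsilon> \<le> 1 / (1 - \<epsilon>)"
  using assms by (auto simp: field_simps)

lemma hausdorff_outer_proj_normal_within_factor:
  assumes n: "norm n = 1" and flat: "flat_along n \<epsilon> B" and \<epsilon>: "0 < \<epsilon>" "\<epsilon> < 1" and s: "0 \<le> s"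
  shows "within_factor ((1 / (1 - \<epsilon>)) powr s) (hausdorff_outer s (proj_perp n ` B)) (hausdorff_outer s B)"
proof -
  have "within_factor ((1 / (1 - \<epsilon>)) powr s) (hausdorff_outer s (proj_perp n ` B)) (hausdorff_outer s ((\<lambda>x. x) ` B))"
  proof (rule hausdorff_outer_images_within_factor[OF _ _ _ s])
    fix x y assume xy: "x \<in> B" "y \<in> B"
    have "norm (proj_perp n (x - y)) \<le> 1 * norm (x - y)" using norm_proj_perp_le[OF n] by simp
    also have "\<dots> \<le> 1 / (1 - \<epsilon>) * norm (x - y)"
      using one_le_inverse_one_minus[OF \<epsilon>] by (intro mult_right_mono) auto
    finally show "dist (proj_perp n x) (proj_perp n y) \<le> 1 / (1 - \<epsilon>) * dist x y"
      by (simp add: dist_norm proj_perp_diff)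
    show "dist x y \<le> 1 / (1 - \<epsilon>) * dist (proj_perp n x) (proj_perp n y)"
      using norm_diff_le_proj_normal[OF n flat xy] \<epsilon> by (simp add: dist_norm proj_perp_diff field_simps)
  qed (use \<epsilon> in simp)
  then show ?thesis by simp
qed

lemma hausdorff_outer_proj_oblique_within_factor:
  assumes n: "norm n = 1" and e: "norm e = 1" and ne: "0 < n \<bullet> e"
    and flat: "flat_along n \<epsilon> B" and \<epsilon>: "0 < \<epsilon>" "\<epsilon> \<le> (n \<bullet> e) / 2" and s: "0 \<le> s"
  defines "\<theta> \<equiv> 2 * (1 + 1 / (n \<bullet> e)) * \<epsilon>"
  assumes \<theta>: "\<theta> < 1"
  shows "within_factor ((1 / (1 - \<theta>)) powr s)
    (hausdorff_outer s (proj_perp e ` B)) (hausdorff_outer s (proj_perp e ` proj_perp n ` B))"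
proof -
  let ?L = "1 / (1 - \<theta>)"
  have "0 < \<theta>" using ne \<epsilon> by (simp add: \<theta>_def add_pos_pos)
  note L = one_le_inverse_one_minus[OF this \<theta>]
  show ?thesis
    unfolding image_image
  proof (rule hausdorff_outer_images_within_factor[OF _ _ _ s])
    fix x y assume xy: "x \<in> B" "y \<in> B"
    let ?p = "norm (proj_perp e (x - y))" and ?q = "norm (proj_perp e (proj_perp n (x - y)))"
    have close: "\<bar>?p - ?q\<bar> \<le> \<theta> * ?p"
      using proj_oblique_of_proj_normal_estimate[OF n e ne \<epsilon> flat xy, folded \<theta>_def] norm_triangle_ineq3 order_trans by blast
    then have "?p \<le> ?L * ?q" using \<theta> by (simp add: field_simps)
    then show "dist (proj_perp e x) (proj_perp e y) \<le> ?L * dist (proj_perp e (proj_perp n x)) (proj_perp e (proj_perp n y))"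
      by (simp add: dist_norm proj_perp_diff)
    have "?q \<le> (1 + \<theta>) * ?p" using close by (simp add: algebra_simps)
    also have "\<dots> \<le> ?L * ?p" using L by (intro mult_right_mono) auto
    finally show "dist (proj_perp e (proj_perp n x)) (proj_perp e (proj_perp n y)) \<le> ?L * dist (proj_perp e x) (proj_perp e y)"
      by (simp add: dist_norm proj_perp_diff)
  qed (use \<theta> in simp)
qed

lemma proj_flat_compact_image_borel:
  assumes n: "norm n = 1" and flat: "flat_along n \<epsilon> Q" "\<epsilon> < 1" and Q: "compact Q" and B: "B \<in> sets borel" "B \<subseteq> Q"
  shows "proj_perp n ` B \<in> sets borel"
proof (rule injective_image_compact_borel[OF Q _ _ B])
  show "inj_on (proj_perp n) Q"
  proof (rule inj_onI)
    fix x y assume xy: "x \<in> Q" "y \<in> Q" and "proj_perp n x = proj_perp n y"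
    then have "(1 - \<epsilon>) * norm (x - y) \<le> 0"
      using norm_diff_le_proj_normal[OF n flat(1) xy] by (simp add: proj_perp_diff)
    then show "x = y" using flat(2) by (simp add: mult_le_0_iff)
  qed
qed (intro continuous_intros)

lemma hausdorff_outer_proj_flat_within_factor:
  fixes n e :: "'a::euclidean_space"
  assumes n: "norm n = 1" and e: "norm e = 1" and dim: "DIM('a) \<ge> 2" and ne: "0 < n \<bullet> e"
    and flat: "flat_along n \<epsilon> Q" and \<epsilon>: "0 < \<epsilon>" "\<epsilon> \<le> (n \<bullet> e) / 2"
    and Q: "compact Q" and B: "B \<in> sets borel" "B \<subseteq> Q"
  defines "\<theta> \<equiv> 2 * (1 + 1 / (n \<bullet> e)) * \<epsilon>" and "s \<equiv> real DIM('a) - 1"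
  assumes \<theta>: "\<theta> < 1"
  shows "within_factor ((1 / (1 - \<theta>)) powr s * (1 / (1 - \<theta>)) powr s)
    (hausdorff_outer s (proj_perp e ` B)) (ennreal (n \<bullet> e) * hausdorff_outer s B)"
proof -
  have s: "0 \<le> s" using dim by (simp add: s_def)
  have "\<epsilon> * 1 \<le> \<epsilon> * (2 * (1 + 1 / (n \<bullet> e)))" using ne \<epsilon> by (intro mult_left_mono) auto
  then have "\<epsilon> \<le> \<theta>" by (simp add: \<theta>_def mult_ac)
  then have \<epsilon>\<theta>: "0 < \<theta>" "\<epsilon> < 1" "flat_along n \<theta> B"
    using \<epsilon> \<theta> flat_along_mono[OF flat B(2)] by auto
  have "within_factor ((1 / (1 - \<theta>)) powr s) (hausdorff_outer s (proj_perp e ` B)) (hausdorff_outer s (proj_perp e ` proj_perp n ` B))"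
    using flat_along_mono[OF flat B(2)] \<theta> unfolding \<theta>_def
    by (intro hausdorff_outer_proj_oblique_within_factor n e ne \<epsilon> s) auto
  moreover have "hausdorff_outer s (proj_perp e ` proj_perp n ` B) = ennreal (n \<bullet> e) * hausdorff_outer s (proj_perp n ` B)"
    unfolding s_def using proj_perp_inner[OF n]
    by (intro hausdorff_outer_proj_hplane[OF n e dim ne proj_flat_compact_image_borel[OF n flat \<epsilon>\<theta>(2) Q B]]) auto
  moreover have "within_factor ((1 / (1 - \<theta>)) powr s)
      (ennreal (n \<bullet> e) * hausdorff_outer s (proj_perp n ` B)) (ennreal (n \<bullet> e) * hausdorff_outer s B)"
    by (intro within_factor_mult_left hausdorff_outer_proj_normal_within_factor[OF n \<epsilon>\<theta>(3,1) \<theta> s])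
  ultimately show ?thesis by (auto intro: within_factor_trans)
qed

section \<open>Convex bodies with unique normals\<close>

text \<open>The normal \<open>n\<close> is extended by \<open>0\<close> off the boundary to make it Borel measurable on the whole space.\<close>

locale smooth_body =
  fixes K :: "'a::euclidean_space set" and n :: "'a \<Rightarrow> 'a"
  assumes dim: "DIM('a) \<ge> 2" and compact_K: "compact K" and convex_K: "convex K" and interior_K: "interior K \<noteq> {}"
    and normal_unit: "x \<in> frontier K \<Longrightarrow> norm (n x) = 1"
    and normal_le: "x \<in> frontier K \<Longrightarrow> y \<in> K \<Longrightarrow> (y - x) \<bullet> n x \<le> 0"
    and normal_unique: "x \<in> frontier K \<Longrightarrow> norm u = 1 \<Longrightarrow> (\<And>y. y \<in> K \<Longrightarrow> (y - x) \<bullet> u \<le> 0) \<Longrightarrow> u = n x"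
    and normal_outside: "x \<notin> frontier K \<Longrightarrow> n x = 0"
begin

abbreviation "S \<equiv> frontier K"

lemma closed_K: "closed K"
  using compact_K by (rule compact_imp_closed)

lemma S_subset: "S \<subseteq> K"
  using closed_K by (simp add: frontier_subset_closed)

lemma compact_S: "compact S"
  using compact_K by (rule compact_frontier)

lemma S_borel [measurable]: "S \<in> sets borel"
  using compact_S by (rule borel_compact)

lemma K_borel [measurable]: "K \<in> sets borel"
  using compact_K by (rule borel_compact)

lemma normal_continuous: "continuous_on S n"
proof -
  have graph: "(\<lambda>x. (x, n x)) ` S = (S \<times> sphere 0 1) \<inter> (\<Inter>y\<in>K. {p. (y - fst p) \<bullet> snd p \<le> 0})"
  proof (intro subset_antisym subsetI)
    fix p assume p: "p \<in> (S \<times> sphere 0 1) \<inter> (\<Inter>y\<in>K. {p. (y - fst p) \<bullet> snd p \<le> 0})"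
    then have "snd p = n (fst p)" by (intro normal_unique) auto
    then show "p \<in> (\<lambda>x. (x, n x)) ` S" using p by (auto simp: image_iff prod_eq_iff)
  qed (use normal_unit normal_le in auto)
  have "closed (\<Inter>y\<in>K. {p :: 'a \<times> 'a. (y - fst p) \<bullet> snd p \<le> 0})"
    by (intro closed_INT ballI closed_Collect_le continuous_intros)
  then have "closedin (top_of_set (S \<times> sphere 0 1)) ((\<lambda>x. (x, n x)) ` S)"
    unfolding graph by (rule closedin_closed_Int)
  then show ?thesis
    using continuous_closed_graph_eq[of "sphere 0 1" n S] normal_unit by auto
qed

lemma normal_measurable [measurable]: "n \<in> borel_measurable borel"
proof -
  have "(\<lambda>x. if x \<in> S then n x else 0) \<in> borel_measurable borel"
    using normal_continuous S_borel by (intro borel_measurable_continuous_on_if) auto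
  moreover have "(\<lambda>x. if x \<in> S then n x else 0) = n" using normal_outside by auto
  ultimately show ?thesis by simp
qed

lemma norm_normal_le: "norm (n x) \<le> 1"
  using normal_unit[of x] normal_outside[of x] by (cases "x \<in> S") auto

lemma abs_normal_inner_le: "\<bar>n x \<bullet> v\<bar> \<le> norm v"
  using Cauchy_Schwarz_ineq2[of "n x" v] mult_right_mono[OF norm_normal_le[of x], of "norm v"] by simp

lemma locally_flat:
  assumes x0: "x0 \<in> S" and \<epsilon>: "0 < \<epsilon>"
  obtains \<delta> where "0 < \<delta>" "\<And>x. x \<in> S \<inter> cball x0 \<delta> \<Longrightarrow> norm (n x - n x0) \<le> \<epsilon>" "flat_along (n x0) \<epsilon> (S \<inter> cball x0 \<delta>)"
proof -
  obtain d where d: "d > 0" "\<And>x. x \<in> S \<Longrightarrow> dist x x0 < d \<Longrightarrow> dist (n x) (n x0) < \<epsilon>"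
    using normal_continuous x0 \<epsilon> unfolding continuous_on_iff by metis
  have close: "norm (n x - n x0) \<le> \<epsilon>" if "x \<in> S \<inter> cball x0 (d/2)" for x
    using d(2)[of x] that d(1) by (auto simp: dist_norm norm_minus_commute)
  have below: "(y - x) \<bullet> n x0 \<le> \<epsilon> * dist x y" if "x \<in> S \<inter> cball x0 (d/2)" "y \<in> S" for x y
  proof -
    have "(y - x) \<bullet> n x0 = (y - x) \<bullet> n x + (y - x) \<bullet> (n x0 - n x)" by (simp add: inner_diff_right)
    also have "\<dots> \<le> 0 + norm (y - x) * norm (n x0 - n x)"
      using normal_le[of x y] that S_subset by (intro add_mono norm_cauchy_schwarz) auto
    also have "\<dots> \<le> norm (y - x) * \<epsilon>"
      using close[OF that(1)] by (simp add: norm_minus_commute mult_left_mono)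
    finally show ?thesis by (simp add: dist_norm norm_minus_commute mult.commute)
  qed
  have "flat_along (n x0) \<epsilon> (S \<inter> cball x0 (d/2))"
    unfolding flat_along_def
  proof (intro ballI)
    fix x y assume xy: "x \<in> S \<inter> cball x0 (d/2)" "y \<in> S \<inter> cball x0 (d/2)"
    have "(x - y) \<bullet> n x0 = - ((y - x) \<bullet> n x0)" by (simp add: inner_diff_left)
    then show "\<bar>(x - y) \<bullet> n x0\<bar> \<le> \<epsilon> * dist x y"
      using below[of x y] below[of y x] xy by (auto simp: abs_le_iff dist_commute)
  qed
  then show ?thesis using that[of "d/2"] d close by auto
qed

text \<open>Otherwise a hyperplane separates the interior from the ray \<open>x - s e\<close>, so that it supports \<open>K\<close> at \<open>x\<close>; its
  normal is \<open>n x\<close>, but it cannot have a positive component along \<open>e\<close>.\<close>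

lemma interior_below:
  assumes x: "x \<in> S" and e: "0 < n x \<bullet> e"
  obtains s where "0 < s" "x - s *\<^sub>R e \<in> interior K"
proof (cases "\<exists>s\<ge>0. x - s *\<^sub>R e \<in> interior K")
  case True
  then obtain s where s: "0 \<le> s" "x - s *\<^sub>R e \<in> interior K" by auto
  then have "s \<noteq> 0" using x by (auto simp: frontier_def)
  then show ?thesis using s by (intro that[of s]) auto
next
  case False
  let ?ray = "(\<lambda>s. x - s *\<^sub>R e) ` {0..}"
  have "?ray = (\<lambda>z. x + z) ` (\<lambda>s. s *\<^sub>R (- e)) ` {0..}" by (auto simp: image_image)
  moreover have "linear (\<lambda>s. s *\<^sub>R (- e))" by (intro linearI) (auto simp: algebra_simps)
  ultimately have "convex ?ray" by (simp add: convex_linear_image convex_translation)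
  moreover have "interior K \<inter> ?ray = {}" using False by auto
  ultimately obtain a b where ab: "a \<noteq> 0" "\<forall>y\<in>interior K. a \<bullet> y \<le> b" "\<forall>y\<in>?ray. b \<le> a \<bullet> y"
    using separating_hyperplane_sets[of "interior K" ?ray] interior_K convex_K by (auto simp: convex_interior)
  have "closure (interior K) \<subseteq> {y. a \<bullet> y \<le> b}"
    using ab(2) by (intro closure_minimal closed_halfspace_le) auto
  then have K_below: "a \<bullet> y \<le> b" if "y \<in> K" for y
    using that convex_closure_interior[OF convex_K interior_K] closed_K by auto
  have ray: "b \<le> a \<bullet> x - s * (a \<bullet> e)" if "0 \<le> s" for s
    using ab(3) that by (auto simp: inner_diff_right)
  have b: "b = a \<bullet> x" using K_below[of x] ray[of 0] x S_subset by force
  have "a /\<^sub>R norm a = n x"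
  proof (rule normal_unique[OF x])
    fix y assume "y \<in> K"
    then have "a \<bullet> (y - x) \<le> 0" using K_below b by (simp add: inner_diff_right)
    then show "(y - x) \<bullet> (a /\<^sub>R norm a) \<le> 0"
      using ab(1) by (simp add: inner_commute[of _ a] mult_le_0_iff)
  qed (use ab(1) in simp)
  then have "n x \<bullet> e = (a \<bullet> e) / norm a" by (simp add: divide_inverse mult.commute flip: \<open>a /\<^sub>R norm a = n x\<close>)
  moreover have "a \<bullet> e \<le> 0" using ray[of 1] b by simp
  ultimately show ?thesis using e ab(1) by (simp add: zero_less_divide_iff)
qed

lemma normal_pos_of_interior_below:
  assumes x: "x \<in> S" and s: "0 < s" "x - s *\<^sub>R e \<in> interior K"
  shows "0 < n x \<bullet> e"
proof -
  obtain d where d: "d > 0" "ball (x - s *\<^sub>R e) d \<subseteq> K" using s(2) by (auto simp: mem_interior)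
  have "x - s *\<^sub>R e + (d/2) *\<^sub>R n x \<in> K"
    using d normal_unit[OF x] by (intro subsetD[OF d(2)]) (auto simp: dist_norm)
  then have "(x - s *\<^sub>R e + (d/2) *\<^sub>R n x - x) \<bullet> n x \<le> 0" by (rule normal_le[OF x])
  then have "d / 2 \<le> s * (n x \<bullet> e)"
    using normal_unit[OF x] by (simp add: inner_add_left inner_diff_left inner_commute[of e] norm_eq_1)
  then have "0 < s * (n x \<bullet> e)" using d by linarith
  then show ?thesis using s by (simp add: zero_less_mult_iff)
qed

section \<open>Projection of the boundary along a direction\<close>

definition height :: "'a \<Rightarrow> 'a \<Rightarrow> real" where
  "height e y = (if \<exists>t. y + t *\<^sub>R e \<in> K then Sup {t. y + t *\<^sub>R e \<in> K} else 0)"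

definition top_point :: "'a \<Rightarrow> 'a \<Rightarrow> 'a" where
  "top_point e y = y + height e y *\<^sub>R e"

definition open_cylinder :: "'a \<Rightarrow> 'a set" where
  "open_cylinder e = {y. \<exists>t. y + t *\<^sub>R e \<in> interior K}"

definition shadow :: "'a \<Rightarrow> 'a set" where
  "shadow e = hplane e \<inter> open_cylinder e"

lemma compact_line_slice:
  assumes e: "norm e = 1"
  shows "compact {t. y + t *\<^sub>R e \<in> K}"
proof -
  obtain r where r: "\<And>x. x \<in> K \<Longrightarrow> norm x \<le> r" using compact_imp_bounded[OF compact_K] by (auto simp: bounded_iff)
  have "closed ((\<lambda>t. y + t *\<^sub>R e) -` K)"
    using closed_K by (intro continuous_closed_vimage) (auto intro!: continuous_intros)
  moreover have "bounded {t. y + t *\<^sub>R e \<in> K}"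
  proof (rule boundedI)
    fix t assume "t \<in> {t. y + t *\<^sub>R e \<in> K}"
    then have "norm (y + t *\<^sub>R e) \<le> r" using r by auto
    moreover have "norm (t *\<^sub>R e) \<le> norm (y + t *\<^sub>R e) + norm y"
      using norm_triangle_ineq4[of "y + t *\<^sub>R e" y] by simp
    ultimately show "norm t \<le> r + norm y" using e by simp
  qed
  ultimately show ?thesis by (simp add: compact_eq_bounded_closed vimage_def)
qed

lemma convex_line_slice: "convex {t. y + t *\<^sub>R e \<in> K}"
proof (rule convexI)
  fix s t v w :: real assume "s \<in> {t. y + t *\<^sub>R e \<in> K}" "t \<in> {t. y + t *\<^sub>R e \<in> K}" "0 \<le> v" "0 \<le> w" "v + w = 1"
  moreover from this have "v *\<^sub>R (y + s *\<^sub>R e) + w *\<^sub>R (y + t *\<^sub>R e) \<in> K" by (intro convexD[OF convex_K]) auto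
  moreover have "v *\<^sub>R (y + s *\<^sub>R e) + w *\<^sub>R (y + t *\<^sub>R e) = (v + w) *\<^sub>R y + (v * s + w * t) *\<^sub>R e" by (simp add: algebra_simps)
  ultimately show "v *\<^sub>R s + w *\<^sub>R t \<in> {t. y + t *\<^sub>R e \<in> K}" by simp
qed

lemma height_eq: "{t. y + t *\<^sub>R e \<in> K} = {a..b} \<Longrightarrow> a \<le> b \<Longrightarrow> height e y = b"
  by (auto simp: height_def)

lemma line_slice_eq_Icc:
  assumes e: "norm e = 1" and t: "y + t *\<^sub>R e \<in> K"
  shows "{t. y + t *\<^sub>R e \<in> K} = {- height (- e) y..height e y}"
proof -
  obtain a b where ab: "{t. y + t *\<^sub>R e \<in> K} = {a..b}"
    using compact_line_slice[OF e] convex_connected[OF convex_line_slice] connected_compact_interval_1 by blast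
  have "t \<in> {a..b}" using t unfolding ab[symmetric] by simp
  then have "a \<le> b" by simp
  moreover have "{t. y + t *\<^sub>R (- e) \<in> K} = uminus ` {t. y + t *\<^sub>R e \<in> K}"
    by (auto simp: image_iff intro!: exI[of _ "- _"])
  then have "{t. y + t *\<^sub>R (- e) \<in> K} = {- b..- a}" by (simp only: ab image_uminus_atLeastAtMost)
  ultimately have "height e y = b" "height (- e) y = - a"
    using height_eq[OF ab] height_eq[of y "- e" "- b" "- a"] by auto
  then show ?thesis using ab by simp
qed

lemma top_point_in_K:
  assumes "norm e = 1" "y + t *\<^sub>R e \<in> K"
  shows "top_point e y \<in> K" "t \<le> height e y"
  using line_slice_eq_Icc[OF assms] assms(2) by (auto simp: top_point_def set_eq_iff)

lemma top_point_uminus: "top_point (- e) y = y + (- height (- e) y) *\<^sub>R e"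
  by (simp add: top_point_def)

lemma shadow_uminus: "shadow (- e) = shadow e"
proof -
  have "(\<exists>t. y + t *\<^sub>R - e \<in> interior K) \<longleftrightarrow> (\<exists>t. y + t *\<^sub>R e \<in> interior K)" for y
    by (metis minus_minus scaleR_minus_left scaleR_minus_right)
  then show ?thesis by (simp add: shadow_def open_cylinder_def)
qed

lemma shadow_meets_K: "y \<in> shadow e \<Longrightarrow> \<exists>t. y + t *\<^sub>R e \<in> K"
  using interior_subset by (auto simp: shadow_def open_cylinder_def)

lemma top_point_shadow:
  assumes e: "norm e = 1" and y: "y \<in> shadow e"
  shows "top_point e y \<in> S" "0 < n (top_point e y) \<bullet> e" "proj_perp e (top_point e y) = y"
proof -
  obtain t where t: "y + t *\<^sub>R e \<in> interior K" and orthogonal: "y \<bullet> e = 0" using y by (auto simp: shadow_def open_cylinder_def)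
  then have in_K: "y + t *\<^sub>R e \<in> K" using interior_subset by auto
  have not_int: "top_point e y \<notin> interior K"
  proof
    assume "top_point e y \<in> interior K"
    then obtain d where d: "d > 0" "ball (top_point e y) d \<subseteq> K" by (auto simp: mem_interior)
    have "y + (height e y + d/2) *\<^sub>R e \<in> K"
      using d e by (intro subsetD[OF d(2)]) (auto simp: top_point_def dist_norm algebra_simps)
    then show False using top_point_in_K(2)[OF e, of y "height e y + d/2"] d by simp
  qed
  then show S: "top_point e y \<in> S"
    using top_point_in_K(1)[OF e in_K] closed_K by (simp add: frontier_def)
  have "t \<noteq> height e y" using not_int t by (auto simp: top_point_def)
  then have "t < height e y" using top_point_in_K(2)[OF e in_K] by simp
  then show "0 < n (top_point e y) \<bullet> e"
    using S t by (intro normal_pos_of_interior_below[of _ "height e y - t"]) (auto simp: top_point_def algebra_simps)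
  show "proj_perp e (top_point e y) = y" unfolding top_point_def using e orthogonal by (rule proj_perp_add_scaleR)
qed

lemma top_point_proj_perp:
  assumes e: "norm e = 1" and x: "x \<in> S" "0 < n x \<bullet> e"
  shows "proj_perp e x \<in> shadow e" "top_point e (proj_perp e x) = x"
proof -
  obtain s where s: "s > 0" "x - s *\<^sub>R e \<in> interior K" using interior_below[OF x] by blast
  have shift: "proj_perp e x + t *\<^sub>R e = x + (t - x \<bullet> e) *\<^sub>R e" for t by (simp add: proj_perp_def algebra_simps)
  have "proj_perp e x + (x \<bullet> e - s) *\<^sub>R e \<in> interior K" using s by (simp add: shift)
  then show "proj_perp e x \<in> shadow e" using proj_perp_inner[OF e] by (auto simp: shadow_def open_cylinder_def)
  have xK: "proj_perp e x + (x \<bullet> e) *\<^sub>R e \<in> K" using x S_subset by (auto simp: shift)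
  have top: "top_point e (proj_perp e x) = x + (height e (proj_perp e x) - x \<bullet> e) *\<^sub>R e"
    by (simp add: top_point_def shift)
  have "(top_point e (proj_perp e x) - x) \<bullet> n x \<le> 0" using top_point_in_K(1)[OF e xK] by (rule normal_le[OF x(1)])
  then have "height e (proj_perp e x) \<le> x \<bullet> e" using x(2) by (simp add: top inner_commute mult_le_0_iff)
  then show "top_point e (proj_perp e x) = x" using top top_point_in_K(2)[OF e xK] by simp
qed

lemma closed_upper_ray_hits:
  assumes e: "norm e = 1"
  shows "closed {y. \<exists>t\<ge>a. y + t *\<^sub>R e \<in> K}"
proof -
  let ?ray = "(\<lambda>t. t *\<^sub>R e) ` {a..}"
  have "closed ?ray"
  proof (rule closed_injective_linear_image)
    show "linear (\<lambda>t::real. t *\<^sub>R e)" by (intro linearI) (auto simp: algebra_simps)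
    show "inj (\<lambda>t::real. t *\<^sub>R e)" using e by (intro injI) auto
  qed simp
  then have "closed (\<Union>x\<in>K. \<Union>y\<in>?ray. {x - y})" by (rule compact_closed_differences[OF compact_K])
  moreover have "(\<Union>x\<in>K. \<Union>y\<in>?ray. {x - y}) = {y. \<exists>t\<ge>a. y + t *\<^sub>R e \<in> K}"
  proof (intro subset_antisym subsetI)
    fix y assume "y \<in> {y. \<exists>t\<ge>a. y + t *\<^sub>R e \<in> K}"
    then obtain t where "t \<ge> a" "y + t *\<^sub>R e \<in> K" by auto
    then show "y \<in> (\<Union>x\<in>K. \<Union>y\<in>?ray. {x - y})" by (intro UN_I[of "y + t *\<^sub>R e"] UN_I[of "t *\<^sub>R e"]) auto
  qed auto
  ultimately show ?thesis by simp
qed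

lemma height_measurable [measurable]:
  assumes e: "norm e = 1"
  shows "height e \<in> borel_measurable borel"
proof -
  define hits where "hits a = {y. \<exists>t\<ge>a. y + t *\<^sub>R e \<in> K}" for a
  have hits [measurable]: "hits a \<in> sets borel" for a
    unfolding hits_def using closed_upper_ray_hits[OF e] by (rule borel_closed)
  have meets: "(\<exists>t. y + t *\<^sub>R e \<in> K) \<longleftrightarrow> y \<in> (\<Union>i::nat. hits (- real i))" for y
  proof
    assume "\<exists>t. y + t *\<^sub>R e \<in> K"
    then obtain t where t: "y + t *\<^sub>R e \<in> K" ..
    obtain i :: nat where "- t \<le> real i" using real_arch_simple by blast
    then show "y \<in> (\<Union>i::nat. hits (- real i))" using t by (auto simp: hits_def intro!: exI[of _ i] exI[of _ t])
  qed (auto simp: hits_def)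
  have "{y. a \<le> height e y} = hits a \<union> (if a \<le> 0 then - (\<Union>i::nat. hits (- real i)) else {})" for a
  proof (rule set_eqI)
    fix y
    show "y \<in> {y. a \<le> height e y} \<longleftrightarrow> y \<in> hits a \<union> (if a \<le> 0 then - (\<Union>i::nat. hits (- real i)) else {})"
    proof (cases "\<exists>t. y + t *\<^sub>R e \<in> K")
      case True
      then have "y \<in> hits a \<longleftrightarrow> a \<le> height e y"
        using top_point_in_K[OF e] unfolding hits_def top_point_def by (auto intro: order_trans)
      then show ?thesis using True meets[of y] by auto
    next
      case False
      then have "y \<notin> hits a" "height e y = 0" by (auto simp: hits_def height_def)
      then show ?thesis using False meets[of y] by auto
    qed
  qed
  then show ?thesis by (subst borel_measurable_iff_ge) simp
qed

lemma top_point_measurable: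
  assumes "norm e = 1"
  shows "top_point e \<in> borel_measurable borel"
  using height_measurable[OF assms] unfolding top_point_def by measurable

lemma open_open_cylinder: "open (open_cylinder e)"
proof -
  have "open_cylinder e = (\<Union>t. (\<lambda>y. y + t *\<^sub>R e) -` interior K)" by (auto simp: open_cylinder_def)
  moreover have "open ((\<lambda>y. y + t *\<^sub>R e) -` interior K)" for t
    by (intro open_vimage continuous_intros) auto
  ultimately show ?thesis by auto
qed

lemma shadow_borel [measurable]: "shadow e \<in> sets borel"
  unfolding shadow_def using open_open_cylinder by (intro sets.Int borel_open hplane_borel)

end

lemma emeasure_density_within_factor:
  fixes w :: "'a::euclidean_space \<Rightarrow> real"
  assumes w [measurable]: "w \<in> borel_measurable borel" and M [measurable_cong]: "sets M = sets borel"
    and [measurable]: "B \<in> sets borel" and close: "\<And>x. x \<in> B \<Longrightarrow> \<bar>w x - k\<bar> \<le> \<epsilon>" and \<epsilon>: "0 < \<epsilon>" "\<epsilon> < k"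
  shows "within_factor (k / (k - \<epsilon>)) (emeasure (density M (\<lambda>x. ennreal (w x))) B) (ennreal k * emeasure M B)"
proof -
  have density: "emeasure (density M (\<lambda>x. ennreal (w x))) B = (\<integral>\<^sup>+x. ennreal (w x) * indicator B x \<partial>M)"
    by (subst emeasure_density) auto
  have const: "ennreal c * emeasure M B = (\<integral>\<^sup>+x. ennreal c * indicator B x \<partial>M)" for c
    by (simp add: nn_integral_cmult M)
  have "(k + \<epsilon>) * (k - \<epsilon>) \<le> k * k" by (simp add: algebra_simps)
  then have "k + \<epsilon> \<le> k / (k - \<epsilon>) * k" using \<epsilon> by (simp add: field_simps)
  have "emeasure (density M (\<lambda>x. ennreal (w x))) B \<le> ennreal (k + \<epsilon>) * emeasure M B"
    unfolding density const using close
    by (intro nn_integral_mono) (force simp: indicator_def intro!: ennreal_leI)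
  also have "\<dots> \<le> ennreal (k / (k - \<epsilon>) * k) * emeasure M B"
    using \<open>k + \<epsilon> \<le> k / (k - \<epsilon>) * k\<close> by (intro mult_right_mono ennreal_leI) auto
  finally have upper: "emeasure (density M (\<lambda>x. ennreal (w x))) B \<le> ennreal (k / (k - \<epsilon>)) * (ennreal k * emeasure M B)"
    using \<epsilon> by (subst (asm) ennreal_mult) (auto simp: mult.assoc)
  have "ennreal k * emeasure M B = ennreal (k / (k - \<epsilon>)) * (ennreal (k - \<epsilon>) * emeasure M B)"
    using \<epsilon> by (simp flip: mult.assoc ennreal_mult)
  also have "ennreal (k - \<epsilon>) * emeasure M B \<le> emeasure (density M (\<lambda>x. ennreal (w x))) B"
    unfolding density const using close
    by (intro nn_integral_mono) (force simp: indicator_def intro!: ennreal_leI)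
  finally have "ennreal k * emeasure M B \<le> ennreal (k / (k - \<epsilon>)) * emeasure (density M (\<lambda>x. ennreal (w x))) B"
    by (simp add: mult_left_mono)
  with upper show ?thesis by (simp add: within_factor_def)
qed

lemma ex_small_distortion:
  fixes c k \<eta> s :: real
  assumes "0 < k" "0 < \<eta>"
  obtains \<epsilon> where "0 < \<epsilon>" "\<epsilon> \<le> k / 2" "c * \<epsilon> < 1"
    "k / (k - \<epsilon>) * ((1 / (1 - c * \<epsilon>)) powr s * (1 / (1 - c * \<epsilon>)) powr s) \<le> 1 + \<eta>"
proof -
  let ?f = "\<lambda>\<epsilon>. k / (k - \<epsilon>) * ((1 / (1 - c * \<epsilon>)) powr s * (1 / (1 - c * \<epsilon>)) powr s)"
  have "(?f \<longlongrightarrow> k / (k - 0) * ((1 / (1 - c * 0)) powr s * (1 / (1 - c * 0)) powr s)) (at_right 0)"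
    using assms by (intro tendsto_intros) auto
  then have "\<forall>\<^sub>F \<epsilon> in at_right 0. ?f \<epsilon> < 1 + \<eta>"
    using assms by (intro order_tendstoD(2)) auto
  moreover have "((\<lambda>\<epsilon>. c * \<epsilon>) \<longlongrightarrow> c * 0) (at_right 0)" by (intro tendsto_intros)
  then have "\<forall>\<^sub>F \<epsilon> in at_right 0. c * \<epsilon> < 1"
    by (rule order_tendstoD(2)) simp
  moreover have "\<forall>\<^sub>F \<epsilon> in at_right 0. 0 < \<epsilon> \<and> \<epsilon> < k / 2"
    using assms by (auto intro!: eventually_at_rightI[of 0 "k / 2"])
  ultimately have "\<forall>\<^sub>F \<epsilon> in at_right 0. ?f \<epsilon> < 1 + \<eta> \<and> c * \<epsilon> < 1 \<and> 0 < \<epsilon> \<and> \<epsilon> < k / 2"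
    by eventually_elim auto
  then obtain \<epsilon> where "?f \<epsilon> < 1 + \<eta>" "c * \<epsilon> < 1" "0 < \<epsilon>" "\<epsilon> < k / 2"
    using eventually_happens[of _ "at_right (0::real)"] by (auto simp: trivial_limit_at_right_real)
  then show ?thesis using that[of \<epsilon>] by simp
qed

context smooth_body
begin

lemma projection_locally_within_factor:
  assumes e: "norm e = 1" and x0: "x0 \<in> S" "0 < n x0 \<bullet> e" and \<eta>: "0 < \<eta>"
  shows "\<exists>U. open U \<and> x0 \<in> U \<and> (\<forall>B\<in>sets borel. B \<subseteq> S \<inter> U \<longrightarrow>
     within_factor (1 + \<eta>) (emeasure (density (surface S) (\<lambda>x. ennreal (n x \<bullet> e))) B)
       (hausdorff_outer (real DIM('a) - 1) (proj_perp e ` B)))"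
proof -
  let ?k = "n x0 \<bullet> e" and ?s = "real DIM('a) - 1"
  let ?c = "2 * (1 + 1 / ?k)"
  obtain \<epsilon> where \<epsilon>: "0 < \<epsilon>" "\<epsilon> \<le> ?k / 2" "?c * \<epsilon> < 1"
    and small: "?k / (?k - \<epsilon>) * ((1 / (1 - ?c * \<epsilon>)) powr ?s * (1 / (1 - ?c * \<epsilon>)) powr ?s) \<le> 1 + \<eta>"
    using ex_small_distortion[OF x0(2) \<eta>] by blast
  obtain \<delta> where \<delta>: "0 < \<delta>" "\<And>x. x \<in> S \<inter> cball x0 \<delta> \<Longrightarrow> norm (n x - n x0) \<le> \<epsilon>" "flat_along (n x0) \<epsilon> (S \<inter> cball x0 \<delta>)"
    using locally_flat[OF x0(1) \<epsilon>(1)] by blast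
  have Q: "compact (S \<inter> cball x0 \<delta>)" using compact_S by (simp add: compact_Int)
  show ?thesis
  proof (intro exI[of _ "ball x0 \<delta>"] conjI ballI impI)
    fix B :: "'a set" assume B: "B \<in> sets borel" and "B \<subseteq> S \<inter> ball x0 \<delta>"
    then have BQ: "B \<subseteq> S \<inter> cball x0 \<delta>" by auto
    have "\<bar>n x \<bullet> e - ?k\<bar> \<le> \<epsilon>" if "x \<in> B" for x
    proof -
      have "\<bar>(n x - n x0) \<bullet> e\<bar> \<le> norm (n x - n x0) * norm e" by (rule Cauchy_Schwarz_ineq2)
      moreover have "norm (n x - n x0) \<le> \<epsilon>" using that BQ by (intro \<delta>(2)) auto
      ultimately show ?thesis using e by (simp add: inner_diff_left)
    qed
    then have "within_factor (?k / (?k - \<epsilon>)) (emeasure (density (surface S) (\<lambda>x. ennreal (n x \<bullet> e))) B) (ennreal ?k * emeasure (surface S) B)"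
      using \<epsilon> x0 B by (intro emeasure_density_within_factor) auto
    moreover have "emeasure (surface S) B = hausdorff_outer ?s B"
      using B BQ by (subst emeasure_hausdorff_within) (auto simp: Int_absorb1)
    moreover note hausdorff_outer_proj_flat_within_factor[OF normal_unit[OF x0(1)] e dim x0(2) \<delta>(3) \<epsilon>(1,2) Q B BQ \<epsilon>(3)]
    ultimately have "within_factor (?k / (?k - \<epsilon>) * ((1 / (1 - ?c * \<epsilon>)) powr ?s * (1 / (1 - ?c * \<epsilon>)) powr ?s))
        (emeasure (density (surface S) (\<lambda>x. ennreal (n x \<bullet> e))) B) (hausdorff_outer ?s (proj_perp e ` B))"
      using \<epsilon> x0 by - (rule within_factor_trans[OF _ within_factor_sym], auto)
    then show "within_factor (1 + \<eta>) (emeasure (density (surface S) (\<lambda>x. ennreal (n x \<bullet> e))) B) (hausdorff_outer ?s (proj_perp e ` B))"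
      using small by (rule within_factor_mono)
  qed (use \<delta> in auto)
qed

lemma emeasure_distr_top_point:
  assumes e: "norm e = 1" and B [measurable]: "B \<in> sets borel"
  shows "emeasure (distr (density (surface (hplane e)) (indicator (shadow e))) borel (top_point e)) B
    = hausdorff_outer (real DIM('a) - 1) (shadow e \<inter> top_point e -` B)"
proof -
  note [measurable] = top_point_measurable[OF e]
  have vimage: "top_point e -` B \<in> sets borel" using measurable_sets[OF top_point_measurable[OF e] B] by simp
  have "emeasure (distr (density (surface (hplane e)) (indicator (shadow e))) borel (top_point e)) B
      = emeasure (surface (hplane e)) (shadow e \<inter> top_point e -` B)"
    using vimage by (simp add: emeasure_distr emeasure_density flip: indicator_inter_arith)
  also have "\<dots> = hausdorff_outer (real DIM('a) - 1) (hplane e \<inter> (shadow e \<inter> top_point e -` B))"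
    using vimage by (intro emeasure_hausdorff_within) auto
  also have "hplane e \<inter> (shadow e \<inter> top_point e -` B) = shadow e \<inter> top_point e -` B"
    by (auto simp: shadow_def)
  finally show ?thesis .
qed

lemma shadow_Int_vimage_top_point:
  assumes e: "norm e = 1" and B: "B \<subseteq> {x\<in>S. 0 < n x \<bullet> e}"
  shows "shadow e \<inter> top_point e -` B = proj_perp e ` B"
proof (intro subset_antisym subsetI)
  fix y assume "y \<in> shadow e \<inter> top_point e -` B"
  then show "y \<in> proj_perp e ` B" using top_point_shadow(3)[OF e, of y] by (metis IntD1 IntD2 image_eqI vimage_eq)
next
  fix y assume "y \<in> proj_perp e ` B"
  then show "y \<in> shadow e \<inter> top_point e -` B" using top_point_proj_perp[OF e] B by auto
qed

lemma density_normal_eq_distr_top_point: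
  assumes e: "norm e = 1"
  shows "density (surface S) (\<lambda>x. ennreal (n x \<bullet> e))
    = distr (density (surface (hplane e)) (indicator (shadow e))) borel (top_point e)" (is "?M = ?N")
proof (rule measure_eqI)
  let ?P = "{x\<in>S. 0 < n x \<bullet> e}"
  have P [measurable]: "?P \<in> sets borel"
  proof -
    have "S \<inter> {x. 0 < n x \<bullet> e} \<in> sets borel" by measurable
    then show ?thesis by (simp add: Collect_conj_eq)
  qed
  fix B assume "B \<in> sets ?M"
  then have B [measurable]: "B \<in> sets borel" by simp
  have "emeasure ?M B = (\<integral>\<^sup>+x. ennreal (n x \<bullet> e) * indicator B x \<partial>surface S)" by (subst emeasure_density) auto
  also have "\<dots> = (\<integral>\<^sup>+x. ennreal (n x \<bullet> e) * indicator (B \<inter> ?P) x \<partial>surface S)"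
    using AE_hausdorff_within[OF S_borel]
    by (intro nn_integral_cong_AE, eventually_elim) (auto simp: indicator_def ennreal_neg not_less)
  also have "\<dots> = emeasure ?M (B \<inter> ?P)" by (subst emeasure_density) auto
  also have "\<dots> = emeasure ?N (B \<inter> ?P)"
  proof (rule emeasure_eq_of_locally_within_factor[where S="?P"])
    fix x and \<eta> :: real assume "x \<in> ?P" "0 < \<eta>"
    then obtain U where U: "open U" "x \<in> U" "\<And>B. B \<in> sets borel \<Longrightarrow> B \<subseteq> S \<inter> U \<Longrightarrow>
        within_factor (1 + \<eta>) (emeasure ?M B) (hausdorff_outer (real DIM('a) - 1) (proj_perp e ` B))"
      using projection_locally_within_factor[OF e, of x \<eta>] by blast
    have "within_factor (1 + \<eta>) (emeasure ?M B) (emeasure ?N B)" if "B \<in> sets borel" "B \<subseteq> ?P \<inter> U" for B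
      using U(3)[of B] that shadow_Int_vimage_top_point[OF e, of B] by (auto simp: emeasure_distr_top_point[OF e])
    then show "\<exists>U. open U \<and> x \<in> U \<and> (\<forall>B\<in>sets borel. B \<subseteq> ?P \<inter> U \<longrightarrow> within_factor (1 + \<eta>) (emeasure ?M B) (emeasure ?N B))"
      using U(1,2) by blast
  qed auto
  also have "shadow e \<inter> top_point e -` (B \<inter> ?P) = shadow e \<inter> top_point e -` B"
    using top_point_shadow[OF e] by auto
  then have "emeasure ?N (B \<inter> ?P) = emeasure ?N B" by (simp add: emeasure_distr_top_point[OF e])
  finally show "emeasure ?M B = emeasure ?N B" .
qed simp

lemma nn_integral_projection:
  assumes e: "norm e = 1" and f [measurable]: "f \<in> borel_measurable borel"
  shows "(\<integral>\<^sup>+x. ennreal (n x \<bullet> e) * f x \<partial>surface S)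
    = (\<integral>\<^sup>+y. indicator (shadow e) y * f (top_point e y) \<partial>surface (hplane e))"
proof -
  note [measurable] = top_point_measurable[OF e]
  have "(\<integral>\<^sup>+x. ennreal (n x \<bullet> e) * f x \<partial>surface S) = (\<integral>\<^sup>+x. f x \<partial>density (surface S) (\<lambda>x. ennreal (n x \<bullet> e)))"
    by (subst nn_integral_density) auto
  also have "\<dots> = (\<integral>\<^sup>+y. indicator (shadow e) y * f (top_point e y) \<partial>surface (hplane e))"
    unfolding density_normal_eq_distr_top_point[OF e] by (simp add: nn_integral_distr nn_integral_density)
  finally show ?thesis .
qed

lemma
  assumes e: "norm e = 1" and f [measurable]: "f \<in> borel_measurable borel"
  shows integral_projection:
      "(\<integral>x. max 0 (n x \<bullet> e) * f x \<partial>surface S) = (\<integral>y. indicator (shadow e) y * f (top_point e y) \<partial>surface (hplane e))"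
    and integrable_projection:
      "integrable (surface S) (\<lambda>x. max 0 (n x \<bullet> e) * f x)
        \<longleftrightarrow> integrable (surface (hplane e)) (\<lambda>y. indicator (shadow e) y * (f (top_point e y) :: real))"
proof -
  note [measurable] = top_point_measurable[OF e]
  have pos: "(\<lambda>x. ennreal (n x \<bullet> e)) = (\<lambda>x. ennreal (max 0 (n x \<bullet> e)))"
    by (auto simp: max_def ennreal_neg)
  have indicator_eq: "(indicator (shadow e) :: 'a \<Rightarrow> ennreal) = (\<lambda>x. ennreal (indicator (shadow e) x))"
    by (auto simp: fun_eq_iff indicator_def)
  note pushforward = density_normal_eq_distr_top_point[OF e, unfolded pos indicator_eq]
  have "(\<integral>x. max 0 (n x \<bullet> e) * f x \<partial>surface S) = (\<integral>x. f x \<partial>density (surface S) (\<lambda>x. ennreal (max 0 (n x \<bullet> e))))"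
    by (subst integral_density) auto
  also have "\<dots> = (\<integral>y. f (top_point e y) \<partial>density (surface (hplane e)) (\<lambda>x. ennreal (indicator (shadow e) x)))"
    unfolding pushforward by (subst integral_distr) auto
  also have "\<dots> = (\<integral>y. indicator (shadow e) y * f (top_point e y) \<partial>surface (hplane e))"
    by (subst integral_density) auto
  finally show "(\<integral>x. max 0 (n x \<bullet> e) * f x \<partial>surface S) = (\<integral>y. indicator (shadow e) y * f (top_point e y) \<partial>surface (hplane e))" .
  have "integrable (surface S) (\<lambda>x. max 0 (n x \<bullet> e) * f x) \<longleftrightarrow> integrable (density (surface S) (\<lambda>x. ennreal (max 0 (n x \<bullet> e)))) f"
    by (subst integrable_density) auto
  also have "\<dots> \<longleftrightarrow> integrable (density (surface (hplane e)) (\<lambda>x. ennreal (indicator (shadow e) x))) (\<lambda>y. f (top_point e y))"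
    unfolding pushforward by (subst integrable_distr_eq) auto
  also have "\<dots> \<longleftrightarrow> integrable (surface (hplane e)) (\<lambda>y. indicator (shadow e) y * f (top_point e y))"
    by (subst integrable_density) auto
  finally show "integrable (surface S) (\<lambda>x. max 0 (n x \<bullet> e) * f x)
      \<longleftrightarrow> integrable (surface (hplane e)) (\<lambda>y. indicator (shadow e) y * f (top_point e y))" .
qed

lemma nn_integral_surface_le_projections:
  assumes w [measurable]: "w \<in> borel_measurable borel"
  shows "(\<integral>\<^sup>+x. w x \<partial>surface S)
    \<le> (\<Sum>b\<in>Basis. (\<integral>\<^sup>+x. ennreal (n x \<bullet> b) * w x \<partial>surface S) + (\<integral>\<^sup>+x. ennreal (n x \<bullet> (- b)) * w x \<partial>surface S))"
proof -
  have "(\<integral>\<^sup>+x. w x \<partial>surface S) \<le> (\<integral>\<^sup>+x. (\<Sum>b\<in>Basis. ennreal (n x \<bullet> b) * w x + ennreal (n x \<bullet> (- b)) * w x) \<partial>surface S)"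
  proof (rule nn_integral_mono_AE)
    show "AE x in surface S. w x \<le> (\<Sum>b\<in>Basis. ennreal (n x \<bullet> b) * w x + ennreal (n x \<bullet> (- b)) * w x)"
      using AE_hausdorff_within[OF S_borel]
    proof eventually_elim
      case (elim x)
      have "1 \<le> (\<Sum>b\<in>Basis. \<bar>n x \<bullet> b\<bar>)" using norm_le_l1[of "n x"] normal_unit[OF elim] by simp
      then have "1 * w x \<le> ennreal (\<Sum>b\<in>Basis. \<bar>n x \<bullet> b\<bar>) * w x" by (intro mult_right_mono) auto
      also have "ennreal (\<Sum>b\<in>Basis. \<bar>n x \<bullet> b\<bar>) = (\<Sum>b\<in>Basis. ennreal \<bar>n x \<bullet> b\<bar>)" by simp
      also have "\<dots> * w x = (\<Sum>b\<in>Basis. (ennreal (n x \<bullet> b) + ennreal (n x \<bullet> (- b))) * w x)"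
        unfolding sum_distrib_right
        by (intro sum.cong refl arg_cong2[where f="(*)"]) (auto simp: abs_if ennreal_neg)
      finally show ?case by (simp add: distrib_right)
    qed
  qed
  also have "\<dots> = (\<Sum>b\<in>Basis. (\<integral>\<^sup>+x. ennreal (n x \<bullet> b) * w x \<partial>surface S) + (\<integral>\<^sup>+x. ennreal (n x \<bullet> (- b)) * w x \<partial>surface S))"
    by (subst nn_integral_sum) (auto simp: nn_integral_add)
  finally show ?thesis .
qed

lemma bounded_shadow:
  assumes e: "norm e = 1"
  shows "bounded (shadow e)"
proof -
  obtain R where R: "\<And>x. x \<in> K \<Longrightarrow> norm x \<le> R" using compact_imp_bounded[OF compact_K] by (auto simp: bounded_iff)
  show ?thesis
  proof (rule boundedI)
    fix y assume y: "y \<in> shadow e"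
    have "norm (top_point e y) \<le> R" using top_point_shadow(1)[OF e y] S_subset R by auto
    then show "norm y \<le> R" using norm_proj_perp_le[OF e, of "top_point e y"] top_point_shadow(3)[OF e y] by simp
  qed
qed

lemma finite_surface: "finite_measure (surface S)"
proof
  have finite: "(\<integral>\<^sup>+x. ennreal (n x \<bullet> e) * 1 \<partial>surface S) < \<infinity>" if e: "norm e = 1" for e
  proof -
    have "(\<integral>\<^sup>+x. ennreal (n x \<bullet> e) * 1 \<partial>surface S) = emeasure (surface (hplane e)) (shadow e)"
      by (subst nn_integral_projection[OF e]) auto
    also have "\<dots> = hausdorff_outer (real DIM('a) - 1) (hplane e \<inter> shadow e)"
      by (intro emeasure_hausdorff_within) auto
    also have "\<dots> < \<infinity>"
      using bounded_shadow[OF e] by (intro hausdorff_outer_hplane_finite[OF e dim]) (auto intro: bounded_Int)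
    finally show ?thesis .
  qed
  have "emeasure (surface S) (space (surface S)) = (\<integral>\<^sup>+x. 1 \<partial>surface S)" by simp
  also have "\<dots> \<le> (\<Sum>b\<in>Basis. (\<integral>\<^sup>+x. ennreal (n x \<bullet> b) * 1 \<partial>surface S) + (\<integral>\<^sup>+x. ennreal (n x \<bullet> (- b)) * 1 \<partial>surface S))"
    by (rule nn_integral_surface_le_projections) simp
  also have "\<dots> < \<infinity>" using finite by (simp del: mult_1_right inner_minus_right)
  finally show "emeasure (surface S) (space (surface S)) \<noteq> \<infinity>" by simp
qed

end

lemma AE_hplane_notin_null_cylinder:
  fixes e :: "'a::euclidean_space"
  assumes e: "norm e = 1" "DIM('a) \<ge> 2" and N: "N \<in> sets borel" "emeasure lborel N = 0"
    and invariant: "\<And>x t. x + t *\<^sub>R e \<in> N \<longleftrightarrow> x \<in> N"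
  shows "AE y in surface (hplane e). y \<notin> N"
proof -
  have "(\<integral>\<^sup>+y. \<infinity> * indicator N y \<partial>surface (hplane e)) = (\<integral>\<^sup>+y. \<integral>\<^sup>+t. indicator N (y + t *\<^sub>R e) \<partial>lborel \<partial>surface (hplane e))"
  proof (rule nn_integral_cong)
    fix y
    have "(\<integral>\<^sup>+t. indicator N (y + t *\<^sub>R e) \<partial>lborel) = (\<integral>\<^sup>+t. indicator N y \<partial>(lborel :: real measure))"
      using invariant by (intro nn_integral_cong) (simp add: indicator_def)
    then show "\<infinity> * indicator N y = (\<integral>\<^sup>+t. indicator N (y + t *\<^sub>R e) \<partial>lborel)" by (simp add: mult.commute)
  qed
  also have "\<dots> = 0" using nn_integral_slices_eq_lborel[OF e, of "indicator N"] N by simp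
  finally have "AE y in surface (hplane e). \<infinity> * indicator N y = (0::ennreal)"
    using N(1) by (subst (asm) nn_integral_0_iff_AE) auto
  then show ?thesis by eventually_elim (auto simp: indicator_def split: if_splits)
qed

context smooth_body
begin

lemma convex_open_cylinder: "convex (open_cylinder e)"
proof (rule convexI)
  fix x y and u v :: real assume "x \<in> open_cylinder e" "y \<in> open_cylinder e" and uv: "0 \<le> u" "0 \<le> v" "u + v = 1"
  then obtain s t where "x + s *\<^sub>R e \<in> interior K" "y + t *\<^sub>R e \<in> interior K" by (auto simp: open_cylinder_def)
  then have "u *\<^sub>R (x + s *\<^sub>R e) + v *\<^sub>R (y + t *\<^sub>R e) \<in> interior K"
    using uv convex_K by (intro convexD[OF convex_interior]) auto
  then show "u *\<^sub>R x + v *\<^sub>R y \<in> open_cylinder e"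
    by (auto simp: open_cylinder_def algebra_simps intro!: exI[of _ "u * s + v * t"])
qed

lemma open_cylinder_translate: "(+) (t *\<^sub>R e) ` open_cylinder e = open_cylinder e"
proof (intro subset_antisym subsetI)
  fix x assume "x \<in> (+) (t *\<^sub>R e) ` open_cylinder e"
  then obtain y s where "x = t *\<^sub>R e + y" "y + s *\<^sub>R e \<in> interior K" by (auto simp: open_cylinder_def)
  then show "x \<in> open_cylinder e" by (auto simp: open_cylinder_def algebra_simps intro!: exI[of _ "s - t"])
next
  fix x assume "x \<in> open_cylinder e"
  then obtain s where s: "x + s *\<^sub>R e \<in> interior K" by (auto simp: open_cylinder_def)
  then have "x - t *\<^sub>R e \<in> open_cylinder e" by (auto simp: open_cylinder_def algebra_simps intro!: exI[of _ "s + t"])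
  then show "x \<in> (+) (t *\<^sub>R e) ` open_cylinder e" by (rule rev_image_eqI) simp
qed

lemma line_meets_K_imp_closure_open_cylinder:
  assumes "x + t *\<^sub>R e \<in> K"
  shows "x \<in> closure (open_cylinder e)"
proof -
  have "x + t *\<^sub>R e \<in> closure (interior K)"
    using assms convex_closure_interior[OF convex_K interior_K] closed_K by simp
  moreover have "interior K \<subseteq> open_cylinder e" by (auto simp: open_cylinder_def intro!: exI[of _ 0])
  ultimately have "x + t *\<^sub>R e \<in> closure ((+) (t *\<^sub>R e) ` open_cylinder e)"
    unfolding open_cylinder_translate using closure_mono by blast
  then have "x + t *\<^sub>R e \<in> (+) (t *\<^sub>R e) ` closure (open_cylinder e)" by (simp only: closure_translation)
  then show ?thesis by (metis add.commute add_left_cancel imageE)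
qed

lemma AE_shadow:
  assumes e: "norm e = 1"
  shows "AE y in surface (hplane e). (\<exists>t. y + t *\<^sub>R e \<in> K) \<longrightarrow> y \<in> shadow e"
proof -
  let ?N = "frontier (open_cylinder e)"
  have "negligible ?N" by (rule negligible_convex_frontier[OF convex_open_cylinder])
  then have "emeasure lborel ?N = 0"
    by (simp add: negligible_iff_null_sets null_sets_completion_iff null_sets_def)
  moreover have "x + t *\<^sub>R e \<in> ?N \<longleftrightarrow> x \<in> ?N" for x t
  proof -
    have image: "(+) (t *\<^sub>R e) ` ?N = ?N"
      using frontier_translation[of "t *\<^sub>R e" "open_cylinder e"] by (simp only: open_cylinder_translate)
    have "x + t *\<^sub>R e \<in> ?N \<longleftrightarrow> t *\<^sub>R e + x \<in> (+) (t *\<^sub>R e) ` ?N" by (simp only: image add.commute)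
    then show ?thesis by (simp only: inj_image_mem_iff[OF inj_on_add])
  qed
  ultimately have "AE y in surface (hplane e). y \<notin> ?N"
    by (intro AE_hplane_notin_null_cylinder[OF e dim]) auto
  with AE_hausdorff_within[OF hplane_borel] show ?thesis
  proof eventually_elim
    case (elim y)
    then show ?case
      using line_meets_K_imp_closure_open_cylinder[of y _ e] open_open_cylinder[of e]
      by (auto simp: shadow_def frontier_def interior_open)
  qed
qed

end

section \<open>The divergence theorem\<close>

context smooth_body
begin

lemma integral_derivative_on_line:
  assumes e: "norm e = 1" and y: "y \<in> shadow e" and avoids: "\<And>t. y + t *\<^sub>R e \<noteq> p"
    and deriv: "\<And>x. x \<noteq> p \<Longrightarrow> ((\<lambda>t. f (x + t *\<^sub>R e)) has_real_derivative g x) (at 0)"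
    and slice_integrable: "integrable lborel (\<lambda>t. indicator K (y + t *\<^sub>R e) * g (y + t *\<^sub>R e))"
  shows "(\<integral>t. indicator K (y + t *\<^sub>R e) * g (y + t *\<^sub>R e) \<partial>lborel) = f (top_point e y) - f (top_point (- e) y)"
proof -
  let ?a = "- height (- e) y" and ?b = "height e y"
  obtain t where t: "y + t *\<^sub>R e \<in> K" using shadow_meets_K[OF y] ..
  note slice = line_slice_eq_Icc[OF e t]
  have "t \<in> {?a..?b}" using t unfolding slice[symmetric] by simp
  then have bounds: "?a \<le> ?b" by simp
  have indicator_eq: "indicator K (y + t *\<^sub>R e) = (indicator {?a..?b} t :: real)" for t
    unfolding slice[symmetric] by (simp add: indicator_def)
  have "((\<lambda>t. g (y + t *\<^sub>R e)) has_integral f (y + ?b *\<^sub>R e) - f (y + ?a *\<^sub>R e)) {?a..?b}"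
  proof (rule fundamental_theorem_of_calculus[OF bounds])
    fix t
    have "((\<lambda>r. f (y + t *\<^sub>R e + r *\<^sub>R e)) has_real_derivative g (y + t *\<^sub>R e)) (at 0)" by (rule deriv[OF avoids])
    then have "((\<lambda>r. f (y + (r + t) *\<^sub>R e)) has_real_derivative g (y + t *\<^sub>R e)) (at 0)"
      by (simp add: algebra_simps)
    then have "((\<lambda>r. f (y + r *\<^sub>R e)) has_real_derivative g (y + t *\<^sub>R e)) (at t)"
      using DERIV_shift[of "\<lambda>r. f (y + r *\<^sub>R e)" "g (y + t *\<^sub>R e)" 0 t] by simp
    then show "((\<lambda>r. f (y + r *\<^sub>R e)) has_vector_derivative g (y + t *\<^sub>R e)) (at t within {?a..?b})"
      by (simp add: has_real_derivative_iff_has_vector_derivative has_vector_derivative_at_within)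
  qed
  moreover have "set_integrable lborel {?a..?b} (\<lambda>t. g (y + t *\<^sub>R e))"
    using slice_integrable by (simp add: set_integrable_def indicator_eq)
  note set_borel_integral_eq_integral(2)[OF this]
  ultimately have "(LINT t:{?a..?b}|lborel. g (y + t *\<^sub>R e)) = f (y + ?b *\<^sub>R e) - f (y + ?a *\<^sub>R e)"
    by (simp add: integral_unique)
  then show ?thesis unfolding top_point_uminus by (simp add: set_lebesgue_integral_def indicator_eq top_point_def)
qed

lemma AE_integral_derivative_on_line:
  assumes e: "norm e = 1"
    and deriv: "\<And>x. x \<noteq> p \<Longrightarrow> ((\<lambda>t. f (x + t *\<^sub>R e)) has_real_derivative g x) (at 0)"
    and intg: "integrable lborel (\<lambda>x. indicator K x * g x)"
  shows "AE y in surface (hplane e). (\<integral>t. indicator K (y + t *\<^sub>R e) * g (y + t *\<^sub>R e) \<partial>lborel)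
    = indicator (shadow e) y * f (top_point e y) - indicator (shadow e) y * f (top_point (- e) y)"
  using AE_hausdorff_within[OF hplane_borel] AE_shadow[OF e] AE_integrable_slices[OF e dim intg]
    AE_hausdorff_within_neq[where T="hplane e" and p="proj_perp e p", OF hplane_borel]
proof eventually_elim
  case (elim y)
  show ?case
  proof (cases "y \<in> shadow e")
    case False
    then have "y + t *\<^sub>R e \<notin> K" for t using elim by auto
    then show ?thesis using False by simp
  next
    case True
    have "y + t *\<^sub>R e \<noteq> p" for t using elim proj_perp_add_scaleR[OF e, of y t] by auto
    then have "(\<integral>t. indicator K (y + t *\<^sub>R e) * g (y + t *\<^sub>R e) \<partial>lborel) = f (top_point e y) - f (top_point (- e) y)"
      using elim by (intro integral_derivative_on_line[OF e True, where p=p] deriv) auto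
    then show ?thesis using True by simp
  qed
qed

lemma integrable_mult_bounded_normal_part:
  assumes f: "integrable (surface S) f" and [measurable]: "w \<in> borel_measurable borel"
    and bound: "\<And>x. \<bar>w x\<bar> \<le> \<bar>n x \<bullet> v\<bar>"
  shows "integrable (surface S) (\<lambda>x. w x * (f x :: real))"
proof (rule Bochner_Integration.integrable_bound)
  show "integrable (surface S) (\<lambda>x. norm v * f x)" using f by simp
  have [measurable]: "f \<in> borel_measurable (surface S)" using f by simp
  show "(\<lambda>x. w x * f x) \<in> borel_measurable (surface S)" by measurable
  have "\<bar>w x\<bar> * \<bar>f x\<bar> \<le> norm v * \<bar>f x\<bar>" for x
    using order_trans[OF bound abs_normal_inner_le] by (intro mult_right_mono) auto
  then show "AE x in surface S. norm (w x * f x) \<le> norm (norm v * f x)"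
    by (intro AE_I2) (simp add: abs_mult)
qed

lemma divergence_direction:
  assumes e: "norm e = 1"
    and f [measurable]: "f \<in> borel_measurable borel" and g [measurable]: "g \<in> borel_measurable borel"
    and deriv: "\<And>x. x \<noteq> p \<Longrightarrow> ((\<lambda>t. f (x + t *\<^sub>R e)) has_real_derivative g x) (at 0)"
    and intg: "integrable lborel (\<lambda>x. indicator K x * g x)"
    and intf: "integrable (surface S) f"
  shows "(\<integral>x. f x * (n x \<bullet> e) \<partial>surface S) = slice_const TYPE('a) * (\<integral>x. indicator K x * g x \<partial>lborel)"
proof -
  have e': "norm (- e) = 1" using e by simp
  note [measurable] = top_point_measurable[OF e] top_point_measurable[OF e']
  have "integrable (surface S) (\<lambda>x. max 0 (n x \<bullet> e) * f x)" "integrable (surface S) (\<lambda>x. max 0 (n x \<bullet> (- e)) * f x)"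
    by (rule integrable_mult_bounded_normal_part[OF intf, where v=e]; simp)+
  note parts_integrable = this this[unfolded integrable_projection[OF e f] integrable_projection[OF e' f], unfolded shadow_uminus]
  have "(\<integral>x. f x * (n x \<bullet> e) \<partial>surface S)
      = (\<integral>x. max 0 (n x \<bullet> e) * f x - max 0 (n x \<bullet> (- e)) * f x \<partial>surface S)"
    by (intro Bochner_Integration.integral_cong) (auto simp: max_def)
  also have "\<dots> = (\<integral>y. indicator (shadow e) y * f (top_point e y) \<partial>surface (hplane e))
       - (\<integral>y. indicator (shadow e) y * f (top_point (- e) y) \<partial>surface (hplane e))"
    unfolding Bochner_Integration.integral_diff[OF parts_integrable(1,2)] integral_projection[OF e f] integral_projection[OF e' f]
    by (simp add: shadow_uminus)
  also have "\<dots> = (\<integral>y. indicator (shadow e) y * f (top_point e y) - indicator (shadow e) y * f (top_point (- e) y) \<partial>surface (hplane e))"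
    using parts_integrable(3,4) by (intro Bochner_Integration.integral_diff[symmetric]) auto
  also have "\<dots> = (\<integral>y. \<integral>t. indicator K (y + t *\<^sub>R e) * g (y + t *\<^sub>R e) \<partial>lborel \<partial>surface (hplane e))"
  proof (rule integral_cong_AE)
    show "AE y in surface (hplane e). indicator (shadow e) y * f (top_point e y) - indicator (shadow e) y * f (top_point (- e) y)
        = (\<integral>t. indicator K (y + t *\<^sub>R e) * g (y + t *\<^sub>R e) \<partial>lborel)"
      by (rule eventually_mono[OF AE_integral_derivative_on_line[OF e _ intg]], rule deriv) (auto dest: sym)
  qed measurable
  also have "\<dots> = slice_const TYPE('a) * (\<integral>x. indicator K x * g x \<partial>lborel)"
    by (rule integral_slices_eq_lborel[OF e dim intg])
  finally show ?thesis .
qed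

theorem divergence_theorem:
  fixes V :: "'a \<Rightarrow> 'a" and g :: "'a \<Rightarrow> 'a \<Rightarrow> real"
  assumes V [measurable]: "V \<in> borel_measurable borel" and g [measurable]: "\<And>b. g b \<in> borel_measurable borel"
    and deriv: "\<And>b x. b \<in> Basis \<Longrightarrow> x \<noteq> p \<Longrightarrow> ((\<lambda>t. V (x + t *\<^sub>R b) \<bullet> b) has_real_derivative g b x) (at 0)"
    and intg: "\<And>b. b \<in> Basis \<Longrightarrow> integrable lborel (\<lambda>x. indicator K x * g b x)"
    and intV: "integrable (surface S) V"
  shows "(\<integral>x. V x \<bullet> n x \<partial>surface S) = slice_const TYPE('a) * (\<integral>x. indicator K x * (\<Sum>b\<in>Basis. g b x) \<partial>lborel)"
proof -
  have intVb: "integrable (surface S) (\<lambda>x. V x \<bullet> b)" for b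
    using intV by (rule integrable_inner_left)
  have intVbn: "integrable (surface S) (\<lambda>x. (V x \<bullet> b) * (n x \<bullet> b))" for b
    using integrable_mult_bounded_normal_part[OF intVb, of "\<lambda>x. n x \<bullet> b" b b] by (simp add: mult.commute)
  have "(\<integral>x. V x \<bullet> n x \<partial>surface S) = (\<integral>x. (\<Sum>b\<in>Basis. (V x \<bullet> b) * (n x \<bullet> b)) \<partial>surface S)"
    by (intro Bochner_Integration.integral_cong refl euclidean_inner)
  also have "\<dots> = (\<Sum>b\<in>Basis. \<integral>x. (V x \<bullet> b) * (n x \<bullet> b) \<partial>surface S)"
    by (rule Bochner_Integration.integral_sum) (rule intVbn)
  also have "\<dots> = (\<Sum>b\<in>Basis. slice_const TYPE('a) * (\<integral>x. indicator K x * g b x \<partial>lborel))"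
  proof (rule sum.cong[OF refl])
    fix b :: 'a assume b: "b \<in> Basis"
    show "(\<integral>x. (V x \<bullet> b) * (n x \<bullet> b) \<partial>surface S) = slice_const TYPE('a) * (\<integral>x. indicator K x * g b x \<partial>lborel)"
      by (rule divergence_direction[OF _ _ g deriv[OF b] intg[OF b] intVb]) (use b in auto)
  qed
  also have "\<dots> = slice_const TYPE('a) * (\<integral>x. (\<Sum>b\<in>Basis. indicator K x * g b x) \<partial>lborel)"
    using intg by (subst Bochner_Integration.integral_sum) (auto simp: sum_distrib_left)
  finally show ?thesis by (simp only: sum_distrib_left)
qed

end

section \<open>The surface measure of the sphere\<close>

lemma smooth_body_ball:
  assumes "DIM('a::euclidean_space) \<ge> 2"
  shows "smooth_body (cball 0 1) (\<lambda>x::'a. if x \<in> sphere 0 1 then x else 0)"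
proof
  fix x y :: 'a assume x: "x \<in> frontier (cball 0 1)" and y: "y \<in> cball 0 1"
  then have "y \<bullet> x \<le> 1" using norm_cauchy_schwarz[of y x] by simp
  then show "(y - x) \<bullet> (if x \<in> sphere 0 1 then x else 0) \<le> 0"
    using x by (auto simp: inner_diff_left norm_eq_1)
next
  fix x u :: 'a assume x: "x \<in> frontier (cball 0 1)" and u: "norm u = 1" and supporting: "\<And>y. y \<in> cball 0 1 \<Longrightarrow> (y - x) \<bullet> u \<le> 0"
  have "(u - x) \<bullet> u \<le> 0" using u by (intro supporting) simp
  then have "1 \<le> x \<bullet> u" using u by (simp add: inner_diff_left norm_eq_1)
  moreover have "(u - x) \<bullet> (u - x) = 2 - 2 * (x \<bullet> u)"
    using u x by (simp add: inner_diff_left inner_diff_right inner_commute norm_eq_1)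
  ultimately have "(u - x) \<bullet> (u - x) \<le> 0" by simp
  then have "u - x = 0" by (metis inner_eq_zero_iff inner_ge_zero order_antisym)
  then show "u = (if x \<in> sphere 0 1 then x else 0)" using x by simp
qed (use assms in auto)

lemma finite_surface_sphere: "DIM('a::euclidean_space) \<ge> 2 \<Longrightarrow> finite_measure (surface (sphere (0::'a) 1))"
  using smooth_body.finite_surface[OF smooth_body_ball] by simp

lemma bounded_linear_eq_inner:
  fixes f :: "'a::euclidean_space \<Rightarrow> real"
  assumes "bounded_linear f"
  shows "f v = (\<Sum>b\<in>Basis. f b *\<^sub>R b) \<bullet> v"
proof -
  interpret bounded_linear f by fact
  have "f v = f (\<Sum>b\<in>Basis. (v \<bullet> b) *\<^sub>R b)" by (simp add: euclidean_representation)
  also have "\<dots> = (\<Sum>b\<in>Basis. f b *\<^sub>R b) \<bullet> v"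
    by (simp add: sum scaleR inner_sum_left inner_commute[of v] mult.commute)
  finally show ?thesis .
qed

lemma real_polynomial_function_has_gradient:
  fixes g :: "'a::euclidean_space \<Rightarrow> real"
  assumes "real_polynomial_function g"
  shows "\<exists>G. continuous_on UNIV G \<and> (\<forall>x. (g has_derivative (\<lambda>v. G x \<bullet> v)) (at x))"
  using assms
proof induction
  case (linear f)
  have "f = (\<lambda>v. (\<Sum>b\<in>Basis. f b *\<^sub>R b) \<bullet> v)" using bounded_linear_eq_inner[OF linear] by (rule ext)
  then have "(f has_derivative (\<lambda>v. (\<Sum>b\<in>Basis. f b *\<^sub>R b) \<bullet> v)) (at x)" for x
    using bounded_linear_imp_has_derivative[OF linear] by simp
  then show ?case by (intro exI[of _ "\<lambda>_. \<Sum>b\<in>Basis. f b *\<^sub>R b"]) auto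
next
  case (const c)
  show ?case by (intro exI[of _ "\<lambda>_. 0"]) auto
next
  case (add f g)
  then obtain F G where F: "continuous_on UNIV F" "\<And>x. (f has_derivative (\<lambda>v. F x \<bullet> v)) (at x)"
    and G: "continuous_on UNIV G" "\<And>x. (g has_derivative (\<lambda>v. G x \<bullet> v)) (at x)" by blast
  have "((\<lambda>x. f x + g x) has_derivative (\<lambda>v. (F x + G x) \<bullet> v)) (at x)" for x
    using has_derivative_add[OF F(2) G(2), of x] by (simp add: inner_add_left)
  moreover have "continuous_on UNIV (\<lambda>x. F x + G x)" using F(1) G(1) by (rule continuous_on_add)
  ultimately show ?case by blast
next
  case (mult f g)
  then obtain F G where F: "continuous_on UNIV F" "\<And>x. (f has_derivative (\<lambda>v. F x \<bullet> v)) (at x)"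
    and G: "continuous_on UNIV G" "\<And>x. (g has_derivative (\<lambda>v. G x \<bullet> v)) (at x)" by blast
  have "continuous_on UNIV f" "continuous_on UNIV g"
    using has_derivative_continuous[OF F(2)] has_derivative_continuous[OF G(2)]
    by (auto intro: continuous_at_imp_continuous_on)
  then have "continuous_on UNIV (\<lambda>x. f x *\<^sub>R G x + g x *\<^sub>R F x)" using F(1) G(1) by (intro continuous_intros)
  moreover have "((\<lambda>x. f x * g x) has_derivative (\<lambda>v. (f x *\<^sub>R G x + g x *\<^sub>R F x) \<bullet> v)) (at x)" for x
    using has_derivative_mult[OF F(2) G(2), of x] by (simp add: inner_add_left mult.commute)
  ultimately show ?case by blast
qed

lemma norm_scaleR_sgn: "norm z *\<^sub>R sgn z = (z :: 'a::real_normed_vector)"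
  by (cases "z = 0") (auto simp: sgn_div_norm)

lemma inner_sgn_self: "x \<bullet> sgn x = norm x" for x :: "'a::euclidean_space"
  by (cases "x = 0") (simp_all add: sgn_div_norm dot_square_norm power2_eq_square)

lemma has_derivative_sgn_vec:
  fixes x :: "'a::euclidean_space"
  assumes x: "x \<noteq> 0"
  shows "(sgn has_derivative (\<lambda>v. proj_perp (sgn x) v /\<^sub>R norm x)) (at x)"
proof -
  have "((\<lambda>x. inverse (norm x) *\<^sub>R x) has_derivative
      (\<lambda>v. inverse (norm x) *\<^sub>R v + (- (inverse (norm x) * (v \<bullet> sgn x) * inverse (norm x))) *\<^sub>R x)) (at x)"
    by (rule derivative_eq_intros has_derivative_norm refl x | simp add: x)+
  then have "((\<lambda>x. inverse (norm x) *\<^sub>R x) has_derivative (\<lambda>v. proj_perp (sgn x) v /\<^sub>R norm x)) (at x)"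
    by (rule has_derivative_eq_rhs)
      (simp add: fun_eq_iff proj_perp_def sgn_div_norm scaleR_right_diff_distrib mult_ac)
  then show ?thesis unfolding sgn_div_norm[abs_def] .
qed

lemma has_real_derivative_along_line:
  fixes f :: "'a::real_normed_vector \<Rightarrow> real"
  assumes "(f has_derivative D) (at x)"
  shows "((\<lambda>t. f (x + t *\<^sub>R b)) has_real_derivative D b) (at 0)"
proof -
  interpret bounded_linear D using assms by (rule has_derivative_bounded_linear)
  have "((\<lambda>t. x + t *\<^sub>R b) has_derivative (\<lambda>t. t *\<^sub>R b)) (at 0)"
    by (auto intro!: derivative_eq_intros)
  from has_derivative_compose[OF this, of f D] assms
  have "((\<lambda>t. f (x + t *\<^sub>R b)) has_derivative (\<lambda>t. D (t *\<^sub>R b))) (at 0)" by simp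
  moreover have "(\<lambda>t. D (t *\<^sub>R b)) = (*) (D b)" by (simp add: scaleR fun_eq_iff)
  ultimately show ?thesis by (simp add: has_field_derivative_def)
qed

text \<open>\<open>g (sgn x) x\<close> is homogeneous of degree one, so that its divergence is \<open>DIM('a) * g (sgn x)\<close>.\<close>

definition radial_field_deriv :: "('a::euclidean_space \<Rightarrow> real) \<Rightarrow> ('a \<Rightarrow> 'a) \<Rightarrow> 'a \<Rightarrow> 'a \<Rightarrow> real" where
  "radial_field_deriv g G b x = (G (sgn x) \<bullet> (proj_perp (sgn x) b /\<^sub>R norm x)) * (x \<bullet> b) + g (sgn x)"

lemma radial_field_has_derivative:
  fixes g :: "'a::euclidean_space \<Rightarrow> real"
  assumes g: "\<And>x. (g has_derivative (\<lambda>v. G x \<bullet> v)) (at x)" and x: "x \<noteq> 0" and b: "b \<in> Basis"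
  shows "((\<lambda>t. (g (sgn (x + t *\<^sub>R b)) *\<^sub>R (x + t *\<^sub>R b)) \<bullet> b) has_real_derivative radial_field_deriv g G b x) (at 0)"
proof -
  have "((\<lambda>x. g (sgn x) * (x \<bullet> b)) has_derivative
      (\<lambda>v. g (sgn x) * (v \<bullet> b) + G (sgn x) \<bullet> (proj_perp (sgn x) v /\<^sub>R norm x) * (x \<bullet> b))) (at x)"
    by (rule has_derivative_mult[OF has_derivative_compose[OF has_derivative_sgn_vec[OF x] g]
          has_derivative_inner_left[OF has_derivative_ident]])
  from has_real_derivative_along_line[OF this, of b] show ?thesis
    using b by (simp add: radial_field_deriv_def inner_Basis add.commute)
qed

lemma sum_radial_field_deriv:
  fixes g :: "'a::euclidean_space \<Rightarrow> real"
  shows "(\<Sum>b\<in>Basis. radial_field_deriv g G b x) = real DIM('a) * g (sgn x)"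
proof -
  have "(\<Sum>b\<in>Basis. (G (sgn x) \<bullet> (proj_perp (sgn x) b /\<^sub>R norm x)) * (x \<bullet> b))
      = G (sgn x) \<bullet> (proj_perp (sgn x) (\<Sum>b\<in>Basis. (x \<bullet> b) *\<^sub>R b) /\<^sub>R norm x)"
    by (simp add: proj_perp_def inner_diff_right inner_diff_left inner_sum_right inner_sum_left sum_subtractf
        sum_distrib_left sum_distrib_right algebra_simps)
  also have "proj_perp (sgn x) (\<Sum>b\<in>Basis. (x \<bullet> b) *\<^sub>R b) = 0"
    by (simp add: euclidean_representation proj_perp_def inner_sgn_self norm_scaleR_sgn)
  finally show ?thesis by (simp add: radial_field_deriv_def sum.distrib)
qed

lemma abs_radial_field_deriv_le:
  assumes b: "b \<in> Basis"
  shows "\<bar>radial_field_deriv g G b x\<bar> \<le> norm (G (sgn x)) + \<bar>g (sgn x)\<bar>"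
proof (cases "x = 0")
  case False
  have "norm (proj_perp (sgn x) b) \<le> 1" using norm_proj_perp_le[of "sgn x" b] b False by (simp add: norm_sgn)
  then have "\<bar>G (sgn x) \<bullet> (proj_perp (sgn x) b /\<^sub>R norm x)\<bar> \<le> norm (G (sgn x)) * (1 / norm x)"
    using Cauchy_Schwarz_ineq2[of "G (sgn x)" "proj_perp (sgn x) b /\<^sub>R norm x"]
    by (elim order_trans) (auto intro!: mult_left_mono simp: divide_inverse mult_left_le)
  then have "\<bar>G (sgn x) \<bullet> (proj_perp (sgn x) b /\<^sub>R norm x)\<bar> * \<bar>x \<bullet> b\<bar> \<le> norm (G (sgn x)) * (1 / norm x) * norm x"
    using Basis_le_norm[OF b] by (intro mult_mono) auto
  then show ?thesis unfolding radial_field_deriv_def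
    using False abs_triangle_ineq[of "(G (sgn x) \<bullet> (proj_perp (sgn x) b /\<^sub>R norm x)) * (x \<bullet> b)" "g (sgn x)"]
    by (simp add: abs_mult)
qed (simp add: radial_field_deriv_def)

lemma cball_borel [measurable]: "cball a r \<in> sets borel"
  by simp

lemma radial_field_deriv_measurable [measurable]:
  assumes [measurable]: "g \<in> borel_measurable borel" "G \<in> borel_measurable borel"
  shows "radial_field_deriv g G b \<in> borel_measurable borel"
  unfolding radial_field_deriv_def proj_perp_def by measurable

lemma integrable_radial_field_deriv:
  fixes g :: "'a::euclidean_space \<Rightarrow> real"
  assumes [measurable]: "g \<in> borel_measurable borel" "G \<in> borel_measurable borel"
    and C: "\<And>x. norm (G (sgn x)) + \<bar>g (sgn x)\<bar> \<le> C" and b: "b \<in> Basis"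
  shows "integrable lborel (\<lambda>x. indicator (cball 0 1) x * radial_field_deriv g G b x)"
proof (rule Bochner_Integration.integrable_bound)
  show "integrable lborel (\<lambda>x. indicator (cball 0 1) x * C)"
    by (intro integrable_mult_left integrable_real_indicator) (auto simp: emeasure_cball)
  have "\<bar>radial_field_deriv g G b x\<bar> \<le> \<bar>C\<bar>" for x
    using abs_radial_field_deriv_le[OF b, of g G x] C[of x] by linarith
  then show "AE x in lborel. norm (indicator (cball 0 1) x * radial_field_deriv g G b x) \<le> norm (indicator (cball 0 1) x * C)"
    by (intro AE_I2) (auto simp: indicator_def)
qed measurable

lemma integral_sphere_polynomial:
  fixes g :: "'a::euclidean_space \<Rightarrow> real"
  assumes dim: "DIM('a) \<ge> 2" and g: "real_polynomial_function g"
  shows "(\<integral>x. g x \<partial>surface (sphere 0 1))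
    = slice_const TYPE('a) * (\<integral>x. indicator (cball 0 1) x * (real DIM('a) * g (sgn x)) \<partial>lborel)"
proof -
  let ?n = "\<lambda>x::'a. if x \<in> sphere 0 1 then x else 0"
  interpret B: smooth_body "cball 0 1" ?n by (rule smooth_body_ball[OF dim])
  interpret finite_measure "surface (sphere (0::'a) 1)" by (rule finite_surface_sphere[OF dim])
  note [measurable] = B.normal_measurable
  obtain G where G: "continuous_on UNIV G" "\<And>x. (g has_derivative (\<lambda>v. G x \<bullet> v)) (at x)"
    using real_polynomial_function_has_gradient[OF g] by blast
  have cont: "continuous_on UNIV g"
    using g by (auto intro: continuous_at_imp_continuous_on continuous_real_polymonial_function)
  have [measurable]: "g \<in> borel_measurable borel" "G \<in> borel_measurable borel"
    using cont G(1) by (auto intro: borel_measurable_continuous_onI)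
  have "continuous_on UNIV (\<lambda>x. norm (G x) + \<bar>g x\<bar>)" using cont G(1) by (intro continuous_intros)
  then have "compact ((\<lambda>x. norm (G x) + \<bar>g x\<bar>) ` cball 0 1)"
    by (intro compact_continuous_image) (auto intro: continuous_on_subset)
  then obtain C where "norm (G x) + \<bar>g x\<bar> \<le> C" if "x \<in> cball 0 1" for x
    using compact_imp_bounded by (fastforce simp: bounded_iff)
  then have C: "norm (G (sgn x)) + \<bar>g (sgn x)\<bar> \<le> C" for x by (simp add: norm_sgn)
  have on_sphere: "AE x in surface (sphere 0 1). x \<in> sphere (0::'a) 1" by (rule AE_hausdorff_within) simp
  have "(\<integral>x. g x \<partial>surface (sphere 0 1)) = (\<integral>x. (g (sgn x) *\<^sub>R x) \<bullet> ?n x \<partial>surface (sphere 0 1))"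
  proof (rule integral_cong_AE)
    show "AE x in surface (sphere 0 1). g x = (g (sgn x) *\<^sub>R x) \<bullet> ?n x"
      using on_sphere by eventually_elim (simp add: sgn_div_norm dot_square_norm)
  qed measurable
  also have "\<dots> = slice_const TYPE('a) * (\<integral>x. indicator (cball 0 1) x * (\<Sum>b\<in>Basis. radial_field_deriv g G b x) \<partial>lborel)"
  proof (rule B.divergence_theorem[where p=0, unfolded frontier_cball])
    have "\<bar>g (sgn x)\<bar> \<le> C" for x using C[of x] norm_ge_zero[of "G (sgn x)"] by linarith
    then show "integrable (surface (sphere 0 1)) (\<lambda>x. g (sgn x) *\<^sub>R x)"
      by (intro integrable_const_bound[where B=C] eventually_mono[OF on_sphere]) auto
  qed (use radial_field_has_derivative[OF G(2)] integrable_radial_field_deriv[of g G, OF _ _ C] in auto)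
  finally show ?thesis by (simp only: sum_radial_field_deriv)
qed

lemma finite_measure_eqI_closed:
  fixes M N :: "'a::euclidean_space measure"
  assumes M: "finite_measure M" "sets M = sets borel" and N: "sets N = sets borel"
    and closed_eq: "\<And>A. closed A \<Longrightarrow> emeasure M A = emeasure N A"
  shows "M = N"
proof (rule measure_eqI_generator_eq[where E="{A. closed A}" and \<Omega>=UNIV and A="\<lambda>_. UNIV"])
  show "Int_stable {A :: 'a set. closed A}" by (auto simp: Int_stable_def)
  show "sets M = sigma_sets UNIV {A. closed A}" "sets N = sigma_sets UNIV {A. closed A}"
    using M N by (simp_all add: borel_eq_closed)
  show "emeasure M UNIV \<noteq> \<infinity>"
    using finite_measure.emeasure_finite[OF M(1)] by simp
qed (use closed_eq in auto)

lemma integral_cutoff_tendsto_measure: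
  fixes M :: "'a::euclidean_space measure"
  assumes M: "finite_measure M" "sets M = sets borel" and A: "closed A" "A \<noteq> {}"
  shows "(\<lambda>k. \<integral>x. max 0 (1 - real k * infdist x A) \<partial>M) \<longlonglongrightarrow> measure M A"
proof -
  interpret finite_measure M by fact
  have [measurable_cong]: "sets M = sets borel" by fact
  have [measurable]: "A \<in> sets borel" using A by simp
  have "(\<lambda>k. \<integral>x. max 0 (1 - real k * infdist x A) \<partial>M) \<longlonglongrightarrow> (\<integral>x. indicator A x \<partial>M)"
  proof (rule integral_dominated_convergence[where w="\<lambda>_. 1"])
    show "AE x in M. (\<lambda>k. max 0 (1 - real k * infdist x A)) \<longlonglongrightarrow> indicator A x"
    proof (rule AE_I2)
      fix x
      show "(\<lambda>k. max 0 (1 - real k * infdist x A)) \<longlonglongrightarrow> indicator A x"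
      proof (cases "x \<in> A")
        case False
        then have "0 < infdist x A" using A by (simp add: infdist_pos_not_in_closed)
        then obtain k where k: "1 < real k * infdist x A" using ex_less_of_nat_mult by blast
        have "max 0 (1 - real j * infdist x A) = 0" if "k \<le> j" for j
        proof -
          have "real k * infdist x A \<le> real j * infdist x A" using that infdist_nonneg by (intro mult_right_mono) auto
          then show ?thesis using k by simp
        qed
        then show ?thesis using False by (intro tendsto_eventually eventually_sequentiallyI[of k]) simp
      qed simp
    qed
    show "AE x in M. norm (max 0 (1 - real k * infdist x A)) \<le> 1" for k
      by (intro AE_I2) (simp add: infdist_nonneg)
    show "(\<lambda>x. max 0 (1 - real k * infdist x A)) \<in> borel_measurable M" for k
      using borel_measurable_continuous_onI[OF continuous_on_infdist[OF continuous_on_id, of UNIV A]] by measurable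
  qed auto
  then show ?thesis by simp
qed

lemma abs_integral_le:
  fixes f w :: "'a \<Rightarrow> real"
  assumes "integrable M f" "integrable M w" "AE x in M. \<bar>f x\<bar> \<le> w x"
  shows "\<bar>\<integral>x. f x \<partial>M\<bar> \<le> (\<integral>x. w x \<partial>M)"
proof -
  have "\<bar>\<integral>x. f x \<partial>M\<bar> \<le> (\<integral>x. \<bar>f x\<bar> \<partial>M)" by (rule integral_abs_bound)
  also have "\<dots> \<le> (\<integral>x. w x \<partial>M)" using assms by (intro integral_mono_AE) auto
  finally show ?thesis .
qed

lemma integrable_continuous_of_AE_compact:
  fixes f :: "'a::euclidean_space \<Rightarrow> real"
  assumes M: "finite_measure M" "sets M = sets borel" "AE x in M. x \<in> C" and C: "compact C" and f: "continuous_on UNIV f"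
  shows "integrable M f"
proof -
  have [measurable_cong]: "sets M = sets borel" by fact
  have [measurable]: "f \<in> borel_measurable borel" using f by (rule borel_measurable_continuous_onI)
  have "compact (f ` C)" using C f by (intro compact_continuous_image) (auto intro: continuous_on_subset)
  then obtain B where B: "\<And>x. x \<in> C \<Longrightarrow> \<bar>f x\<bar> \<le> B" using compact_imp_bounded by (fastforce simp: bounded_iff)
  have "AE x in M. norm (f x) \<le> B" using M(3) by eventually_elim (simp add: B)
  then show ?thesis using M(1) by (intro finite_measure.integrable_const_bound) auto
qed

lemma abs_integral_diff_le_of_close:
  fixes f g :: "'a::euclidean_space \<Rightarrow> real"
  assumes M: "finite_measure M" "sets M = sets borel" "AE x in M. x \<in> C" and C: "compact C"
    and fg: "continuous_on UNIV f" "continuous_on UNIV g" and close: "\<And>x. x \<in> C \<Longrightarrow> \<bar>f x - g x\<bar> \<le> \<epsilon>"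
  shows "\<bar>(\<integral>x. f x \<partial>M) - (\<integral>x. g x \<partial>M)\<bar> \<le> \<epsilon> * measure M UNIV"
proof -
  note continuous_integrable = integrable_continuous_of_AE_compact[OF M C]
  have "(\<integral>x. f x \<partial>M) - (\<integral>x. g x \<partial>M) = (\<integral>x. f x - g x \<partial>M)" using continuous_integrable fg by simp
  also have "\<bar>\<dots>\<bar> \<le> (\<integral>x. \<epsilon> \<partial>M)"
  proof (rule abs_integral_le)
    show "AE x in M. \<bar>f x - g x\<bar> \<le> \<epsilon>" using M(3) by eventually_elim (rule close)
  qed (use continuous_integrable fg in \<open>auto intro: finite_measure.integrable_const[OF M(1)]\<close>)
  also have "\<dots> = \<epsilon> * measure M UNIV" using sets_eq_imp_space_eq[OF M(2)] by simp
  finally show ?thesis .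
qed

lemma integral_continuous_eqI_polynomial:
  fixes M N :: "'a::euclidean_space measure" and f :: "'a \<Rightarrow> real"
  assumes M: "finite_measure M" "sets M = sets borel" "AE x in M. x \<in> C"
    and N: "finite_measure N" "sets N = sets borel" "AE x in N. x \<in> C" and C: "compact C"
    and polynomial_eq: "\<And>g. real_polynomial_function g \<Longrightarrow> (\<integral>x. g x \<partial>M) = (\<integral>x. g x \<partial>N)"
    and f: "continuous_on UNIV f"
  shows "(\<integral>x. f x \<partial>M) = (\<integral>x. f x \<partial>N)"
proof -
  let ?T = "measure M UNIV + measure N UNIV + 1"
  have T: "0 < ?T" by (simp add: add_nonneg_pos)
  have "\<bar>(\<integral>x. f x \<partial>M) - (\<integral>x. f x \<partial>N)\<bar> \<le> \<epsilon>" if \<epsilon>: "0 < \<epsilon>" for \<epsilon>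
  proof -
    obtain g where g: "real_polynomial_function g" "\<And>x. x \<in> C \<Longrightarrow> \<bar>f x - g x\<bar> < \<epsilon> / ?T"
      using Stone_Weierstrass_real_polynomial_function[OF C continuous_on_subset[OF f], of "\<epsilon> / ?T"] \<epsilon> T by auto
    have "continuous_on UNIV g"
      using g(1) by (auto intro: continuous_at_imp_continuous_on continuous_real_polymonial_function)
    then have "\<bar>(\<integral>x. f x \<partial>M) - (\<integral>x. g x \<partial>M)\<bar> \<le> \<epsilon> / ?T * measure M UNIV"
      and "\<bar>(\<integral>x. f x \<partial>N) - (\<integral>x. g x \<partial>N)\<bar> \<le> \<epsilon> / ?T * measure N UNIV"
      using abs_integral_diff_le_of_close[OF M C f _ less_imp_le[OF g(2)]]
        abs_integral_diff_le_of_close[OF N C f _ less_imp_le[OF g(2)]] by blast+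
    then have "\<bar>(\<integral>x. f x \<partial>M) - (\<integral>x. f x \<partial>N)\<bar> \<le> \<epsilon> / ?T * measure M UNIV + \<epsilon> / ?T * measure N UNIV"
      using polynomial_eq[OF g(1)] by linarith
    also have "\<dots> = \<epsilon> * ((measure M UNIV + measure N UNIV) / ?T)" by (simp add: distrib_left add_divide_distrib)
    also have "\<dots> \<le> \<epsilon>" using \<epsilon> T by (intro mult_left_le) auto
    finally show ?thesis .
  qed
  then have "\<bar>(\<integral>x. f x \<partial>M) - (\<integral>x. f x \<partial>N)\<bar> \<le> 0" by (rule dense_ge)
  then show ?thesis by simp
qed

lemma finite_measure_eqI_polynomial:
  fixes M N :: "'a::euclidean_space measure"
  assumes M: "finite_measure M" "sets M = sets borel" "AE x in M. x \<in> C"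
    and N: "finite_measure N" "sets N = sets borel" "AE x in N. x \<in> C" and C: "compact C"
    and polynomial_eq: "\<And>g. real_polynomial_function g \<Longrightarrow> (\<integral>x. g x \<partial>M) = (\<integral>x. g x \<partial>N)"
  shows "M = N"
proof (rule finite_measure_eqI_closed[OF M(1,2) N(2)])
  fix A :: "'a set" assume A: "closed A"
  have "measure M A = measure N A"
  proof (cases "A = {}")
    case False
    have "(\<integral>x. max 0 (1 - real k * infdist x A) \<partial>M) = (\<integral>x. max 0 (1 - real k * infdist x A) \<partial>N)" for k
      by (intro integral_continuous_eqI_polynomial[OF M N C polynomial_eq] continuous_intros)
    then show ?thesis
      using LIMSEQ_unique integral_cutoff_tendsto_measure[OF M(1,2) A False] integral_cutoff_tendsto_measure[OF N(1,2) A False] by simp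
  qed simp
  then show "emeasure M A = emeasure N A"
    using M(1) N(1) by (simp add: finite_measure.emeasure_eq_measure)
qed

definition cone_measure :: "'a::euclidean_space measure" where
  "cone_measure = distr (density lborel (indicator (cball 0 1))) borel sgn"

lemma sets_cone_measure [simp, measurable_cong]: "sets cone_measure = sets borel"
  by (simp add: cone_measure_def)

lemma space_cone_measure [simp]: "space cone_measure = UNIV"
  by (simp add: cone_measure_def)

lemma nn_integral_cone_measure:
  assumes [measurable]: "f \<in> borel_measurable borel"
  shows "(\<integral>\<^sup>+u. f u \<partial>cone_measure) = (\<integral>\<^sup>+x. indicator (cball 0 1) x * f (sgn x) \<partial>(lborel :: 'a::euclidean_space measure))"
  unfolding cone_measure_def by (simp add: nn_integral_distr nn_integral_density)

lemma integral_cone_measure: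
  fixes f :: "'a::euclidean_space \<Rightarrow> real"
  assumes [measurable]: "f \<in> borel_measurable borel"
  shows "(\<integral>u. f u \<partial>cone_measure) = (\<integral>x. indicator (cball 0 1) x * f (sgn x) \<partial>lborel)"
proof -
  have indicator_eq: "(indicator (cball 0 1) :: 'a \<Rightarrow> ennreal) = (\<lambda>x. ennreal (indicator (cball 0 1) x))"
    by (auto simp: fun_eq_iff indicator_def)
  show ?thesis unfolding cone_measure_def indicator_eq by (simp add: integral_distr integral_density)
qed

lemma finite_cone_measure: "finite_measure (cone_measure :: 'a::euclidean_space measure)"
proof
  have "emeasure (cone_measure :: 'a measure) (space cone_measure) = (\<integral>\<^sup>+u. 1 \<partial>(cone_measure :: 'a measure))" by simp
  also have "\<dots> = emeasure lborel (cball 0 1 :: 'a set)" by (subst nn_integral_cone_measure) simp_all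
  finally show "emeasure (cone_measure :: 'a measure) (space cone_measure) \<noteq> \<infinity>" by (simp add: emeasure_cball)
qed

lemma surface_sphere_eq_cone_measure:
  assumes dim: "DIM('a::euclidean_space) \<ge> 2"
  shows "surface (sphere (0::'a) 1) = density cone_measure (\<lambda>_. ennreal (slice_const TYPE('a) * real DIM('a)))"
proof (rule finite_measure_eqI_polynomial[where C="cball 0 1"])
  let ?c = "slice_const TYPE('a) * real DIM('a)"
  have const_nonneg: "0 \<le> ?c" using slice_const_pos(1)[OF dim] by simp
  show "finite_measure (surface (sphere (0::'a) 1))" by (rule finite_surface_sphere[OF dim])
  show "AE x in surface (sphere (0::'a) 1). x \<in> cball 0 1"
    using AE_hausdorff_within[OF borel_closed[OF closed_sphere]] by eventually_elim auto
  interpret C: finite_measure "cone_measure :: 'a measure" by (rule finite_cone_measure)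
  show "finite_measure (density cone_measure (\<lambda>_::'a. ennreal ?c))"
    using C.emeasure_finite[of UNIV] by (intro finite_measureI) (simp add: emeasure_density nn_integral_cmult ennreal_mult_eq_top_iff)
  show "AE x in density cone_measure (\<lambda>_::'a. ennreal ?c). x \<in> cball 0 1"
    unfolding cone_measure_def by (simp add: AE_density AE_distr_iff norm_sgn)
  fix g :: "'a \<Rightarrow> real" assume g: "real_polynomial_function g"
  then have "continuous_on UNIV g" by (auto intro: continuous_at_imp_continuous_on continuous_real_polymonial_function)
  then have [measurable]: "g \<in> borel_measurable borel" by (rule borel_measurable_continuous_onI)
  have "(\<integral>x. g x \<partial>surface (sphere 0 1))
      = slice_const TYPE('a) * (\<integral>x. real DIM('a) * (indicator (cball 0 1) x * g (sgn x)) \<partial>lborel)"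
    unfolding integral_sphere_polynomial[OF dim g] by (simp only: mult.left_commute)
  also have "\<dots> = ?c * (\<integral>x. indicator (cball 0 1) x * g (sgn x) \<partial>lborel)"
    unfolding integral_mult_right_zero by (simp only: mult.assoc)
  also have "\<dots> = (\<integral>x. g x \<partial>density cone_measure (\<lambda>_. ennreal ?c))"
    using const_nonneg by (subst integral_density) (simp_all add: integral_cone_measure)
  finally show "(\<integral>x. g x \<partial>surface (sphere 0 1)) = (\<integral>x. g x \<partial>density cone_measure (\<lambda>_. ennreal ?c))" .
qed simp_all

section \<open>Polar coordinates\<close>

definition radial_measure :: "nat \<Rightarrow> real measure" where
  "radial_measure d = density lborel (\<lambda>t. ennreal (indicator {0<..} t * t ^ (d - 1)))"

lemma sets_radial_measure [simp, measurable_cong]: "sets (radial_measure d) = sets borel"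
  by (simp add: radial_measure_def)

lemma nn_integral_radial_measure:
  assumes [measurable]: "f \<in> borel_measurable borel"
  shows "(\<integral>\<^sup>+t. f t \<partial>radial_measure d) = (\<integral>\<^sup>+t. indicator {0<..} t * (ennreal (t ^ (d - 1)) * f t) \<partial>lborel)"
  unfolding radial_measure_def by (subst nn_integral_density) (auto intro!: nn_integral_cong simp: indicator_def)

lemma sigma_finite_radial_measure: "sigma_finite_measure (radial_measure d)"
  unfolding radial_measure_def
  by (subst sigma_finite_measure.sigma_finite_iff_density_finite[OF lborel.sigma_finite_measure_axioms]) auto

lemma nn_integral_radial_measure_scale:
  assumes f [measurable]: "f \<in> borel_measurable borel" and r: "0 < r" and d: "0 < d"
  shows "(\<integral>\<^sup>+t. f t \<partial>radial_measure d) = ennreal (r ^ d) * (\<integral>\<^sup>+t. f (r * t) \<partial>radial_measure d)"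
proof -
  have "(\<integral>\<^sup>+t. f t \<partial>radial_measure d)
      = ennreal \<bar>r\<bar> * (\<integral>\<^sup>+t. indicator {0<..} (0 + r * t) * (ennreal ((0 + r * t) ^ (d - 1)) * f (0 + r * t)) \<partial>lborel)"
    unfolding nn_integral_radial_measure[OF f] using r by (intro nn_integral_real_affine) auto
  also have "\<dots> = (\<integral>\<^sup>+t. ennreal r * (indicator {0<..} (r * t) * (ennreal ((r * t) ^ (d - 1)) * f (r * t))) \<partial>lborel)"
    using r by (subst nn_integral_cmult) auto
  also have "\<dots> = (\<integral>\<^sup>+t. ennreal (r ^ d) * (indicator {0<..} t * (ennreal (t ^ (d - 1)) * f (r * t))) \<partial>lborel)"
  proof (rule nn_integral_cong)
    fix t
    show "ennreal r * (indicator {0<..} (r * t) * (ennreal ((r * t) ^ (d - 1)) * f (r * t)))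
        = ennreal (r ^ d) * (indicator {0<..} t * (ennreal (t ^ (d - 1)) * f (r * t)))"
    proof (cases "0 < t")
      case True
      have "ennreal r * ennreal ((r * t) ^ (d - 1)) = ennreal (r ^ d) * ennreal (t ^ (d - 1))"
        using True r d by (simp add: power_mult_distrib power_eq_if[of r d] mult.assoc flip: ennreal_mult)
      then show ?thesis using True r by (simp add: flip: mult.assoc)
    qed (use r in \<open>simp add: zero_less_mult_iff\<close>)
  qed
  also have "\<dots> = ennreal (r ^ d) * (\<integral>\<^sup>+t. f (r * t) \<partial>radial_measure d)"
    by (simp add: nn_integral_cmult nn_integral_radial_measure)
  finally show ?thesis .
qed

lemma nn_integral_inverse_power_tail:
  assumes a: "0 < a" and d: "0 < d"
  shows "(\<integral>\<^sup>+s. ennreal (1 / s ^ Suc d) * indicator {a..} s \<partial>lborel) = ennreal (1 / (real d * a ^ d))"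
proof -
  let ?F = "\<lambda>s::real. - (1 / (real d * s ^ d))"
  have "(\<integral>\<^sup>+s. ennreal (1 / s ^ Suc d) * indicator {a..} s \<partial>lborel) = 0 - ?F a"
  proof (rule nn_integral_FTC_atLeast)
    fix s assume "a \<le> s"
    then have s: "0 < s" using a by simp
    have "(?F has_real_derivative (real d * (real d * s ^ (d - 1))) / (real d * s ^ d)\<^sup>2) (at s)"
      using d s by (auto intro!: derivative_eq_intros simp: power2_eq_square)
    also have "(real d * (real d * s ^ (d - 1))) / (real d * s ^ d)\<^sup>2 = 1 / s ^ Suc d"
      using d s by (simp add: power_eq_if[of s d] power2_eq_square divide_eq_eq eq_divide_eq)
    finally show "(?F has_real_derivative 1 / s ^ Suc d) (at s)" .
    show "0 \<le> 1 / s ^ Suc d" using s by simp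
  next
    have "filterlim (\<lambda>s::real. real d * s ^ d) at_top at_top"
      using d by (intro filterlim_tendsto_pos_mult_at_top[OF tendsto_const] filterlim_pow_at_top filterlim_ident) auto
    then have "((\<lambda>s::real. 1 / (real d * s ^ d)) \<longlongrightarrow> 0) at_top"
      by (intro tendsto_divide_0[OF tendsto_const] filterlim_at_top_imp_at_infinity)
    then show "(?F \<longlongrightarrow> 0) at_top" using tendsto_minus by fastforce
  qed simp
  then show ?thesis by simp
qed

lemma nn_integral_radial_measure_tail:
  assumes a: "0 < a" and d: "0 < d"
  shows "(\<integral>\<^sup>+s. ennreal (1 / s ^ (2 * d)) * indicator {a..} s \<partial>radial_measure d) = ennreal (1 / (real d * a ^ d))"
proof -
  have "(\<integral>\<^sup>+s. ennreal (1 / s ^ (2 * d)) * indicator {a..} s \<partial>radial_measure d)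
      = (\<integral>\<^sup>+s. ennreal (1 / s ^ Suc d) * indicator {a..} s \<partial>lborel)"
    unfolding nn_integral_radial_measure[OF borel_measurable_times_ennreal[OF _ borel_measurable_indicator]]
  proof (subst nn_integral_radial_measure, measurable, rule nn_integral_cong)
    fix s
    show "indicator {0<..} s * (ennreal (s ^ (d - 1)) * (ennreal (1 / s ^ (2 * d)) * indicator {a..} s)) = ennreal (1 / s ^ Suc d) * indicator {a..} s"
    proof (cases "a \<le> s")
      case True
      then have s: "0 < s" using a by simp
      have "s ^ (d - 1) * (1 / s ^ (2 * d)) = 1 / s ^ Suc d"
        using s d by (simp add: mult_2 power_add power_eq_if[of s d])
      then have "ennreal (s ^ (d - 1)) * ennreal (1 / s ^ (2 * d)) = ennreal (1 / s ^ Suc d)"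
        using s by (simp flip: ennreal_mult)
      then show ?thesis using True s by simp
    qed simp
  qed
  then show ?thesis using nn_integral_inverse_power_tail[OF a d] by simp
qed

lemma nn_integral_lborel_scale:
  fixes f :: "'a::euclidean_space \<Rightarrow> ennreal"
  assumes [measurable]: "f \<in> borel_measurable borel" and c: "0 < c"
  shows "(\<integral>\<^sup>+x. f x \<partial>lborel) = ennreal (c ^ DIM('a)) * (\<integral>\<^sup>+x. f (c *\<^sub>R x) \<partial>lborel)"
  using c by (subst lborel_affine[of c "0::'a"])
    (auto simp: nn_integral_density nn_integral_distr nn_integral_cmult)

lemma AE_radial_measure_pos: "AE t in radial_measure d. 0 < t"
  unfolding radial_measure_def by (subst AE_density) (auto simp: indicator_def)

lemma nn_integral_unit_ball_scale:
  fixes f :: "'a::euclidean_space \<Rightarrow> ennreal"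
  assumes [measurable]: "f \<in> borel_measurable borel" and s: "0 < s"
  shows "(\<integral>\<^sup>+x. indicator (cball 0 1) x * (ennreal (norm x ^ DIM('a)) * f (s *\<^sub>R x)) \<partial>lborel)
    = ennreal (1 / s ^ (2 * DIM('a))) * (\<integral>\<^sup>+z. (if norm z \<le> s then ennreal (norm z ^ DIM('a)) * f z else 0) \<partial>lborel)"
    (is "?L = _ * ?R")
proof -
  have scale: "(if norm (s *\<^sub>R x) \<le> s then ennreal (norm (s *\<^sub>R x) ^ DIM('a)) * f (s *\<^sub>R x) else 0)
      = ennreal (s ^ DIM('a)) * (indicator (cball 0 1) x * (ennreal (norm x ^ DIM('a)) * f (s *\<^sub>R x)))" for x :: 'a
    using s by (simp add: indicator_def mult_le_cancel_left1 power_mult_distrib ennreal_mult mult.assoc)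
  have "?R = ennreal (s ^ DIM('a)) * (\<integral>\<^sup>+x. (if norm (s *\<^sub>R x) \<le> s then ennreal (norm (s *\<^sub>R x) ^ DIM('a)) * f (s *\<^sub>R x) else 0) \<partial>lborel)"
    by (rule nn_integral_lborel_scale[OF _ s]) measurable
  also have "\<dots> = ennreal (s ^ DIM('a)) * (ennreal (s ^ DIM('a)) * ?L)"
    unfolding scale by (simp add: nn_integral_cmult)
  also have "\<dots> = ennreal (s ^ (2 * DIM('a))) * ?L"
    using s by (simp add: mult_2 power_add ennreal_mult mult.assoc)
  finally have "ennreal (1 / s ^ (2 * DIM('a))) * ?R
      = (ennreal (1 / s ^ (2 * DIM('a))) * ennreal (s ^ (2 * DIM('a)))) * ?L" by (simp only: mult.assoc)
  also have "ennreal (1 / s ^ (2 * DIM('a))) * ennreal (s ^ (2 * DIM('a))) = 1"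
    using s by (subst ennreal_mult[symmetric]) auto
  finally show ?thesis by simp
qed

lemma nn_integral_radial_measure_shells:
  fixes z :: "'a::euclidean_space"
  assumes z: "z \<noteq> 0"
  shows "(\<integral>\<^sup>+t. ennreal (1 / t ^ (2 * DIM('a))) * (if norm z \<le> t then ennreal (norm z ^ DIM('a)) * c else 0) \<partial>radial_measure DIM('a))
    = ennreal (1 / DIM('a)) * c"
proof -
  have "(\<integral>\<^sup>+t. ennreal (1 / t ^ (2 * DIM('a))) * (if norm z \<le> t then ennreal (norm z ^ DIM('a)) * c else 0) \<partial>radial_measure DIM('a))
      = (\<integral>\<^sup>+t. (ennreal (norm z ^ DIM('a)) * c) * (ennreal (1 / t ^ (2 * DIM('a))) * indicator {norm z..} t) \<partial>radial_measure DIM('a))"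
    by (intro nn_integral_cong) (simp add: indicator_def mult.commute)
  also have "\<dots> = (ennreal (norm z ^ DIM('a)) * c) * ennreal (1 / (real DIM('a) * norm z ^ DIM('a)))"
    using z by (simp add: nn_integral_cmult nn_integral_radial_measure_tail)
  also have "\<dots> = (ennreal (norm z ^ DIM('a)) * ennreal (1 / (real DIM('a) * norm z ^ DIM('a)))) * c"
    by (simp only: mult_ac)
  also have "ennreal (norm z ^ DIM('a)) * ennreal (1 / (real DIM('a) * norm z ^ DIM('a))) = ennreal (1 / DIM('a))"
    using z by (subst ennreal_mult[symmetric]) auto
  finally show ?thesis .
qed

lemma nn_integral_radial_measure_ray:
  fixes x :: "'a::euclidean_space"
  assumes [measurable]: "f \<in> borel_measurable borel" and x: "x \<noteq> 0"
  shows "(\<integral>\<^sup>+t. f (t *\<^sub>R sgn x) \<partial>radial_measure DIM('a))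
    = ennreal (norm x ^ DIM('a)) * (\<integral>\<^sup>+t. f (t *\<^sub>R x) \<partial>radial_measure DIM('a))"
proof -
  have "(norm x * t) *\<^sub>R sgn x = t *\<^sub>R x" for t by (metis mult.commute norm_scaleR_sgn scaleR_scaleR)
  then show ?thesis
    using nn_integral_radial_measure_scale[of "\<lambda>t. f (t *\<^sub>R sgn x)" "norm x" "DIM('a)"] x by simp
qed

theorem polar_coordinates:
  fixes f :: "'a::euclidean_space \<Rightarrow> ennreal"
  assumes dim: "DIM('a) \<ge> 2" and f [measurable]: "f \<in> borel_measurable borel"
  shows "(\<integral>\<^sup>+u. \<integral>\<^sup>+t. f (t *\<^sub>R u) \<partial>radial_measure DIM('a) \<partial>surface (sphere 0 1))
    = ennreal (slice_const TYPE('a)) * (\<integral>\<^sup>+x. f x \<partial>lborel)"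
proof -
  let ?d = "DIM('a)" and ?\<rho> = "radial_measure DIM('a)"
  interpret \<rho>: sigma_finite_measure ?\<rho> by (rule sigma_finite_radial_measure)
  interpret pair_sigma_finite "lborel :: 'a measure" ?\<rho> ..
  have "(\<integral>\<^sup>+u. \<integral>\<^sup>+t. f (t *\<^sub>R u) \<partial>?\<rho> \<partial>surface (sphere 0 1))
      = ennreal (slice_const TYPE('a) * ?d) * (\<integral>\<^sup>+x. indicator (cball 0 1) x * (\<integral>\<^sup>+t. f (t *\<^sub>R sgn x) \<partial>?\<rho>) \<partial>lborel)"
    unfolding surface_sphere_eq_cone_measure[OF dim]
    by (simp add: nn_integral_density nn_integral_cmult nn_integral_cone_measure)
  also have "(\<integral>\<^sup>+x. indicator (cball 0 1) x * (\<integral>\<^sup>+t. f (t *\<^sub>R sgn x) \<partial>?\<rho>) \<partial>lborel)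
      = (\<integral>\<^sup>+x. \<integral>\<^sup>+t. indicator (cball 0 1) x * (ennreal (norm x ^ ?d) * f (t *\<^sub>R x)) \<partial>?\<rho> \<partial>lborel)"
  proof (rule nn_integral_cong_AE, use AE_lborel_singleton[of "0::'a"] in eventually_elim)
    case (elim x)
    then show ?case by (simp add: nn_integral_radial_measure_ray nn_integral_cmult)
  qed
  also have "\<dots> = (\<integral>\<^sup>+t. \<integral>\<^sup>+x. indicator (cball 0 1) x * (ennreal (norm x ^ ?d) * f (t *\<^sub>R x)) \<partial>lborel \<partial>?\<rho>)"
    by (rule Fubini'[symmetric]) measurable
  also have "\<dots> = (\<integral>\<^sup>+t. \<integral>\<^sup>+z. ennreal (1 / t ^ (2 * ?d)) * (if norm z \<le> t then ennreal (norm z ^ ?d) * f z else 0) \<partial>lborel \<partial>?\<rho>)"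
  proof (rule nn_integral_cong_AE, use AE_radial_measure_pos in eventually_elim)
    case (elim t)
    show ?case unfolding nn_integral_unit_ball_scale[OF f elim] by (rule nn_integral_cmult[symmetric]) measurable
  qed
  also have "\<dots> = (\<integral>\<^sup>+z. \<integral>\<^sup>+t. ennreal (1 / t ^ (2 * ?d)) * (if norm z \<le> t then ennreal (norm z ^ ?d) * f z else 0) \<partial>?\<rho> \<partial>lborel)"
    by (rule Fubini') measurable
  also have "\<dots> = (\<integral>\<^sup>+z. ennreal (1 / ?d) * f z \<partial>lborel)"
    by (intro nn_integral_cong_AE eventually_mono[OF AE_lborel_singleton[of 0]] nn_integral_radial_measure_shells)
  also have "\<dots> = ennreal (1 / ?d) * (\<integral>\<^sup>+z. f z \<partial>lborel)" by (rule nn_integral_cmult) simp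
  also have "ennreal (slice_const TYPE('a) * ?d) * (ennreal (1 / ?d) * (\<integral>\<^sup>+z. f z \<partial>lborel))
      = ennreal (slice_const TYPE('a)) * (\<integral>\<^sup>+z. f z \<partial>lborel)"
    using slice_const_pos(1)[OF dim] by (subst mult.assoc[symmetric], subst ennreal_mult[symmetric]) auto
  finally show ?thesis .
qed

lemma distr_polar_coordinates:
  assumes dim: "DIM('a::euclidean_space) \<ge> 2"
  shows "distr (surface (sphere (0::'a) 1) \<Otimes>\<^sub>M radial_measure DIM('a)) borel (\<lambda>(u, t). t *\<^sub>R u)
    = density lborel (\<lambda>_. ennreal (slice_const TYPE('a)))"
proof (rule measure_eqI)
  interpret sigma_finite_measure "radial_measure DIM('a)" by (rule sigma_finite_radial_measure)
  let ?P = "surface (sphere (0::'a) 1) \<Otimes>\<^sub>M radial_measure DIM('a)"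
  fix A assume "A \<in> sets (distr ?P borel (\<lambda>(u, t). t *\<^sub>R u))"
  then have [measurable]: "A \<in> sets borel" by simp
  have "emeasure (distr ?P borel (\<lambda>(u, t). t *\<^sub>R u)) A = (\<integral>\<^sup>+x. indicator A x \<partial>distr ?P borel (\<lambda>(u, t). t *\<^sub>R u))" by simp
  also have "\<dots> = (\<integral>\<^sup>+p. indicator A (snd p *\<^sub>R fst p) \<partial>?P)"
    by (subst nn_integral_distr) (auto simp: split_beta')
  also have "\<dots> = (\<integral>\<^sup>+u. \<integral>\<^sup>+t. indicator A (t *\<^sub>R u) \<partial>radial_measure DIM('a) \<partial>surface (sphere 0 1))"
    by (subst nn_integral_fst[symmetric]) auto
  also have "\<dots> = ennreal (slice_const TYPE('a)) * (\<integral>\<^sup>+x. indicator A x \<partial>lborel)"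
    by (rule polar_coordinates[OF dim]) measurable
  finally show "emeasure (distr ?P borel (\<lambda>(u, t). t *\<^sub>R u)) A
      = emeasure (density lborel (\<lambda>_. ennreal (slice_const TYPE('a)))) A"
    by (simp add: emeasure_density nn_integral_cmult)
qed simp

lemma integral_polar_coordinates:
  fixes F :: "'a::euclidean_space \<Rightarrow> real"
  assumes dim: "DIM('a) \<ge> 2" and F: "integrable lborel F"
  shows "(\<integral>u. \<integral>t. F (t *\<^sub>R u) \<partial>radial_measure DIM('a) \<partial>surface (sphere 0 1)) = slice_const TYPE('a) * (\<integral>x. F x \<partial>lborel)"
proof -
  have [measurable]: "F \<in> borel_measurable borel" using F by simp
  have const_nonneg: "0 \<le> slice_const TYPE('a)" using slice_const_pos(1)[OF dim] by simp
  interpret S: finite_measure "surface (sphere (0::'a) 1)" by (rule finite_surface_sphere[OF dim])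
  interpret \<rho>: sigma_finite_measure "radial_measure DIM('a)" by (rule sigma_finite_radial_measure)
  interpret pair_sigma_finite "surface (sphere (0::'a) 1)" "radial_measure DIM('a)" ..
  let ?P = "surface (sphere (0::'a) 1) \<Otimes>\<^sub>M radial_measure DIM('a)"
  have "integrable (density lborel (\<lambda>_. ennreal (slice_const TYPE('a)))) F" using F const_nonneg by (subst integrable_density) auto
  then have pair_integrable: "integrable ?P (\<lambda>(u, t). F (t *\<^sub>R u))"
    unfolding distr_polar_coordinates[OF dim, symmetric] by (subst (asm) integrable_distr_eq) (auto simp: split_beta')
  have "(\<integral>u. \<integral>t. F (t *\<^sub>R u) \<partial>radial_measure DIM('a) \<partial>surface (sphere 0 1)) = (\<integral>p. F (snd p *\<^sub>R fst p) \<partial>?P)"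
    using integral_fst'[OF pair_integrable] by (simp add: split_beta')
  also have "\<dots> = (\<integral>x. F x \<partial>distr ?P borel (\<lambda>(u, t). t *\<^sub>R u))" by (subst integral_distr) (auto simp: split_beta')
  also have "\<dots> = slice_const TYPE('a) * (\<integral>x. F x \<partial>lborel)"
    unfolding distr_polar_coordinates[OF dim] using const_nonneg by (subst integral_density) auto
  finally show ?thesis .
qed

section \<open>Integrability of singular kernels\<close>

definition radial_weight :: "real \<Rightarrow> 'a::euclidean_space \<Rightarrow> ennreal" where
  "radial_weight R x = indicator (cball 0 R) x * ennreal (1 / norm x ^ (DIM('a) - 1))"

lemma radial_weight_measurable [measurable]: "radial_weight R \<in> borel_measurable borel"
  unfolding radial_weight_def by measurable

lemma nn_integral_radial_weight_ray_le:
  fixes u :: "'a::euclidean_space"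
  assumes "norm u = 1" "0 \<le> R"
  shows "(\<integral>\<^sup>+t. radial_weight R (t *\<^sub>R u) \<partial>radial_measure DIM('a)) \<le> ennreal R"
proof -
  have "(\<integral>\<^sup>+t. radial_weight R (t *\<^sub>R u) \<partial>radial_measure DIM('a)) \<le> (\<integral>\<^sup>+t. indicator {0..R} t \<partial>lborel)"
  proof (subst nn_integral_radial_measure, measurable, rule nn_integral_mono)
    fix t :: real
    show "indicator {0<..} t * (ennreal (t ^ (DIM('a) - 1)) * radial_weight R (t *\<^sub>R u)) \<le> indicator {0..R} t"
    proof (cases "0 < t \<and> t \<le> R")
      case True
      have "ennreal (t ^ (DIM('a) - 1)) * ennreal (1 / t ^ (DIM('a) - 1)) = 1"
        using True by (subst ennreal_mult[symmetric]) auto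
      then show ?thesis using True assms by (simp add: radial_weight_def)
    qed (use assms in \<open>auto simp: radial_weight_def indicator_def\<close>)
  qed
  then show ?thesis using assms by simp
qed

lemma nn_integral_radial_weight_finite:
  assumes dim: "DIM('a::euclidean_space) \<ge> 2" and R: "0 \<le> R"
  shows "(\<integral>\<^sup>+x. radial_weight R (x::'a) \<partial>lborel) < \<infinity>"
proof -
  interpret finite_measure "surface (sphere (0::'a) 1)" by (rule finite_surface_sphere[OF dim])
  have "ennreal (slice_const TYPE('a)) * (\<integral>\<^sup>+x. radial_weight R (x::'a) \<partial>lborel)
      = (\<integral>\<^sup>+u. \<integral>\<^sup>+t. radial_weight R (t *\<^sub>R u) \<partial>radial_measure DIM('a) \<partial>surface (sphere (0::'a) 1))"
    by (rule polar_coordinates[OF dim, symmetric]) measurable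
  also have "\<dots> \<le> (\<integral>\<^sup>+u. ennreal R \<partial>surface (sphere (0::'a) 1))"
    by (intro nn_integral_mono_AE eventually_mono[OF AE_hausdorff_within[OF borel_closed[OF closed_sphere]]]
        nn_integral_radial_weight_ray_le R) simp
  also have "\<dots> < \<infinity>" using emeasure_finite[of UNIV, unfolded infinity_ennreal_def] by (simp add: ennreal_mult_eq_top_iff less_top[symmetric])
  finally show ?thesis using slice_const_pos(1)[OF dim] by (auto simp: ennreal_mult_less_top)
qed

lemma inverse_power_le_nn_integral_radial_weight:
  fixes z e :: "'a::euclidean_space"
  assumes dim: "DIM('a) \<ge> 2" and e: "norm e = 1" and z: "z \<noteq> 0" "z \<bullet> e = 0" "norm z \<le> R"
  shows "ennreal (1 / norm z ^ (DIM('a) - 2))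
    \<le> ennreal (2 ^ (DIM('a) - 1)) * (\<integral>\<^sup>+t. radial_weight (2 * R) (z + t *\<^sub>R e) \<partial>lborel)"
proof -
  let ?m = "DIM('a) - 1"
  have "?m = Suc (DIM('a) - 2)" using dim by simp
  then have "1 / norm z ^ (DIM('a) - 2) = 2 ^ ?m * (1 / (2 * norm z) ^ ?m * norm z)"
    using z(1) by (simp add: power_mult_distrib)
  also have "ennreal \<dots> = ennreal (2 ^ ?m) * (ennreal (1 / (2 * norm z) ^ ?m) * ennreal (norm z))"
    unfolding mult.assoc by (simp only: ennreal_mult'' norm_ge_zero ennreal_mult' zero_le_power zero_le_numeral)
  also have "ennreal (1 / (2 * norm z) ^ ?m) * ennreal (norm z)
      = (\<integral>\<^sup>+t. ennreal (1 / (2 * norm z) ^ ?m) * indicator {0..norm z} t \<partial>lborel)"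
    by (subst nn_integral_cmult) auto
  also have "\<dots> \<le> (\<integral>\<^sup>+t. radial_weight (2 * R) (z + t *\<^sub>R e) \<partial>lborel)"
  proof (rule nn_integral_mono)
    fix t :: real
    show "ennreal (1 / (2 * norm z) ^ ?m) * indicator {0..norm z} t \<le> radial_weight (2 * R) (z + t *\<^sub>R e)"
    proof (cases "t \<in> {0..norm z}")
      case t: True
      have norm_le: "norm (z + t *\<^sub>R e) \<le> 2 * norm z" using norm_triangle_ineq[of z "t *\<^sub>R e"] e t by simp
      have "(z + t *\<^sub>R e) \<bullet> z = z \<bullet> z" using z(2) by (simp add: inner_add_left inner_commute[of e z])
      then have "z + t *\<^sub>R e \<noteq> 0" using z(1) by auto
      then have "1 / (2 * norm z) ^ ?m \<le> 1 / norm (z + t *\<^sub>R e) ^ ?m"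
        using norm_le z(1) by (intro divide_left_mono power_mono mult_pos_pos) auto
      then show ?thesis using t norm_le z(3) by (simp add: radial_weight_def ennreal_leI)
    qed simp
  qed
  finally show ?thesis by (simp add: mult_left_mono)
qed

context smooth_body
begin

lemma norm_diff_le_diameter: "x \<in> K \<Longrightarrow> y \<in> K \<Longrightarrow> norm (x - y) \<le> diameter K"
  using diameter_bounded_bound[OF compact_imp_bounded[OF compact_K]] by (simp add: dist_norm)

lemma continuous_bounded_on_distances:
  fixes q :: "real \<Rightarrow> real"
  assumes "continuous_on UNIV q"
  obtains Q where "\<And>x y. x \<in> K \<Longrightarrow> y \<in> K \<Longrightarrow> \<bar>q (norm (x - y))\<bar> \<le> Q"
proof -
  have "compact (q ` {0..diameter K})"
    by (intro compact_continuous_image continuous_on_subset[OF assms]) auto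
  then obtain Q where "\<And>r. r \<in> {0..diameter K} \<Longrightarrow> \<bar>q r\<bar> \<le> Q"
    using compact_imp_bounded by (fastforce simp: bounded_iff)
  then show ?thesis using norm_diff_le_diameter by (intro that[of Q]) simp
qed

lemma integrable_indicator_of_singular_bound:
  fixes f :: "'a \<Rightarrow> real"
  assumes f [measurable]: "f \<in> borel_measurable borel" and p: "p \<in> K"
    and bound: "\<And>x. x \<in> K \<Longrightarrow> \<bar>f x\<bar> \<le> A / norm (x - p) ^ (DIM('a) - 1)"
  shows "integrable lborel (\<lambda>x. indicator K x * f x)"
proof (rule integrableI_bounded)
  have "ennreal (norm (indicator K x * f x)) \<le> ennreal \<bar>A\<bar> * radial_weight (diameter K) (- p + x)" for x
  proof (cases "x \<in> K")
    case True
    then have "\<bar>f x\<bar> \<le> \<bar>A\<bar> * (1 / norm (x - p) ^ (DIM('a) - 1))"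
      using order_trans[OF bound divide_right_mono[OF abs_ge_self]] by simp
    then have "ennreal \<bar>f x\<bar> \<le> ennreal \<bar>A\<bar> * ennreal (1 / norm (x - p) ^ (DIM('a) - 1))"
      by (subst ennreal_mult[symmetric]) (auto intro: ennreal_leI)
    then show ?thesis using True norm_diff_le_diameter[OF True p] by (simp add: radial_weight_def)
  qed simp
  then have "(\<integral>\<^sup>+x. ennreal (norm (indicator K x * f x)) \<partial>lborel)
      \<le> (\<integral>\<^sup>+x. ennreal \<bar>A\<bar> * radial_weight (diameter K) (- p + x) \<partial>lborel)"
    by (rule nn_integral_mono)
  also have "\<dots> = ennreal \<bar>A\<bar> * (\<integral>\<^sup>+x. radial_weight (diameter K) (x::'a) \<partial>lborel)"
    using nn_integral_translate[OF translation_invariant_lborel, of "radial_weight (diameter K)" "- p"]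
    by (simp add: nn_integral_cmult)
  also have "\<dots> < \<infinity>"
    using nn_integral_radial_weight_finite[OF dim diameter_ge_0[OF compact_imp_bounded[OF compact_K]]]
    by (simp add: ennreal_mult_less_top)
  finally show "(\<integral>\<^sup>+x. ennreal (norm (indicator K x * f x)) \<partial>lborel) < \<infinity>" .
qed measurable

lemma inverse_power_top_point_le:
  assumes p: "p \<in> K" and e: "norm e = 1" and y: "y \<in> shadow e" "y \<noteq> proj_perp e p"
  shows "ennreal (1 / norm (top_point e y - p) ^ (DIM('a) - 2))
    \<le> ennreal (2 ^ (DIM('a) - 1)) * (\<integral>\<^sup>+t. radial_weight (2 * diameter K) (- proj_perp e p + y + t *\<^sub>R e) \<partial>lborel)"
proof -
  let ?z = "- proj_perp e p + y"
  have z: "?z \<noteq> 0" "?z \<bullet> e = 0"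
    using y proj_perp_inner[OF e, of p] by (auto simp: inner_diff_left shadow_def)
  have "proj_perp e (top_point e y - p) = ?z"
    using top_point_shadow(3)[OF e y(1)] by (simp add: proj_perp_diff)
  then have norm_le: "norm ?z \<le> norm (top_point e y - p)" using norm_proj_perp_le[OF e] by metis
  then have "ennreal (1 / norm (top_point e y - p) ^ (DIM('a) - 2)) \<le> ennreal (1 / norm ?z ^ (DIM('a) - 2))"
    using z(1) less_le_trans[OF _ norm_le] by (intro ennreal_leI divide_left_mono power_mono mult_pos_pos zero_less_power) auto
  also have "top_point e y \<in> K" using top_point_shadow(1)[OF e y(1)] S_subset by auto
  then have "norm ?z \<le> diameter K" using norm_le norm_diff_le_diameter[OF _ p] order_trans by blast
  note inverse_power_le_nn_integral_radial_weight[OF dim e z this]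
  finally show ?thesis .
qed

lemma nn_integral_projection_inverse_power_le:
  assumes p: "p \<in> K" and e: "norm e = 1"
  shows "(\<integral>\<^sup>+x. ennreal (n x \<bullet> e) * ennreal (1 / norm (x - p) ^ (DIM('a) - 2)) \<partial>surface S)
    \<le> ennreal (2 ^ (DIM('a) - 1) * slice_const TYPE('a)) * (\<integral>\<^sup>+x. radial_weight (2 * diameter K) (x::'a) \<partial>lborel)"
proof -
  note [measurable] = top_point_measurable[OF e]
  let ?d = "DIM('a)" and ?q = "proj_perp e p" and ?w = "radial_weight (2 * diameter K) :: 'a \<Rightarrow> _"
  have "(\<integral>\<^sup>+x. ennreal (n x \<bullet> e) * ennreal (1 / norm (x - p) ^ (?d - 2)) \<partial>surface S)
     = (\<integral>\<^sup>+y. indicator (shadow e) y * ennreal (1 / norm (top_point e y - p) ^ (?d - 2)) \<partial>surface (hplane e))"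
    by (rule nn_integral_projection[OF e]) measurable
  also have "\<dots> \<le> (\<integral>\<^sup>+y. ennreal (2 ^ (?d - 1)) * (\<integral>\<^sup>+t. ?w (- ?q + y + t *\<^sub>R e) \<partial>lborel) \<partial>surface (hplane e))"
  proof (rule nn_integral_mono_AE, use AE_hausdorff_within_neq[where p="?q", OF hplane_borel] in eventually_elim)
    case (elim y)
    then show ?case using inverse_power_top_point_le[OF p e _ elim] by (cases "y \<in> shadow e") simp_all
  qed
  also have "\<dots> = ennreal (2 ^ (?d - 1)) * (\<integral>\<^sup>+y. \<integral>\<^sup>+t. ?w (- ?q + y + t *\<^sub>R e) \<partial>lborel \<partial>surface (hplane e))"
    by (rule nn_integral_cmult) measurable
  also have "(\<integral>\<^sup>+y. \<integral>\<^sup>+t. ?w (- ?q + y + t *\<^sub>R e) \<partial>lborel \<partial>surface (hplane e))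
      = (\<integral>\<^sup>+y. \<integral>\<^sup>+t. ?w (y + t *\<^sub>R e) \<partial>lborel \<partial>surface (hplane e))"
    by (intro nn_integral_surface_hplane_translate) (simp_all add: proj_perp_inner[OF e])
  also have "\<dots> = ennreal (slice_const TYPE('a)) * (\<integral>\<^sup>+x. ?w x \<partial>lborel)"
    by (rule nn_integral_slices_eq_lborel[OF e dim]) measurable
  finally show ?thesis using slice_const_pos(1)[OF dim] by (simp add: ennreal_mult mult.assoc)
qed

lemma nn_integral_inverse_power_bounded:
  obtains C where "0 \<le> C"
    "\<And>p. p \<in> K \<Longrightarrow> (\<integral>\<^sup>+x. ennreal (1 / norm (x - p) ^ (DIM('a) - 2)) \<partial>surface S) \<le> ennreal C"
proof -
  let ?A = "ennreal (2 ^ (DIM('a) - 1) * slice_const TYPE('a)) * (\<integral>\<^sup>+x. radial_weight (2 * diameter K) (x::'a) \<partial>lborel)"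
  let ?B = "\<Sum>b\<in>(Basis::'a set). ?A + ?A"
  have "?B < \<infinity>"
    using nn_integral_radial_weight_finite[OF dim, of "2 * diameter K"] diameter_ge_0[OF compact_imp_bounded[OF compact_K]]
    by (simp add: ennreal_mult_less_top of_nat_less_top)
  then obtain C where C: "0 \<le> C" "?B = ennreal C" by (cases ?B) auto
  show ?thesis
  proof (rule that[OF C(1)])
    fix p assume p: "p \<in> K"
    let ?w = "\<lambda>x. ennreal (1 / norm (x - p) ^ (DIM('a) - 2))"
    have "(\<integral>\<^sup>+x. ?w x \<partial>surface S)
        \<le> (\<Sum>b\<in>Basis. (\<integral>\<^sup>+x. ennreal (n x \<bullet> b) * ?w x \<partial>surface S) + (\<integral>\<^sup>+x. ennreal (n x \<bullet> (- b)) * ?w x \<partial>surface S))"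
      by (rule nn_integral_surface_le_projections) measurable
    also have "\<dots> \<le> ?B"
      by (intro sum_mono add_mono nn_integral_projection_inverse_power_le p) auto
    finally show "(\<integral>\<^sup>+x. ?w x \<partial>surface S) \<le> ennreal C" unfolding C(2) .
  qed
qed

lemma integrable_surface_inverse_power:
  assumes "p \<in> K"
  shows "integrable (surface S) (\<lambda>x. A / norm (x - p) ^ (DIM('a) - 2))"
proof -
  obtain C where C: "(\<integral>\<^sup>+x. ennreal (1 / norm (x - p) ^ (DIM('a) - 2)) \<partial>surface S) \<le> ennreal C"
    using nn_integral_inverse_power_bounded assms by blast
  have "integrable (surface S) (\<lambda>x. 1 / norm (x - p) ^ (DIM('a) - 2))"
  proof (rule integrableI_bounded)
    show "(\<integral>\<^sup>+x. ennreal (norm (1 / norm (x - p) ^ (DIM('a) - 2))) \<partial>surface S) < \<infinity>"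
      using order_le_less_trans[OF C ennreal_less_top] by simp
  qed measurable
  from integrable_mult_right[OF this, of A] show ?thesis by simp
qed

lemma integrable_surface_of_singular_bound:
  fixes f :: "'a \<Rightarrow> 'b::{banach, second_countable_topology}"
  assumes f [measurable]: "f \<in> borel_measurable borel" and p: "p \<in> K"
    and bound: "\<And>x. x \<in> S \<Longrightarrow> norm (f x) \<le> A / norm (x - p) ^ (DIM('a) - 2)"
  shows "integrable (surface S) f"
proof (rule Bochner_Integration.integrable_bound[OF integrable_surface_inverse_power[OF p]])
  show "AE x in surface S. norm (f x) \<le> norm (A / norm (x - p) ^ (DIM('a) - 2))"
    using AE_hausdorff_within[OF S_borel] by eventually_elim (metis bound abs_ge_self order_trans real_norm_def)
qed measurable

end

section \<open>The flux of a field orthogonal to the chord\<close>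

definition transverse_field :: "(real \<Rightarrow> real) \<Rightarrow> 'a::euclidean_space \<Rightarrow> 'a \<Rightarrow> 'a" where
  "transverse_field \<phi> m z = \<phi> (norm z) *\<^sub>R proj_perp (sgn z) m"

definition transverse_field_deriv :: "(real \<Rightarrow> real) \<Rightarrow> (real \<Rightarrow> real) \<Rightarrow> 'a::euclidean_space \<Rightarrow> 'a \<Rightarrow> 'a \<Rightarrow> real" where
  "transverse_field_deriv \<phi> \<phi>' m b z =
    \<phi>' (norm z) * (b \<bullet> sgn z) * (proj_perp (sgn z) m \<bullet> b)
    - \<phi> (norm z) / norm z * ((m \<bullet> sgn z) * (proj_perp (sgn z) b \<bullet> b) + (m \<bullet> proj_perp (sgn z) b) * (sgn z \<bullet> b))"

lemma transverse_field_measurable [measurable]: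
  assumes [measurable]: "\<phi> \<in> borel_measurable borel" "\<phi>' \<in> borel_measurable borel"
  shows "transverse_field \<phi> m \<in> borel_measurable borel" "transverse_field_deriv \<phi> \<phi>' m b \<in> borel_measurable borel"
  unfolding transverse_field_def transverse_field_deriv_def proj_perp_def by measurable

lemma transverse_field_has_derivative:
  fixes z m b :: "'a::euclidean_space"
  assumes z: "z \<noteq> 0" and \<phi>: "(\<phi> has_real_derivative \<phi>' (norm z)) (at (norm z))"
  shows "((\<lambda>t. transverse_field \<phi> m (z + t *\<^sub>R b) \<bullet> b) has_real_derivative transverse_field_deriv \<phi> \<phi>' m b z) (at 0)"
proof -
  note sgn = has_derivative_sgn_vec[OF z]
  have "((\<lambda>z. m \<bullet> b - (m \<bullet> sgn z) * (sgn z \<bullet> b)) has_derivative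
      (\<lambda>v. 0 - ((m \<bullet> sgn z) * ((proj_perp (sgn z) v /\<^sub>R norm z) \<bullet> b) + (m \<bullet> (proj_perp (sgn z) v /\<^sub>R norm z)) * (sgn z \<bullet> b)))) (at z)"
    by (intro has_derivative_diff has_derivative_const has_derivative_mult
        has_derivative_inner_left has_derivative_inner_right sgn)
  moreover have "((\<lambda>z. \<phi> (norm z)) has_derivative (\<lambda>v. (v \<bullet> sgn z) * \<phi>' (norm z))) (at z)"
    by (rule DERIV_compose_FDERIV[OF \<phi> has_derivative_norm[OF z]])
  ultimately have "((\<lambda>z. \<phi> (norm z) * (m \<bullet> b - (m \<bullet> sgn z) * (sgn z \<bullet> b))) has_derivative
      (\<lambda>v. \<phi> (norm z) * (0 - ((m \<bullet> sgn z) * ((proj_perp (sgn z) v /\<^sub>R norm z) \<bullet> b) + (m \<bullet> (proj_perp (sgn z) v /\<^sub>R norm z)) * (sgn z \<bullet> b)))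
        + (v \<bullet> sgn z) * \<phi>' (norm z) * (m \<bullet> b - (m \<bullet> sgn z) * (sgn z \<bullet> b)))) (at z)"
    by (intro has_derivative_mult)
  from has_real_derivative_along_line[OF this, of b] show ?thesis
    by (simp add: transverse_field_def transverse_field_deriv_def proj_perp_def inner_diff_left inner_diff_right
        divide_inverse algebra_simps)
qed

text \<open>The field is orthogonal to \<open>z\<close>, so that \<open>\<phi>'\<close> drops out of its divergence; this is why no second derivative
  of \<open>h\<close> shows up in the end.\<close>

lemma sum_transverse_field_deriv:
  fixes z m :: "'a::euclidean_space"
  shows "(\<Sum>b\<in>Basis. transverse_field_deriv \<phi> \<phi>' m b z) = - (real DIM('a) - 1) * (\<phi> (norm z) / norm z * (m \<bullet> sgn z))"
proof (cases "z = 0")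
  case False
  let ?u = "sgn z"
  have u: "norm ?u = 1" using False by (simp add: norm_sgn)
  have "(\<Sum>b\<in>Basis. (b \<bullet> ?u) * (proj_perp ?u m \<bullet> b)) = ?u \<bullet> proj_perp ?u m"
    by (subst euclidean_inner) (simp add: inner_commute)
  also have "\<dots> = 0" using proj_perp_inner[OF u, of m] by (simp add: inner_commute)
  finally have radial: "(\<Sum>b\<in>Basis. (b \<bullet> ?u) * (proj_perp ?u m \<bullet> b)) = 0" .
  have "(\<Sum>b\<in>Basis. (m \<bullet> proj_perp ?u b) * (?u \<bullet> b)) = m \<bullet> proj_perp ?u (\<Sum>b\<in>Basis. (?u \<bullet> b) *\<^sub>R b)"
    by (simp add: proj_perp_def inner_diff_right inner_sum_right inner_sum_left sum_subtractf sum_distrib_left sum_distrib_right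
        algebra_simps)
  also have "\<dots> = 0" using u by (simp add: euclidean_representation proj_perp_def dot_square_norm)
  finally have mixed: "(\<Sum>b\<in>Basis. (m \<bullet> proj_perp ?u b) * (?u \<bullet> b)) = 0" .
  have "proj_perp ?u b \<bullet> b = 1 - (?u \<bullet> b) * (?u \<bullet> b)" if "b \<in> Basis" for b
    using that by (simp add: proj_perp_def inner_diff_left inner_commute[of b ?u])
  then have "(\<Sum>b\<in>Basis. proj_perp ?u b \<bullet> b) = real DIM('a) - (\<Sum>b\<in>Basis. (?u \<bullet> b) * (?u \<bullet> b))"
    by (simp add: sum_subtractf)
  also have "(\<Sum>b\<in>Basis. (?u \<bullet> b) * (?u \<bullet> b)) = 1"
    using u euclidean_inner[of ?u ?u] by (simp add: dot_square_norm)
  finally have trace: "(\<Sum>b\<in>Basis. proj_perp ?u b \<bullet> b) = real DIM('a) - 1" .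
  have "(\<Sum>b\<in>Basis. transverse_field_deriv \<phi> \<phi>' m b z)
      = \<phi>' (norm z) * (\<Sum>b\<in>Basis. (b \<bullet> ?u) * (proj_perp ?u m \<bullet> b))
        - \<phi> (norm z) / norm z * ((m \<bullet> ?u) * (\<Sum>b\<in>Basis. proj_perp ?u b \<bullet> b) + (\<Sum>b\<in>Basis. (m \<bullet> proj_perp ?u b) * (?u \<bullet> b)))"
    by (simp only: transverse_field_deriv_def sum_distrib_left sum_subtractf sum.distrib distrib_left mult.assoc)
  also have "\<dots> = - (real DIM('a) - 1) * (\<phi> (norm z) / norm z * (m \<bullet> sgn z))"
    unfolding radial mixed trace by (simp add: divide_inverse algebra_simps)
  finally show ?thesis .
qed (simp add: transverse_field_deriv_def)

lemma norm_sgn_le: "norm (sgn z) \<le> (1::real)" for z :: "'a::real_normed_vector"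
  by (simp add: norm_sgn)

lemma norm_proj_perp_sgn_le: "norm (proj_perp (sgn z) m) \<le> norm m" for z :: "'a::euclidean_space"
  by (cases "z = 0") (simp_all add: proj_perp_def[of 0] norm_proj_perp_le norm_sgn)

lemma norm_transverse_field_le:
  assumes "norm m \<le> 1"
  shows "norm (transverse_field \<phi> m z) \<le> \<bar>\<phi> (norm z)\<bar>"
  using mult_left_mono[OF order_trans[OF norm_proj_perp_sgn_le assms], of "\<bar>\<phi> (norm z)\<bar>"] by (simp add: transverse_field_def)

lemma abs_transverse_field_deriv_le:
  assumes m: "norm m \<le> 1" and b: "norm b = 1"
  shows "\<bar>transverse_field_deriv \<phi> \<phi>' m b z\<bar> \<le> \<bar>\<phi>' (norm z)\<bar> + 2 * (\<bar>\<phi> (norm z)\<bar> / norm z)"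
proof -
  let ?u = "sgn z"
  have inner_le: "\<bar>v \<bullet> w\<bar> \<le> 1" if "norm v \<le> 1" "norm w \<le> 1" for v w :: 'a
    using order_trans[OF Cauchy_Schwarz_ineq2 mult_le_one[OF that(1) norm_ge_zero that(2)]] .
  have unit: "norm b \<le> 1" "norm ?u \<le> 1" "norm (proj_perp ?u m) \<le> 1" "norm (proj_perp ?u b) \<le> 1"
    using m b norm_proj_perp_sgn_le[of z m] norm_proj_perp_sgn_le[of z b] by (simp_all add: norm_sgn_le)
  have product_le: "\<bar>s * t\<bar> \<le> 1" if "\<bar>s\<bar> \<le> 1" "\<bar>t\<bar> \<le> 1" for s t :: real
    using that by (simp add: abs_mult mult_le_one)
  have radial: "\<bar>(b \<bullet> ?u) * (proj_perp ?u m \<bullet> b)\<bar> \<le> 1"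
    by (intro product_le inner_le unit)
  have "\<bar>(m \<bullet> ?u) * (proj_perp ?u b \<bullet> b)\<bar> \<le> 1" "\<bar>(m \<bullet> proj_perp ?u b) * (?u \<bullet> b)\<bar> \<le> 1"
    by (intro product_le inner_le unit m)+
  then have angular: "\<bar>(m \<bullet> ?u) * (proj_perp ?u b \<bullet> b) + (m \<bullet> proj_perp ?u b) * (?u \<bullet> b)\<bar> \<le> 2"
    by linarith
  have "\<bar>transverse_field_deriv \<phi> \<phi>' m b z\<bar>
      \<le> \<bar>\<phi>' (norm z)\<bar> * \<bar>(b \<bullet> ?u) * (proj_perp ?u m \<bullet> b)\<bar>
        + \<bar>\<phi> (norm z)\<bar> / norm z * \<bar>(m \<bullet> ?u) * (proj_perp ?u b \<bullet> b) + (m \<bullet> proj_perp ?u b) * (?u \<bullet> b)\<bar>"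
    unfolding transverse_field_deriv_def mult.assoc
    by (rule order_trans[OF abs_triangle_ineq4]) (simp add: abs_mult)
  also have "\<dots> \<le> \<bar>\<phi>' (norm z)\<bar> * 1 + \<bar>\<phi> (norm z)\<bar> / norm z * 2"
    by (intro add_mono mult_left_mono radial angular) auto
  finally show ?thesis by (simp only: mult_1_right mult.commute[of _ 2])
qed

lemma has_real_derivative_divide_power:
  fixes q :: "real \<Rightarrow> real"
  assumes "(q has_real_derivative q') (at r)" "r \<noteq> 0"
  shows "((\<lambda>r. q r / r ^ k) has_real_derivative q' / r ^ k - real k * q r / r ^ Suc k) (at r)"
proof -
  have "((\<lambda>r. q r / r ^ k) has_real_derivative (q' * r ^ k - q r * (real k * r ^ (k - 1))) / (r ^ k * r ^ k)) (at r)"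
    using assms by (auto intro!: derivative_eq_intros)
  also have "(q' * r ^ k - q r * (real k * r ^ (k - 1))) / (r ^ k * r ^ k) = q' / r ^ k - real k * q r / r ^ Suc k"
    using assms(2) by (cases k) (simp_all add: field_simps)
  finally show ?thesis .
qed

lemma abs_transverse_field_deriv_divide_power_le:
  assumes mb: "norm m \<le> 1" "norm b = 1" and q: "\<bar>q (norm z)\<bar> \<le> Q" "\<bar>q' (norm z)\<bar> \<le> Q'" and R: "norm z \<le> R"
  shows "\<bar>transverse_field_deriv (\<lambda>r. q r / r ^ k) (\<lambda>r. q' r / r ^ k - real k * q r / r ^ Suc k) m b z\<bar>
    \<le> (Q' * R + (real k + 2) * Q) / norm z ^ Suc k"
proof (cases "z = 0")
  case False
  let ?r = "norm z"
  have r: "0 < ?r" using False by simp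
  have "0 \<le> Q'" using q by linarith
  then have "\<bar>q' ?r\<bar> * ?r \<le> Q' * R" using q R by (intro mult_mono) auto
  moreover have "(real k + 2) * \<bar>q ?r\<bar> \<le> (real k + 2) * Q" using q by (intro mult_left_mono) auto
  ultimately have numerator_le: "\<bar>q' ?r\<bar> * ?r + (real k + 2) * \<bar>q ?r\<bar> \<le> Q' * R + (real k + 2) * Q" by (rule add_mono)
  have "\<bar>q' ?r / ?r ^ k - real k * q ?r / ?r ^ Suc k\<bar> + 2 * (\<bar>q ?r / ?r ^ k\<bar> / ?r)
      \<le> \<bar>q' ?r\<bar> / ?r ^ k + real k * \<bar>q ?r\<bar> / ?r ^ Suc k + 2 * (\<bar>q ?r\<bar> / ?r ^ k / ?r)"
    using abs_triangle_ineq4[of "q' ?r / ?r ^ k" "real k * q ?r / ?r ^ Suc k"] by (simp add: abs_mult abs_divide)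
  also have "\<dots> = (\<bar>q' ?r\<bar> * ?r + (real k + 2) * \<bar>q ?r\<bar>) / ?r ^ Suc k"
    using r by (simp add: field_simps)
  also have "\<dots> \<le> (Q' * R + (real k + 2) * Q) / ?r ^ Suc k" using numerator_le by (rule divide_right_mono) simp
  finally show ?thesis using abs_transverse_field_deriv_le[OF mb] by (rule order_trans[rotated])
qed (simp add: transverse_field_deriv_def)

context smooth_body
begin

definition chord_kernel :: "(real \<Rightarrow> real) \<Rightarrow> 'a \<Rightarrow> 'a \<Rightarrow> real" where
  "chord_kernel q p x = transverse_field (\<lambda>r. q r / r ^ (DIM('a) - 2)) (n p) (x - p) \<bullet> n x"

definition volume_kernel :: "(real \<Rightarrow> real) \<Rightarrow> 'a \<Rightarrow> 'a \<Rightarrow> real" where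
  "volume_kernel q p x = q (norm (x - p)) / norm (x - p) ^ (DIM('a) - 1) * (n p \<bullet> sgn (x - p))"

lemma abs_chord_kernel_le:
  assumes "\<bar>q (norm (x - p))\<bar> \<le> Q"
  shows "\<bar>chord_kernel q p x\<bar> \<le> Q / norm (x - p) ^ (DIM('a) - 2)"
proof -
  have "\<bar>chord_kernel q p x\<bar> \<le> \<bar>q (norm (x - p)) / norm (x - p) ^ (DIM('a) - 2)\<bar>"
    unfolding chord_kernel_def inner_commute[of _ "n x"]
    by (rule order_trans[OF abs_normal_inner_le norm_transverse_field_le[OF norm_normal_le]])
  also have "\<dots> \<le> Q / norm (x - p) ^ (DIM('a) - 2)"
    using divide_right_mono[OF assms] by (simp add: abs_divide)
  finally show ?thesis .
qed

lemma abs_volume_kernel_le: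
  assumes "\<bar>q (norm (x - p))\<bar> \<le> Q"
  shows "\<bar>volume_kernel q p x\<bar> \<le> Q / norm (x - p) ^ (DIM('a) - 1)"
proof -
  have "\<bar>volume_kernel q p x\<bar> \<le> \<bar>q (norm (x - p))\<bar> / norm (x - p) ^ (DIM('a) - 1) * 1"
    unfolding volume_kernel_def abs_mult abs_divide
    using order_trans[OF abs_normal_inner_le norm_sgn_le] by (intro mult_mono) auto
  also have "\<dots> \<le> Q / norm (x - p) ^ (DIM('a) - 1)"
    using divide_right_mono[OF assms] by simp
  finally show ?thesis .
qed

lemma chord_kernel_measurable [measurable]:
  assumes [measurable]: "q \<in> borel_measurable borel"
  shows "(\<lambda>(p, x). chord_kernel q p x) \<in> borel_measurable (borel \<Otimes>\<^sub>M borel)" "chord_kernel q p \<in> borel_measurable borel"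
  unfolding chord_kernel_def transverse_field_def proj_perp_def by measurable

lemma volume_kernel_measurable [measurable]:
  assumes [measurable]: "q \<in> borel_measurable borel"
  shows "volume_kernel q p \<in> borel_measurable borel"
  unfolding volume_kernel_def by measurable

lemma integrable_transverse_field_deriv:
  assumes p: "p \<in> K" and q: "continuous_on UNIV q" "continuous_on UNIV q'" and mb: "norm m \<le> 1" "norm b = 1"
  shows "integrable lborel (\<lambda>x. indicator K x * transverse_field_deriv (\<lambda>r. q r / r ^ (DIM('a) - 2))
    (\<lambda>r. q' r / r ^ (DIM('a) - 2) - real (DIM('a) - 2) * q r / r ^ Suc (DIM('a) - 2)) m b (x - p))"
    (is "integrable lborel (\<lambda>x. indicator K x * ?V x)")
proof -
  have [measurable]: "q \<in> borel_measurable borel" "q' \<in> borel_measurable borel"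
    using q by (auto intro: borel_measurable_continuous_onI)
  obtain Q where Q: "\<And>x y. x \<in> K \<Longrightarrow> y \<in> K \<Longrightarrow> \<bar>q (norm (x - y))\<bar> \<le> Q" by (rule continuous_bounded_on_distances[OF q(1)]) blast
  obtain Q' where Q': "\<And>x y. x \<in> K \<Longrightarrow> y \<in> K \<Longrightarrow> \<bar>q' (norm (x - y))\<bar> \<le> Q'" by (rule continuous_bounded_on_distances[OF q(2)]) blast
  have Suc: "DIM('a) - 1 = Suc (DIM('a) - 2)" using dim by simp
  show ?thesis
  proof (rule integrable_indicator_of_singular_bound[OF _ p])
    fix x assume "x \<in> K"
    then show "\<bar>?V x\<bar> \<le> (Q' * diameter K + (real (DIM('a) - 2) + 2) * Q) / norm (x - p) ^ (DIM('a) - 1)"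
      unfolding Suc using p by (intro abs_transverse_field_deriv_divide_power_le mb Q Q' norm_diff_le_diameter)
  qed measurable
qed

lemma integrable_transverse_field:
  assumes p: "p \<in> K" and q: "continuous_on UNIV q" and m: "norm m \<le> 1"
  shows "integrable (surface S) (\<lambda>x. transverse_field (\<lambda>r. q r / r ^ (DIM('a) - 2)) m (x - p))"
    (is "integrable _ ?V")
proof -
  have [measurable]: "q \<in> borel_measurable borel" using q by (rule borel_measurable_continuous_onI)
  obtain Q where Q: "\<And>x y. x \<in> K \<Longrightarrow> y \<in> K \<Longrightarrow> \<bar>q (norm (x - y))\<bar> \<le> Q" by (rule continuous_bounded_on_distances[OF q]) blast
  show ?thesis
  proof (rule integrable_surface_of_singular_bound[OF _ p])
    fix x assume "x \<in> S"
    then have "x \<in> K" using S_subset by auto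
    then show "norm (?V x) \<le> Q / norm (x - p) ^ (DIM('a) - 2)"
      using divide_right_mono[OF Q[OF _ p], of x "norm (x - p) ^ (DIM('a) - 2)"]
        norm_transverse_field_le[OF m, of "\<lambda>r. q r / r ^ (DIM('a) - 2)" "x - p"]
      by (simp add: abs_divide)
  qed measurable
qed

lemma chord_flux_of_derivative:
  assumes p: "p \<in> S" and q: "\<And>r. (q has_real_derivative q' r) (at r)" and q': "continuous_on UNIV q'"
  shows "(\<integral>x. chord_kernel q p x \<partial>surface S)
    = - (real DIM('a) - 1) * slice_const TYPE('a) * (\<integral>x. indicator K x * volume_kernel q p x \<partial>lborel)"
proof -
  let ?m = "DIM('a) - 2"
  have pK: "p \<in> K" using p S_subset by auto
  have Suc: "DIM('a) - 1 = Suc ?m" using dim by simp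
  have cont: "continuous_on UNIV q" using q by (meson DERIV_isCont continuous_at_imp_continuous_on)
  have [measurable]: "q \<in> borel_measurable borel" "q' \<in> borel_measurable borel"
    using cont q' by (auto intro: borel_measurable_continuous_onI)
  define \<phi> where "\<phi> = (\<lambda>r. q r / r ^ ?m)"
  define \<phi>' where "\<phi>' = (\<lambda>r. q' r / r ^ ?m - real ?m * q r / r ^ Suc ?m)"
  have [measurable]: "\<phi> \<in> borel_measurable borel" "\<phi>' \<in> borel_measurable borel" unfolding \<phi>_def \<phi>'_def by measurable
  have "(\<integral>x. chord_kernel q p x \<partial>surface S) = (\<integral>x. transverse_field \<phi> (n p) (x - p) \<bullet> n x \<partial>surface S)"
    by (simp add: chord_kernel_def \<phi>_def)
  also have "\<dots> = slice_const TYPE('a) * (\<integral>x. indicator K x * (\<Sum>b\<in>Basis. transverse_field_deriv \<phi> \<phi>' (n p) b (x - p)) \<partial>lborel)"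
  proof (rule divergence_theorem[where p=p])
    fix b x :: 'a assume "b \<in> Basis" "x \<noteq> p"
    then have "(\<phi> has_real_derivative \<phi>' (norm (x - p))) (at (norm (x - p)))"
      unfolding \<phi>_def \<phi>'_def by (intro has_real_derivative_divide_power q) simp
    from transverse_field_has_derivative[of "x - p" \<phi> \<phi>', OF _ this, of "n p" b] \<open>x \<noteq> p\<close>
    show "((\<lambda>t. transverse_field \<phi> (n p) (x + t *\<^sub>R b - p) \<bullet> b) has_real_derivative transverse_field_deriv \<phi> \<phi>' (n p) b (x - p)) (at 0)"
      by (simp add: algebra_simps)
  next
    show "integrable lborel (\<lambda>x. indicator K x * transverse_field_deriv \<phi> \<phi>' (n p) b (x - p))" if "b \<in> Basis" for b
      unfolding \<phi>_def \<phi>'_def using that by (intro integrable_transverse_field_deriv pK cont q' norm_normal_le) simp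
    show "integrable (surface S) (\<lambda>x. transverse_field \<phi> (n p) (x - p))"
      unfolding \<phi>_def by (intro integrable_transverse_field pK cont norm_normal_le)
  qed measurable
  also have "\<dots> = slice_const TYPE('a) * (\<integral>x. - (real DIM('a) - 1) * (indicator K x * volume_kernel q p x) \<partial>lborel)"
    unfolding sum_transverse_field_deriv volume_kernel_def \<phi>_def Suc power_Suc by (simp add: mult_ac)
  also have "(\<integral>x. - (real DIM('a) - 1) * (indicator K x * volume_kernel q p x) \<partial>lborel)
      = - (real DIM('a) - 1) * (\<integral>x. indicator K x * volume_kernel q p x \<partial>lborel)"
    by (rule integral_mult_right_zero)
  finally show ?thesis by (simp only: mult_ac)
qed

lemma integral_chord_kernel_tendsto:
  assumes p: "p \<in> K" and g: "\<And>k. g k \<in> borel_measurable borel" and q: "q \<in> borel_measurable borel"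
    and lim: "\<And>x. x \<in> K \<Longrightarrow> (\<lambda>k. g k (norm (x - p))) \<longlonglongrightarrow> q (norm (x - p))"
    and bound: "\<And>k x. x \<in> K \<Longrightarrow> \<bar>g k (norm (x - p))\<bar> \<le> Q"
  shows "(\<lambda>k. \<integral>x. chord_kernel (g k) p x \<partial>surface S) \<longlonglongrightarrow> (\<integral>x. chord_kernel q p x \<partial>surface S)"
proof (rule integral_dominated_convergence[OF _ _ integrable_surface_inverse_power[OF p]])
  show "AE x in surface S. (\<lambda>k. chord_kernel (g k) p x) \<longlonglongrightarrow> chord_kernel q p x"
    using AE_hausdorff_within[OF S_borel]
  proof eventually_elim
    case (elim x)
    then show ?case
      unfolding chord_kernel_def transverse_field_def divide_inverse using S_subset by (intro tendsto_intros lim) auto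
  qed
  show "AE x in surface S. norm (chord_kernel (g k) p x) \<le> Q / norm (x - p) ^ (DIM('a) - 2)" for k
    using AE_hausdorff_within[OF S_borel]
  proof eventually_elim
    case (elim x)
    then have "\<bar>g k (norm (x - p))\<bar> \<le> Q" using S_subset by (intro bound) auto
    from abs_chord_kernel_le[of "g k", OF this] show ?case by simp
  qed
qed (use g q in measurable)

lemma integral_volume_kernel_tendsto:
  assumes p: "p \<in> K" and g: "\<And>k. g k \<in> borel_measurable borel" and q: "q \<in> borel_measurable borel"
    and lim: "\<And>x. x \<in> K \<Longrightarrow> (\<lambda>k. g k (norm (x - p))) \<longlonglongrightarrow> q (norm (x - p))"
    and bound: "\<And>k x. x \<in> K \<Longrightarrow> \<bar>g k (norm (x - p))\<bar> \<le> Q"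
  shows "(\<lambda>k. \<integral>x. indicator K x * volume_kernel (g k) p x \<partial>lborel) \<longlonglongrightarrow> (\<integral>x. indicator K x * volume_kernel q p x \<partial>lborel)"
proof (rule integral_dominated_convergence)
  have "0 \<le> Q" using order_trans[OF abs_ge_zero bound[OF p]] .
  then show "integrable lborel (\<lambda>x. indicator K x * (Q / norm (x - p) ^ (DIM('a) - 1)))"
    by (intro integrable_indicator_of_singular_bound[OF _ p, where A=Q]) auto
  show "AE x in lborel. (\<lambda>k. indicator K x * volume_kernel (g k) p x) \<longlonglongrightarrow> indicator K x * volume_kernel q p x"
  proof (rule AE_I2)
    fix x show "(\<lambda>k. indicator K x * volume_kernel (g k) p x) \<longlonglongrightarrow> indicator K x * volume_kernel q p x"
    proof (cases "x \<in> K")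
      case True
      then show ?thesis unfolding volume_kernel_def divide_inverse by (intro tendsto_intros lim)
    qed simp
  qed
  show "AE x in lborel. norm (indicator K x * volume_kernel (g k) p x) \<le> indicator K x * (Q / norm (x - p) ^ (DIM('a) - 1))" for k
  proof (rule AE_I2)
    fix x show "norm (indicator K x * volume_kernel (g k) p x) \<le> indicator K x * (Q / norm (x - p) ^ (DIM('a) - 1))"
    proof (cases "x \<in> K")
      case True
      then show ?thesis using abs_volume_kernel_le[of "g k", OF bound[OF True, of k]] by simp
    qed simp
  qed
qed (use g q in measurable)

theorem chord_flux:
  assumes p: "p \<in> S" and q: "continuous_on UNIV q"
  shows "(\<integral>x. chord_kernel q p x \<partial>surface S)
    = - (real DIM('a) - 1) * slice_const TYPE('a) * (\<integral>x. indicator K x * volume_kernel q p x \<partial>lborel)"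
proof -
  have pK: "p \<in> K" using p S_subset by auto
  obtain Q where Q: "\<And>x y. x \<in> K \<Longrightarrow> y \<in> K \<Longrightarrow> \<bar>q (norm (x - y))\<bar> \<le> Q" by (rule continuous_bounded_on_distances[OF q]) blast
  have "\<exists>g. real_polynomial_function g \<and> (\<forall>r\<in>{0..diameter K}. \<bar>q r - g r\<bar> < 1 / real (Suc k))" for k
    by (rule Stone_Weierstrass_real_polynomial_function[OF compact_Icc continuous_on_subset[OF q],
          of 0 "diameter K" "1 / real (Suc k)"]) auto
  then obtain g where g: "\<And>k. real_polynomial_function (g k)"
      and close: "\<And>k r. r \<in> {0..diameter K} \<Longrightarrow> \<bar>q r - g k r\<bar> < 1 / real (Suc k)" by metis
  have cont: "continuous_on UNIV (g k)" for k
    using g by (auto intro: continuous_at_imp_continuous_on continuous_real_polymonial_function)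
  have close': "\<bar>q (norm (x - p)) - g k (norm (x - p))\<bar> \<le> 1 / real (Suc k)" if "x \<in> K" for x k
    using norm_diff_le_diameter[OF that pK] by (intro less_imp_le close) simp
  have lim: "(\<lambda>k. g k (norm (x - p))) \<longlonglongrightarrow> q (norm (x - p))" if "x \<in> K" for x
    by (rule LIM_zero_cancel, rule Lim_null_comparison[OF _ LIMSEQ_Suc[OF lim_1_over_n]])
      (use close'[OF that] in \<open>simp add: abs_minus_commute\<close>)
  have bound: "\<bar>g k (norm (x - p))\<bar> \<le> Q + 1" if "x \<in> K" for k x
    using close'[OF that, of k] Q[OF that pK] by (smt (verit) divide_le_eq_1 of_nat_Suc of_nat_0_le_iff)
  have measurable: "q \<in> borel_measurable borel" "\<And>k. g k \<in> borel_measurable borel"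
    using q cont by (auto intro: borel_measurable_continuous_onI)
  have flux: "(\<integral>x. chord_kernel (g k) p x \<partial>surface S)
      = - (real DIM('a) - 1) * slice_const TYPE('a) * (\<integral>x. indicator K x * volume_kernel (g k) p x \<partial>lborel)" for k
  proof -
    obtain g' where g': "real_polynomial_function g'" "\<And>r. (g k has_real_derivative g' r) (at r)"
      using has_real_derivative_polynomial_function[OF g] by blast
    then have "continuous_on UNIV g'" by (auto intro: continuous_at_imp_continuous_on continuous_real_polymonial_function)
    then show ?thesis using chord_flux_of_derivative[OF p g'(2)] by blast
  qed
  have "(\<lambda>k. \<integral>x. chord_kernel (g k) p x \<partial>surface S) \<longlonglongrightarrow> (\<integral>x. chord_kernel q p x \<partial>surface S)"
    by (rule integral_chord_kernel_tendsto[OF pK measurable(2,1) lim bound])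
  moreover have "(\<lambda>k. \<integral>x. chord_kernel (g k) p x \<partial>surface S)
      \<longlonglongrightarrow> - (real DIM('a) - 1) * slice_const TYPE('a) * (\<integral>x. indicator K x * volume_kernel q p x \<partial>lborel)"
    unfolding flux by (intro tendsto_mult_left integral_volume_kernel_tendsto[OF pK measurable(2,1) lim bound])
  ultimately show ?thesis by (rule LIMSEQ_unique)
qed

end

section \<open>Chord lengths\<close>

lemma integral_radial_measure:
  fixes f :: "real \<Rightarrow> real"
  assumes [measurable]: "f \<in> borel_measurable borel"
  shows "(\<integral>t. f t \<partial>radial_measure d) = (\<integral>t. indicator {0<..} t * (t ^ (d - 1) * f t) \<partial>lborel)"
  unfolding radial_measure_def by (subst integral_density) (auto simp: indicator_def intro!: Bochner_Integration.integral_cong)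

context smooth_body
begin

definition chord_length :: "'a \<Rightarrow> 'a \<Rightarrow> real" where
  "chord_length x u = measure lborel {t. x + t *\<^sub>R u \<in> K}"

lemma line_slice_borel [measurable]: "{t. x + t *\<^sub>R u \<in> K} \<in> sets borel"
  by measurable

lemma chord_length_measurable [measurable (raw)]:
  assumes [measurable]: "f \<in> borel_measurable M" "g \<in> borel_measurable M"
  shows "(\<lambda>x. chord_length (f x) (g x)) \<in> borel_measurable M"
proof -
  have "emeasure lborel {t. x + t *\<^sub>R u \<in> K} = (\<integral>\<^sup>+t. indicator {t. x + t *\<^sub>R u \<in> K} t \<partial>lborel)" for x u by simp
  then have "chord_length x u = enn2real (\<integral>\<^sup>+t. indicator K (x + t *\<^sub>R u) \<partial>lborel)" for x u
    by (simp add: chord_length_def measure_def indicator_def)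
  then show ?thesis by simp
qed

lemma chord_length_translate: "chord_length (x + s *\<^sub>R u) u = chord_length x u"
proof -
  have "emeasure lborel {t. x + t *\<^sub>R u \<in> K} = emeasure (distr lborel borel ((+) s)) {t. x + t *\<^sub>R u \<in> K}"
    by (subst lborel_distr_plus) simp
  also have "\<dots> = emeasure lborel {t. x + (s + t) *\<^sub>R u \<in> K}"
    using line_slice_borel by (subst emeasure_distr) (auto simp: vimage_def)
  finally show ?thesis by (simp add: chord_length_def measure_def algebra_simps)
qed

lemma chord_length_eq_heights:
  assumes "norm u = 1" "x + t *\<^sub>R u \<in> K"
  shows "chord_length x u = height u x + height (- u) x"
proof -
  note slice = line_slice_eq_Icc[OF assms]
  have "t \<in> {- height (- u) x..height u x}" using assms(2) unfolding slice[symmetric] by simp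
  then show ?thesis by (simp add: chord_length_def slice)
qed

lemma chord_length_eq_distance:
  assumes u: "norm u = 1"
  obtains y z where "y \<in> K" "z \<in> K" "chord_length x u = norm (y - z)"
proof (cases "\<exists>t. x + t *\<^sub>R u \<in> K")
  case True
  then obtain t where t: "x + t *\<^sub>R u \<in> K" ..
  have "top_point u x \<in> K" "top_point (- u) x \<in> K"
    using top_point_in_K(1)[OF u t] top_point_in_K(1)[of "- u" x "- t"] u t by auto
  moreover have "top_point u x - top_point (- u) x = chord_length x u *\<^sub>R u"
    by (simp add: top_point_def chord_length_eq_heights[OF u t] algebra_simps)
  then have "norm (top_point u x - top_point (- u) x) = chord_length x u"
    using u by (simp add: chord_length_def)
  ultimately show ?thesis using that by metis
next
  case False
  obtain y where "y \<in> K" using interior_K interior_subset by blast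
  then show ?thesis using False by (intro that[of y y]) (auto simp: chord_length_def)
qed

lemma hausdorff_outer_chord:
  assumes u: "norm u = 1"
  shows "enn2real (hausdorff_outer 1 (line_through y u \<inter> K)) = chord_length y u"
proof -
  let ?T = "{t. y + t *\<^sub>R u \<in> K}"
  have "line_through y u \<inter> K = (\<lambda>t. y + t *\<^sub>R u) ` ?T" by (auto simp: line_through_def)
  moreover have "hausdorff_outer 1 ((\<lambda>t. y + t *\<^sub>R u) ` ?T) = hausdorff_outer 1 ?T"
  proof (rule hausdorff_outer_isometry)
    fix s t :: real
    have "(y + s *\<^sub>R u) - (y + t *\<^sub>R u) = (s - t) *\<^sub>R u" by (simp add: algebra_simps)
    then show "dist (y + s *\<^sub>R u) (y + t *\<^sub>R u) = dist s t" unfolding dist_norm using u by simp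
  qed simp
  ultimately show ?thesis
    by (simp add: hausdorff_outer_1_eq_lborel[OF line_slice_borel] chord_length_def measure_def)
qed

lemma entering_ray_slice:
  assumes p: "p \<in> S" and u: "norm u = 1" "n p \<bullet> u < 0"
  shows "{t. p + t *\<^sub>R u \<in> K} = {0..chord_length p u}"
proof -
  have p0: "p + 0 *\<^sub>R u \<in> K" using p S_subset by auto
  let ?a = "- height (- u) p" and ?b = "height u p"
  note slice = line_slice_eq_Icc[OF u(1) p0]
  have "0 \<in> {?a..?b}" using p0 unfolding slice[symmetric] by simp
  then have "?a \<in> {?a..?b}" by simp
  then have "p + ?a *\<^sub>R u \<in> K" unfolding slice[symmetric] by simp
  then have "?a * (n p \<bullet> u) \<le> 0" using normal_le[OF p] by (force simp: inner_commute)
  then have "0 \<le> ?a" using u(2) by (auto simp: zero_le_mult_iff mult_le_0_iff)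
  then have "?a = 0" using \<open>0 \<in> {?a..?b}\<close> by simp
  then show ?thesis using slice chord_length_eq_heights[OF u(1) p0] by simp
qed

text \<open>The lines in direction \<open>u\<close>, counted at the boundary point where they enter the body.\<close>

definition entering_chord :: "(real \<Rightarrow> real) \<Rightarrow> 'a \<Rightarrow> 'a \<Rightarrow> real" where
  "entering_chord h p u = max 0 (n p \<bullet> (- u)) * h (chord_length p u)"

lemma entering_chord_measurable [measurable (raw)]:
  assumes [measurable]: "h \<in> borel_measurable borel" "f \<in> borel_measurable M" "g \<in> borel_measurable M"
  shows "(\<lambda>x. entering_chord h (f x) (g x)) \<in> borel_measurable M"
  unfolding entering_chord_def by measurable

lemma integral_entering_ray:
  assumes p: "p \<in> S" and u: "norm u = 1" "n p \<bullet> u < 0"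
    and h: "\<And>t. (h has_real_derivative h' t) (at t)" "continuous_on UNIV h'" "h 0 = 0"
  shows "(\<integral>t. indicator {0<..} t * (indicator K (p + t *\<^sub>R u) * h' t) \<partial>lborel) = h (chord_length p u)"
proof -
  let ?b = "chord_length p u"
  have indicator_eq: "indicator K (p + t *\<^sub>R u) = (indicator {0..?b} t :: real)" for t
    unfolding entering_ray_slice[OF p u, symmetric] by (simp add: indicator_def)
  have [measurable]: "h' \<in> borel_measurable borel" using h(2) by (rule borel_measurable_continuous_onI)
  have "(\<integral>t. indicator {0<..} t * (indicator K (p + t *\<^sub>R u) * h' t) \<partial>lborel) = (\<integral>t. indicator {0..?b} t *\<^sub>R h' t \<partial>lborel)"
  proof (rule integral_cong_AE)
    show "AE t in lborel. indicator {0<..} t * (indicator K (p + t *\<^sub>R u) * h' t) = indicator {0..?b} t *\<^sub>R h' t"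
      unfolding indicator_eq using AE_lborel_singleton[of "0::real"] by eventually_elim (auto simp: indicator_def)
  qed measurable
  also have "\<dots> = h ?b - h 0"
    using h by (intro integral_FTC_Icc) (auto simp: chord_length_def has_real_derivative_iff_has_vector_derivative
        has_vector_derivative_at_within intro: continuous_on_subset)
  finally show ?thesis using h(3) by simp
qed

lemma integral_volume_kernel_ray:
  assumes p: "p \<in> S" and u: "norm u = 1"
    and h: "\<And>t. (h has_real_derivative h' t) (at t)" "continuous_on UNIV h'" "h 0 = 0"
  shows "(\<integral>t. indicator K (p + t *\<^sub>R u) * volume_kernel h' p (p + t *\<^sub>R u) \<partial>radial_measure DIM('a)) = - entering_chord h p u"
proof -
  have [measurable]: "h' \<in> borel_measurable borel" using h(2) by (rule borel_measurable_continuous_onI)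
  have integrand: "indicator {0<..} t * (t ^ (DIM('a) - 1) * (indicator K (p + t *\<^sub>R u) * volume_kernel h' p (p + t *\<^sub>R u)))
      = (n p \<bullet> u) * (indicator {0<..} t * (indicator K (p + t *\<^sub>R u) * h' t))" for t
    using u by (cases "0 < t") (simp_all add: volume_kernel_def sgn_scaleR sgn_div_norm)
  have "(\<integral>t. indicator K (p + t *\<^sub>R u) * volume_kernel h' p (p + t *\<^sub>R u) \<partial>radial_measure DIM('a))
      = (n p \<bullet> u) * (\<integral>t. indicator {0<..} t * (indicator K (p + t *\<^sub>R u) * h' t) \<partial>lborel)"
    by (subst integral_radial_measure) (simp_all only: integrand integral_mult_right_zero, measurable)
  also have "\<dots> = - entering_chord h p u"
  proof -
    consider (entering) "n p \<bullet> u < 0" | (tangential) "n p \<bullet> u = 0" | (leaving) "0 < n p \<bullet> u" by linarith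
    then show ?thesis
    proof cases
      case entering
      then show ?thesis using integral_entering_ray[OF p u entering h] by (simp add: entering_chord_def)
    next
      case tangential
      then show ?thesis by (simp add: entering_chord_def)
    next
      case leaving
      have "p + t *\<^sub>R u \<notin> K" if "0 < t" for t
        using normal_le[OF p, of "p + t *\<^sub>R u"] mult_pos_pos[OF that leaving] by (auto simp: inner_commute)
      then have "(\<lambda>t. indicator {0<..} t * (indicator K (p + t *\<^sub>R u) * h' t)) = (\<lambda>_. 0)"
        by (auto simp: fun_eq_iff indicator_def)
      then show ?thesis using leaving by (simp add: entering_chord_def)
    qed
  qed
  finally show ?thesis .
qed

lemma integral_entering_chord_directional:
  assumes u: "norm u = 1" and [measurable]: "h \<in> borel_measurable borel" and h0: "h 0 = 0"
  shows "(\<integral>x. entering_chord h x u \<partial>surface S) = (\<integral>y. h (chord_length y u) \<partial>surface (hplane u))"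
proof -
  have u': "norm (- u) = 1" using u by simp
  note [measurable] = top_point_measurable[OF u']
  have "chord_length (top_point (- u) y) u = chord_length y u" for y
    unfolding top_point_uminus by (rule chord_length_translate)
  then have "(\<integral>x. entering_chord h x u \<partial>surface S) = (\<integral>y. indicator (shadow u) y * h (chord_length y u) \<partial>surface (hplane u))"
    unfolding entering_chord_def
    using integral_projection[OF u', of "\<lambda>x. h (chord_length x u)"] by (simp add: shadow_uminus)
  also have "\<dots> = (\<integral>y. h (chord_length y u) \<partial>surface (hplane u))"
  proof (rule integral_cong_AE)
    show "AE y in surface (hplane u). indicator (shadow u) y * h (chord_length y u) = h (chord_length y u)"
      using AE_shadow[OF u]
    proof eventually_elim
      case (elim y)
      show ?case
      proof (cases "y \<in> shadow u")
        case False
        then have "{t. y + t *\<^sub>R u \<in> K} = {}" using elim by auto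
        then show ?thesis using h0 by (simp add: chord_length_def)
      qed simp
    qed
  qed measurable
  finally show ?thesis .
qed

lemma lines_integral_chord_length:
  assumes h [measurable]: "h \<in> borel_measurable borel" and h0: "h 0 = 0"
  shows "lines_integral (\<lambda>G. if G \<inter> K \<noteq> {} then h (enn2real (hausdorff_outer 1 (G \<inter> K))) else 0)
    = (\<integral>u. \<integral>x. entering_chord h x u \<partial>surface S \<partial>surface (sphere 0 1)) / omega DIM('a)"
proof -
  let ?s = "real DIM('a) - 1"
  interpret finite_measure "surface S" by (rule finite_surface)
  have sphere: "sphere (0::'a) 1 \<in> sets borel" by simp
  have "(\<integral>y. (if line_through y u \<inter> K \<noteq> {} then h (enn2real (hausdorff_outer 1 (line_through y u \<inter> K))) else 0)
      \<partial>hausdorff_on ?s (hplane u)) = (\<integral>x. entering_chord h x u \<partial>surface S)"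
    if "u \<in> space (hausdorff_on ?s (sphere 0 1))" for u
  proof -
    have u: "norm u = 1" using that by (simp add: space_hausdorff_on[OF sphere])
    have "(if line_through y u \<inter> K \<noteq> {} then h (enn2real (hausdorff_outer 1 (line_through y u \<inter> K))) else 0)
        = h (chord_length y u)" for y
      unfolding hausdorff_outer_chord[OF u, symmetric] using h0 by (simp add: hausdorff_outer.empty)
    then show ?thesis
      by (simp add: integral_entering_chord_directional[OF u h h0] integral_hausdorff_on[OF hplane_borel])
  qed
  then have "lines_integral (\<lambda>G. if G \<inter> K \<noteq> {} then h (enn2real (hausdorff_outer 1 (G \<inter> K))) else 0)
      = (\<integral>u. \<integral>x. entering_chord h x u \<partial>surface S \<partial>hausdorff_on ?s (sphere 0 1)) / omega DIM('a)"
    unfolding lines_integral_def by (simp cong: Bochner_Integration.integral_cong)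
  then show ?thesis by (simp add: integral_hausdorff_on[OF sphere])
qed

section \<open>The double integral over the boundary\<close>

lemma nn_integral_chord_kernel_le:
  assumes p: "p \<in> K" and Q: "\<And>x y. x \<in> K \<Longrightarrow> y \<in> K \<Longrightarrow> \<bar>q (norm (x - y))\<bar> \<le> Q"
  shows "(\<integral>\<^sup>+x. ennreal \<bar>chord_kernel q p x\<bar> \<partial>surface S)
    \<le> ennreal Q * (\<integral>\<^sup>+x. ennreal (1 / norm (x - p) ^ (DIM('a) - 2)) \<partial>surface S)"
proof -
  have Q0: "0 \<le> Q" using order_trans[OF abs_ge_zero Q[OF p p]] .
  have "(\<integral>\<^sup>+x. ennreal \<bar>chord_kernel q p x\<bar> \<partial>surface S)
      \<le> (\<integral>\<^sup>+x. ennreal Q * ennreal (1 / norm (x - p) ^ (DIM('a) - 2)) \<partial>surface S)"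
  proof (rule nn_integral_mono_AE, use AE_hausdorff_within[OF S_borel] in eventually_elim)
    case (elim x)
    then have "\<bar>chord_kernel q p x\<bar> \<le> Q / norm (x - p) ^ (DIM('a) - 2)"
      using p S_subset by (intro abs_chord_kernel_le Q) auto
    then show ?case using Q0 by (subst ennreal_mult[symmetric]) (auto intro: ennreal_leI)
  qed
  then show ?thesis by (simp add: nn_integral_cmult)
qed

lemma integrable_chord_kernel_pair:
  assumes q: "continuous_on UNIV q"
  shows "integrable (surface S \<Otimes>\<^sub>M surface S) (\<lambda>(x, y). chord_kernel q x y)"
proof (rule integrableI_bounded)
  interpret S: finite_measure "surface S" by (rule finite_surface)
  have [measurable]: "q \<in> borel_measurable borel" using q by (rule borel_measurable_continuous_onI)
  show "(\<lambda>(x, y). chord_kernel q x y) \<in> borel_measurable (surface S \<Otimes>\<^sub>M surface S)" by measurable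
  obtain Q where Q: "\<And>x y. x \<in> K \<Longrightarrow> y \<in> K \<Longrightarrow> \<bar>q (norm (x - y))\<bar> \<le> Q" by (rule continuous_bounded_on_distances[OF q]) blast
  obtain C where C: "\<And>p. p \<in> K \<Longrightarrow> (\<integral>\<^sup>+x. ennreal (1 / norm (x - p) ^ (DIM('a) - 2)) \<partial>surface S) \<le> ennreal C"
    using nn_integral_inverse_power_bounded by blast
  have "(\<integral>\<^sup>+p. ennreal (norm (case p of (x, y) \<Rightarrow> chord_kernel q x y)) \<partial>(surface S \<Otimes>\<^sub>M surface S))
      = (\<integral>\<^sup>+x. \<integral>\<^sup>+y. ennreal \<bar>chord_kernel q x y\<bar> \<partial>surface S \<partial>surface S)"
    by (subst S.nn_integral_fst[symmetric]) auto
  also have "\<dots> \<le> (\<integral>\<^sup>+x. ennreal Q * ennreal C \<partial>surface S)"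
  proof (rule nn_integral_mono_AE, use AE_hausdorff_within[OF S_borel] in eventually_elim)
    case (elim x)
    then have "x \<in> K" using S_subset by auto
    from order_trans[OF nn_integral_chord_kernel_le[of x q Q, OF this Q] mult_left_mono[OF C[OF this]]]
    show ?case by simp
  qed
  also have "\<dots> < \<infinity>"
    using S.emeasure_finite[of UNIV, unfolded infinity_ennreal_def]
    by (simp add: ennreal_mult_eq_top_iff less_top[symmetric])
  finally show "(\<integral>\<^sup>+p. ennreal (norm (case p of (x, y) \<Rightarrow> chord_kernel q x y)) \<partial>(surface S \<Otimes>\<^sub>M surface S)) < \<infinity>" .
qed

lemma integral_chord_kernel:
  assumes p: "p \<in> S" and h: "\<And>t. (h has_real_derivative h' t) (at t)" "continuous_on UNIV h'" "h 0 = 0"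
  shows "(\<integral>x. chord_kernel h' p x \<partial>surface S) = (real DIM('a) - 1) * (\<integral>u. entering_chord h p u \<partial>surface (sphere 0 1))"
proof -
  have pK: "p \<in> K" using p S_subset by auto
  have "continuous_on UNIV h" using h(1) by (meson DERIV_isCont continuous_at_imp_continuous_on)
  then have [measurable]: "h' \<in> borel_measurable borel" "h \<in> borel_measurable borel"
    using h(2) by (auto intro: borel_measurable_continuous_onI)
  let ?G = "\<lambda>x. indicator K x * volume_kernel h' p x"
  obtain Q where Q: "\<And>x y. x \<in> K \<Longrightarrow> y \<in> K \<Longrightarrow> \<bar>h' (norm (x - y))\<bar> \<le> Q" by (rule continuous_bounded_on_distances[OF h(2)]) blast
  have "integrable lborel ?G"
    by (rule integrable_indicator_of_singular_bound[OF _ pK abs_volume_kernel_le[of h' _ p Q, OF Q[OF _ pK]]]) measurable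
  then have translated: "integrable (distr lborel borel ((+) p)) ?G" by (simp add: lborel_distr_plus)
  have "slice_const TYPE('a) * (\<integral>x. ?G x \<partial>lborel) = slice_const TYPE('a) * (\<integral>x. ?G x \<partial>distr lborel borel ((+) p))"
    by (simp add: lborel_distr_plus)
  also have "\<dots> = slice_const TYPE('a) * (\<integral>z. ?G (p + z) \<partial>lborel)" by (subst integral_distr) auto
  also have "\<dots> = (\<integral>u. \<integral>t. ?G (p + t *\<^sub>R u) \<partial>radial_measure DIM('a) \<partial>surface (sphere 0 1))"
    using translated by (intro integral_polar_coordinates[OF dim, symmetric]) (subst (asm) integrable_distr_eq, auto)
  also have "\<dots> = (\<integral>u. - entering_chord h p u \<partial>surface (sphere 0 1))"
  proof (rule integral_cong_AE)
    interpret sigma_finite_measure "radial_measure DIM('a)" by (rule sigma_finite_radial_measure)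
    show "(\<lambda>u. \<integral>t. ?G (p + t *\<^sub>R u) \<partial>radial_measure DIM('a)) \<in> borel_measurable (surface (sphere 0 1))"
      by measurable
    show "AE u in surface (sphere 0 1). (\<integral>t. ?G (p + t *\<^sub>R u) \<partial>radial_measure DIM('a)) = - entering_chord h p u"
      using AE_hausdorff_within[OF borel_closed[OF closed_sphere]]
    proof eventually_elim
      case (elim u)
      then show ?case by (intro integral_volume_kernel_ray p h) simp
    qed
  qed measurable
  also have "\<dots> = - (\<integral>u. entering_chord h p u \<partial>surface (sphere 0 1))" by (rule integral_minus)
  finally have "slice_const TYPE('a) * (\<integral>x. ?G x \<partial>lborel) = - (\<integral>u. entering_chord h p u \<partial>surface (sphere 0 1))" .
  then show ?thesis
    using chord_flux[OF p h(2)] by (simp only: mult.assoc minus_mult_minus)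
qed

lemma integrable_entering_chord:
  assumes h: "continuous_on UNIV h"
  shows "integrable (surface S \<Otimes>\<^sub>M surface (sphere 0 1)) (\<lambda>(x, u). entering_chord h x u)"
proof -
  interpret S: finite_measure "surface S" by (rule finite_surface)
  interpret U: finite_measure "surface (sphere (0::'a) 1)" by (rule finite_surface_sphere[OF dim])
  interpret SU: pair_sigma_finite "surface S" "surface (sphere (0::'a) 1)" ..
  have [measurable]: "h \<in> borel_measurable borel" using h by (rule borel_measurable_continuous_onI)
  obtain Q where Q: "\<And>x y. x \<in> K \<Longrightarrow> y \<in> K \<Longrightarrow> \<bar>h (norm (x - y))\<bar> \<le> Q" by (rule continuous_bounded_on_distances[OF h]) blast
  have bound: "\<bar>entering_chord h x u\<bar> \<le> Q" if u: "norm u = 1" for x u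
  proof -
    obtain y z where "y \<in> K" "z \<in> K" "chord_length x u = norm (y - z)" by (rule chord_length_eq_distance[OF u])
    then have "\<bar>h (chord_length x u)\<bar> \<le> Q" using Q by simp
    moreover have "\<bar>max 0 (n x \<bullet> (- u))\<bar> \<le> 1" using abs_normal_inner_le[of x u] u by auto
    ultimately have "\<bar>max 0 (n x \<bullet> (- u))\<bar> * \<bar>h (chord_length x u)\<bar> \<le> 1 * Q" by (intro mult_mono) auto
    then show ?thesis by (simp add: entering_chord_def abs_mult)
  qed
  have "AE p in surface S \<Otimes>\<^sub>M surface (sphere 0 1). norm (case p of (x, u) \<Rightarrow> entering_chord h x u) \<le> Q"
  proof (rule SU.AE_pair_measure)
    show "AE x in surface S. AE u in surface (sphere 0 1). norm (case (x, u) of (x, u) \<Rightarrow> entering_chord h x u) \<le> Q"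
      by (rule AE_I2, rule eventually_mono[OF AE_hausdorff_within[OF borel_closed[OF closed_sphere]]]) (simp add: bound)
  qed measurable
  then show ?thesis
    by (intro finite_measure.integrable_const_bound[OF finite_measure_pair_measure[OF U.finite_measure_axioms S.finite_measure_axioms]])
      (auto simp: split_beta')
qed

theorem double_integral_chord_kernel:
  assumes h: "\<And>t. (h has_real_derivative h' t) (at t)" "continuous_on UNIV h'" "h 0 = 0"
  shows "(\<integral>(x, y). chord_kernel h' x y \<partial>(surface S \<Otimes>\<^sub>M surface S))
    = (real DIM('a) - 1) * (\<integral>u. \<integral>x. entering_chord h x u \<partial>surface S \<partial>surface (sphere 0 1))"
proof -
  interpret S: finite_measure "surface S" by (rule finite_surface)
  interpret SS: pair_sigma_finite "surface S" "surface S" ..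
  interpret U: finite_measure "surface (sphere (0::'a) 1)" by (rule finite_surface_sphere[OF dim])
  interpret SU: pair_sigma_finite "surface S" "surface (sphere (0::'a) 1)" ..
  have cont: "continuous_on UNIV h" using h(1) by (meson DERIV_isCont continuous_at_imp_continuous_on)
  then have [measurable]: "h' \<in> borel_measurable borel" "h \<in> borel_measurable borel"
    using h(2) by (auto intro: borel_measurable_continuous_onI)
  have "(\<integral>(x, y). chord_kernel h' x y \<partial>(surface S \<Otimes>\<^sub>M surface S)) = (\<integral>x. \<integral>y. chord_kernel h' x y \<partial>surface S \<partial>surface S)"
    using SS.integral_fst'[OF integrable_chord_kernel_pair[OF h(2)]] by simp
  also have "\<dots> = (\<integral>x. (real DIM('a) - 1) * (\<integral>u. entering_chord h x u \<partial>surface (sphere 0 1)) \<partial>surface S)"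
  proof (rule integral_cong_AE)
    show "AE x in surface S. (\<integral>y. chord_kernel h' x y \<partial>surface S)
        = (real DIM('a) - 1) * (\<integral>u. entering_chord h x u \<partial>surface (sphere 0 1))"
      using AE_hausdorff_within[OF S_borel] by eventually_elim (rule integral_chord_kernel[OF _ h])
  qed measurable
  also have "\<dots> = (real DIM('a) - 1) * (\<integral>x. \<integral>u. entering_chord h x u \<partial>surface (sphere 0 1) \<partial>surface S)"
    by (rule integral_mult_right_zero)
  also have "(\<integral>x. \<integral>u. entering_chord h x u \<partial>surface (sphere 0 1) \<partial>surface S)
      = (\<integral>u. \<integral>x. entering_chord h x u \<partial>surface S \<partial>surface (sphere 0 1))"
    by (rule SU.Fubini_integral[OF integrable_entering_chord[OF cont], symmetric])
  finally show ?thesis .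
qed

end

section \<open>Angles\<close>

lemma cos_vangle: "cos (vangle u v) = (u \<bullet> v) / (norm u * norm v)"
proof -
  have "\<bar>(u \<bullet> v) / (norm u * norm v)\<bar> \<le> 1"
    using Cauchy_Schwarz_ineq2[of u v] by (cases "norm u * norm v = 0") (auto simp: abs_mult divide_le_eq_1)
  then show ?thesis unfolding vangle_def by (intro cos_arccos_abs)
qed

lemma cos_vangle_proj_perp:
  fixes m u :: "'a::euclidean_space"
  assumes "norm m = 1" "norm u = 1"
  shows "cos (vangle u (proj_perp m u)) = norm (proj_perp u m)"
proof -
  have norm: "(norm (proj_perp m u))\<^sup>2 = 1 - (m \<bullet> u)\<^sup>2" "(norm (proj_perp u m))\<^sup>2 = 1 - (m \<bullet> u)\<^sup>2"
    using norm_proj_perp_power2[of m u] norm_proj_perp_power2[of u m] assms by (simp_all add: inner_commute)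
  have "u \<bullet> proj_perp m u = (norm (proj_perp m u))\<^sup>2"
    unfolding norm using assms by (simp add: proj_perp_def inner_diff_right dot_square_norm inner_commute power2_eq_square)
  moreover have "norm (proj_perp m u) = norm (proj_perp u m)"
    using norm by (simp add: power2_eq_iff_nonneg[symmetric])
  ultimately show ?thesis using assms(2) by (simp add: cos_vangle power2_eq_square)
qed

lemma angle_product:
  fixes m m' u :: "'a::euclidean_space"
  assumes "norm m = 1" "norm m' = 1" "norm u = 1"
  shows "cos (vangle u (proj_perp m u)) * cos (vangle u (proj_perp m' u)) * cos (vangle (proj_perp u m) (proj_perp u m'))
    = proj_perp u m \<bullet> m'"
proof -
  let ?v = "proj_perp u m" and ?w = "proj_perp u m'"
  have "cos (vangle u (proj_perp m u)) * cos (vangle u (proj_perp m' u)) * cos (vangle ?v ?w)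
      = norm ?v * norm ?w * (?v \<bullet> ?w / (norm ?v * norm ?w))"
    by (simp only: cos_vangle_proj_perp[OF assms(1,3)] cos_vangle_proj_perp[OF assms(2,3)] cos_vangle[of ?v ?w])
  also have "\<dots> = ?v \<bullet> ?w" by simp
  also have "\<dots> = ?v \<bullet> m'"
    using proj_perp_inner[OF assms(3), of m] by (simp add: proj_perp_def[of u m'] inner_diff_right)
  finally show ?thesis .
qed

context smooth_body
begin

lemma outer_normal_eq: "x \<in> S \<Longrightarrow> outer_normal K x = n x"
  unfolding outer_normal_def by (rule the_equality) (auto intro: normal_unit normal_le normal_unique)

lemma angle_integrand_eq_chord_kernel:
  assumes xy: "x \<in> S" "y \<in> S"
  shows "q (dist x y) / dist x y ^ (DIM('a) - 2) * cos (alpha_angle K x y x) * cos (alpha_angle K x y y) * cos (phi0_angle K x y)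
    = (if x = y then 0 else chord_kernel q x y)"
proof (cases "x = y")
  case True
  then show ?thesis by (simp add: alpha_angle_def chord_dir_def cos_vangle)
next
  case False
  have dir: "chord_dir x y = sgn (y - x)" by (simp add: chord_dir_def sgn_div_norm)
  have "norm (sgn (y - x)) = 1" using False by (simp add: norm_sgn)
  from angle_product[OF normal_unit[OF xy(1)] normal_unit[OF xy(2)] this]
  have "cos (alpha_angle K x y x) * cos (alpha_angle K x y y) * cos (phi0_angle K x y) = proj_perp (sgn (y - x)) (n x) \<bullet> n y"
    by (simp only: alpha_angle_def phi0_angle_def dir outer_normal_eq xy)
  then show ?thesis
    using False by (simp add: chord_kernel_def transverse_field_def dist_norm norm_minus_commute[of x y] mult.assoc)
qed

end

lemma integral_pair_hausdorff_on:
  fixes f :: "'a::euclidean_space \<times> 'a \<Rightarrow> real"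
  assumes T: "T \<in> sets borel" and finite: "sigma_finite_measure (hausdorff_within s T)"
    and f: "f \<in> borel_measurable (borel \<Otimes>\<^sub>M borel)"
  shows "(\<integral>p. f p \<partial>(hausdorff_on s T \<Otimes>\<^sub>M hausdorff_on s T)) = (\<integral>p. f p \<partial>(hausdorff_within s T \<Otimes>\<^sub>M hausdorff_within s T))"
proof -
  let ?M = "hausdorff_on s T"
  note id = measurable_hausdorff_on_borel[OF T, of s]
  have pair: "hausdorff_within s T \<Otimes>\<^sub>M hausdorff_within s T = distr (?M \<Otimes>\<^sub>M ?M) (borel \<Otimes>\<^sub>M borel) (\<lambda>(x, y). (x, y))"
    using pair_measure_distr[OF id id] finite by (simp add: distr_hausdorff_on[OF T])
  have "(\<lambda>(x, y). (x, y)) \<in> measurable (?M \<Otimes>\<^sub>M ?M) (borel \<Otimes>\<^sub>M borel)"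
    using measurable_Pair[OF measurable_compose[OF measurable_fst id] measurable_compose[OF measurable_snd id]]
    by (simp add: split_beta')
  then show ?thesis unfolding pair using f by (subst integral_distr) (auto simp: split_beta')
qed

context smooth_body
begin

lemma AE_pair_surface_neq: "AE p in surface S \<Otimes>\<^sub>M surface S. fst p \<noteq> snd p"
proof -
  interpret S: finite_measure "surface S" by (rule finite_surface)
  interpret pair_sigma_finite "surface S" "surface S" ..
  show ?thesis
  proof (rule AE_pair_measure)
    show "AE x in surface S. AE y in surface S. fst (x, y) \<noteq> snd (x, y)"
    proof (rule AE_I2)
      fix x show "AE y in surface S. fst (x, y) \<noteq> snd (x, y)"
        using AE_hausdorff_within_neq[OF S_borel, where p=x] by eventually_elim simp
    qed
  qed measurable
qed

lemma integral_angles_eq_chord_kernel: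
  assumes q [measurable]: "q \<in> borel_measurable borel"
  shows "(\<integral>p. (case p of (x, y) \<Rightarrow> q (dist x y) / dist x y ^ (DIM('a) - 2)
        * cos (alpha_angle K x y x) * cos (alpha_angle K x y y) * cos (phi0_angle K x y))
      \<partial>(hausdorff_on (real DIM('a) - 1) S \<Otimes>\<^sub>M hausdorff_on (real DIM('a) - 1) S))
    = (\<integral>(x, y). chord_kernel q x y \<partial>(surface S \<Otimes>\<^sub>M surface S))"
proof -
  interpret S: finite_measure "surface S" by (rule finite_surface)
  let ?M = "hausdorff_on (real DIM('a) - 1) S"
  let ?f = "\<lambda>p. if fst p = snd p then 0 else chord_kernel q (fst p) (snd p)"
  have [measurable]: "?f \<in> borel_measurable (borel \<Otimes>\<^sub>M borel)"
    using chord_kernel_measurable(1)[OF q] by (simp add: split_beta')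
  have "(\<integral>p. (case p of (x, y) \<Rightarrow> q (dist x y) / dist x y ^ (DIM('a) - 2)
        * cos (alpha_angle K x y x) * cos (alpha_angle K x y y) * cos (phi0_angle K x y)) \<partial>(?M \<Otimes>\<^sub>M ?M))
      = (\<integral>p. ?f p \<partial>(?M \<Otimes>\<^sub>M ?M))"
  proof (rule Bochner_Integration.integral_cong[OF refl], goal_cases)
    case (1 p)
    then show ?case
      by (cases p) (simp only: space_pair_measure space_hausdorff_on[OF S_borel] mem_Sigma_iff prod.case fst_conv snd_conv
          angle_integrand_eq_chord_kernel)
  qed
  also have "\<dots> = (\<integral>p. ?f p \<partial>(surface S \<Otimes>\<^sub>M surface S))"
    by (intro integral_pair_hausdorff_on S_borel S.sigma_finite_measure_axioms) measurable
  also have "\<dots> = (\<integral>(x, y). chord_kernel q x y \<partial>(surface S \<Otimes>\<^sub>M surface S))"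
  proof (rule integral_cong_AE)
    show "AE p in surface S \<Otimes>\<^sub>M surface S. ?f p = (case p of (x, y) \<Rightarrow> chord_kernel q x y)"
      using AE_pair_surface_neq by eventually_elim (simp add: split_beta')
  qed measurable
  finally show ?thesis .
qed

end

section \<open>Bodies with \<open>C\<^sup>1\<close> boundary\<close>

lemma unit_eq_sgn_of_half_space:
  fixes G u :: "'a::euclidean_space"
  assumes G: "G \<noteq> 0" and u: "norm u = 1" and half: "\<And>v. G \<bullet> v < 0 \<Longrightarrow> v \<bullet> u \<le> 0"
  shows "u = sgn G"
proof (rule ccontr)
  assume "u \<noteq> sgn G"
  have unit: "u \<bullet> u = 1" "sgn G \<bullet> sgn G = 1" using u G by (simp_all add: norm_sgn flip: norm_eq_1)
  have "0 < (norm (u - sgn G))\<^sup>2" using \<open>u \<noteq> sgn G\<close> by simp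
  also have "\<dots> = 2 * (1 - sgn G \<bullet> u)"
    by (simp add: power2_norm_eq_inner inner_diff_left inner_diff_right inner_commute[of u "sgn G"] unit)
  finally have less: "sgn G \<bullet> u < 1" by simp
  have "G \<bullet> (u - sgn G) = norm G * (sgn G \<bullet> (u - sgn G))" by (simp only: inner_scaleR_left[symmetric] norm_scaleR_sgn)
  also have "sgn G \<bullet> (u - sgn G) = sgn G \<bullet> u - 1" by (simp add: inner_diff_right unit)
  finally have "G \<bullet> (u - sgn G) < 0" using G less by (simp add: mult_pos_neg)
  from half[OF this] show False using less by (simp add: inner_diff_left unit)
qed

lemma sublevel_set_contains_descent:
  fixes g :: "'a::real_inner \<Rightarrow> real"
  assumes g: "(g has_derivative (\<lambda>v. G \<bullet> v)) (at x)" and U: "open U" "x \<in> U" and gx: "g x \<le> 0" and v: "G \<bullet> v < 0"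
  obtains t where "0 < t" "x + t *\<^sub>R v \<in> U" "g (x + t *\<^sub>R v) \<le> 0"
proof -
  have "((\<lambda>t. g (x + t *\<^sub>R v)) has_real_derivative G \<bullet> v) (at 0)" by (rule has_real_derivative_along_line[OF g])
  from DERIV_neg_dec_right[OF this v] obtain d where d: "d > 0" "\<And>t. 0 < t \<Longrightarrow> t < d \<Longrightarrow> g (x + t *\<^sub>R v) < g x" by auto
  have "((\<lambda>t. x + t *\<^sub>R v) \<longlongrightarrow> x + 0 *\<^sub>R v) (at_right 0)" by (intro tendsto_intros)
  then have "\<forall>\<^sub>F t in at_right 0. x + t *\<^sub>R v \<in> U" using U by (auto dest: topological_tendstoD)
  moreover have "\<forall>\<^sub>F t in at_right (0::real). 0 < t \<and> t < d" using d(1) by (auto intro!: eventually_at_rightI[of 0 d])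
  ultimately have "\<forall>\<^sub>F t in at_right (0::real). x + t *\<^sub>R v \<in> U \<and> 0 < t \<and> t < d" by eventually_elim auto
  then obtain t where "x + t *\<^sub>R v \<in> U" "0 < t" "t < d"
    using eventually_happens[of _ "at_right (0::real)"] by (auto simp: trivial_limit_at_right_real)
  then show ?thesis using d(2)[of t] gx by (intro that[of t]) auto
qed

lemma C1_boundary_normal_unique:
  fixes K :: "'a::euclidean_space set"
  assumes K: "closed K" and C1: "C1_boundary K" and x: "x \<in> frontier K"
  obtains v where "\<And>u. norm u = 1 \<Longrightarrow> (\<And>y. y \<in> K \<Longrightarrow> (y - x) \<bullet> u \<le> 0) \<Longrightarrow> u = v"
proof -
  obtain U g g' where "open U \<and> x \<in> U \<and> (\<forall>y\<in>U. (g has_derivative (\<lambda>v. g' y \<bullet> v)) (at y)) \<and>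
      continuous_on U g' \<and> (\<forall>y\<in>U. g' y \<noteq> 0) \<and> K \<inter> U = {y\<in>U. g y \<le> (0::real)}"
    using bspec[OF C1[unfolded C1_boundary_def] x] by (elim exE) (rule that)
  then have U: "open U" "x \<in> U" and g: "(g has_derivative (\<lambda>v. g' x \<bullet> v)) (at x)" "g' x \<noteq> 0"
    and KU: "K \<inter> U = {y\<in>U. g y \<le> 0}" by blast+
  have gx: "g x \<le> 0" using x K frontier_subset_closed U KU by blast
  show ?thesis
  proof (rule that, rule unit_eq_sgn_of_half_space[OF g(2)])
    fix u v assume u: "\<And>y. y \<in> K \<Longrightarrow> (y - x) \<bullet> u \<le> 0" and v: "g' x \<bullet> v < 0"
    obtain t where t: "0 < t" "x + t *\<^sub>R v \<in> U" "g (x + t *\<^sub>R v) \<le> 0"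
      by (rule sublevel_set_contains_descent[OF g(1) U gx v])
    then have "x + t *\<^sub>R v \<in> K" using KU by blast
    from u[OF this] show "v \<bullet> u \<le> 0" using t(1) by (simp add: mult_le_0_iff)
  qed
qed

lemma convex_supporting_normal:
  fixes K :: "'a::euclidean_space set"
  assumes "convex K" "interior K \<noteq> {}" "x \<in> frontier K"
  obtains u where "norm u = 1" "\<And>y. y \<in> K \<Longrightarrow> (y - x) \<bullet> u \<le> 0"
proof -
  have "x \<in> closure K" "x \<notin> rel_interior K"
    using assms by (auto simp: frontier_def rel_interior_nonempty_interior)
  then obtain a where a: "a \<noteq> 0" "\<And>y. y \<in> closure K \<Longrightarrow> a \<bullet> x \<le> a \<bullet> y"
    using supporting_hyperplane_relative_frontier[OF assms(1), of x] by metis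
  show ?thesis
  proof (rule that[of "- sgn a"])
    fix y assume "y \<in> K"
    then have "a \<bullet> x \<le> a \<bullet> y" using a(2) closure_subset by auto
    then show "(y - x) \<bullet> - sgn a \<le> 0"
      using a(1) by (simp add: sgn_div_norm inner_diff_left inner_diff_right inner_commute[of _ a])
  qed (use a in \<open>simp add: norm_sgn\<close>)
qed

lemma smooth_body_outer_normal:
  fixes K :: "'a::euclidean_space set"
  assumes dim: "DIM('a) \<ge> 2" and K: "convex_body K" and C1: "C1_boundary K"
  shows "smooth_body K (\<lambda>x. if x \<in> frontier K then outer_normal K x else 0)"
proof -
  have K: "compact K" "convex K" "interior K \<noteq> {}" "closed K"
    using K by (auto simp: convex_body_def compact_imp_closed)
  have unique: "\<exists>!u. norm u = 1 \<and> (\<forall>y\<in>K. (y - x) \<bullet> u \<le> 0)" if x: "x \<in> frontier K" for x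
  proof -
    obtain v where v: "\<And>u. norm u = 1 \<Longrightarrow> (\<And>y. y \<in> K \<Longrightarrow> (y - x) \<bullet> u \<le> 0) \<Longrightarrow> u = v"
      using C1_boundary_normal_unique[OF K(4) C1 x] by blast
    obtain u where "norm u = 1" "\<And>y. y \<in> K \<Longrightarrow> (y - x) \<bullet> u \<le> 0"
      using convex_supporting_normal[OF K(2,3) x] by blast
    then show ?thesis using v by (metis (no_types, lifting))
  qed
  have normal: "norm (outer_normal K x) = 1 \<and> (\<forall>y\<in>K. (y - x) \<bullet> outer_normal K x \<le> 0)" if "x \<in> frontier K" for x
    unfolding outer_normal_def by (rule theI'[OF unique[OF that]])
  show ?thesis
  proof
    fix x u assume x: "x \<in> frontier K" and u: "norm u = 1" "\<And>y. y \<in> K \<Longrightarrow> (y - x) \<bullet> u \<le> 0"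
    then have "u = outer_normal K x" using unique[OF x] normal[OF x] by blast
    then show "u = (if x \<in> frontier K then outer_normal K x else 0)" using x by simp
  qed (use dim K normal in auto)
qed

theorem theorem1:
  fixes K :: "'a::euclidean_space set" and h :: "real \<Rightarrow> real" and h' :: "real \<Rightarrow> real"
  assumes "DIM('a) \<ge> 2"
    and "convex_body K" and "C1_boundary K"
    and "\<And>t. (h has_real_derivative h' t) (at t)" and "continuous_on UNIV h'"
    and "h 0 = 0"
  shows "lines_integral (\<lambda>G. if G \<inter> K \<noteq> {} then h (enn2real (hausdorff_outer 1 (G \<inter> K))) else 0)
       = 1 / ((real DIM('a) - 1) * omega DIM('a)) *
         (\<integral>p. (case p of (x1, x2) \<Rightarrow>
              h' (dist x1 x2) / dist x1 x2 ^ (DIM('a) - 2)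
              * cos (alpha_angle K x1 x2 x1) * cos (alpha_angle K x1 x2 x2)
              * cos (phi0_angle K x1 x2))
           \<partial>(hausdorff_on (real DIM('a) - 1) (frontier K)
              \<Otimes>\<^sub>M hausdorff_on (real DIM('a) - 1) (frontier K)))"
proof -
  interpret smooth_body K "\<lambda>x. if x \<in> frontier K then outer_normal K x else 0"
    by (rule smooth_body_outer_normal[OF assms(1-3)])
  have "continuous_on UNIV h" using assms(4) by (meson DERIV_isCont continuous_at_imp_continuous_on)
  then have measurable: "h \<in> borel_measurable borel" "h' \<in> borel_measurable borel"
    using assms(5) by (auto intro: borel_measurable_continuous_onI)
  let ?d = "real DIM('a)"
  let ?I = "\<integral>u. \<integral>x. entering_chord h x u \<partial>surface (frontier K) \<partial>surface (sphere 0 1)"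
  have "lines_integral (\<lambda>G. if G \<inter> K \<noteq> {} then h (enn2real (hausdorff_outer 1 (G \<inter> K))) else 0) = ?I / omega DIM('a)"
    by (rule lines_integral_chord_length[OF measurable(1) assms(6)])
  also have "\<dots> = 1 / ((?d - 1) * omega DIM('a)) * ((?d - 1) * ?I)"
    using assms(1) by simp
  also have "(?d - 1) * ?I = (\<integral>(x, y). chord_kernel h' x y \<partial>(surface (frontier K) \<Otimes>\<^sub>M surface (frontier K)))"
    by (rule double_integral_chord_kernel[OF assms(4-6), symmetric])
  finally show ?thesis unfolding integral_angles_eq_chord_kernel[OF measurable(2)] .
qed

end
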